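(* In the two-group random mixture model, fix a level $\alpha\in[0,1]$. (i) For any $\beta\ge\mathsf{mFNR}^*(\alpha)$, the procedure $\delta^n_{\rm NP}(\alpha)$ satisfies, for any $\epsilon>0$, as $n\to\infty$, $$\mathbb P\big(\mathrm{FDP}(\delta^n_{\rm NP}(\alpha))\le\alpha+\epsilon\big)=1-o(1)\quad\text{and}\quad \mathbb P\big(\mathrm{FNP}(\delta^n_{\rm NP}(\alpha))\le\beta+\epsilon\big)=1-o(1).$$ (ii) Conversely, if a sequence of decision rules $\delta^n$ satisfies $\mathbb P(\mathrm{FDP}(\delta^n)\le\alpha)=1-o(1)$ as $n\to\infty$ and $\mathrm{FNR}(\delta^n)\le\beta$, then $\beta\ge\mathsf{mFNR}^*(\alpha)$.
   Context: Two-group random mixture model: $\pi_0,\pi_1\in(0,1)$ with $\pi_0+\pi_1=1$; $f_0,f_1$ are probability densities on a sample space $\mathcal X$ (with respect to a common dominating measure), $f=\pi_0f_0+\pi_1f_1$. The labels $\theta_1,\dots,\theta_n$ are iid $\mathrm{Bern}(\pi_1)$ and, conditionally on $\theta^n$, the observations $X_1,\dots,X_n$ are independent with $X_i\sim f_{\theta_i}$. A (possibly randomized) decision rule $\delta^n=(\delta_1,\dots,\delta_n)$ is given by a Markov kernel from $\mathcal X^n$ to $\{0,1\}^n$ applied to $X^n$ (so $\delta^n$ is conditionally independent of $\theta^n$ given $X^n$). Define $\mathrm{FDP}(\delta^n)=\frac{\sum_i\delta_i(1-\theta_i)}{1\vee\sum_i\delta_i}$, $\mathrm{FNP}(\delta^n)=\frac{\sum_i(1-\delta_i)\theta_i}{1\vee\sum_i(1-\delta_i)}$,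 $\mathrm{FNR}(\delta^n)=\mathbb E[\mathrm{FNP}(\delta^n)]$, and $\mathrm{mFDR}(\delta^n)=\frac{\mathbb E[\sum_i\delta_i(1-\theta_i)]}{\mathbb E[\sum_i\delta_i]}$, $\mathrm{mFNR}(\delta^n)=\frac{\mathbb E[\sum_i(1-\delta_i)\theta_i]}{\mathbb E[\sum_i(1-\delta_i)]}$ with $0/0=0$. $\mathsf{mFNR}^*(\alpha)=\inf\{\mathrm{mFNR}(\delta^n):\mathrm{mFDR}(\delta^n)\le\alpha\}$, infimum over all decision rules; the value does not depend on $n$. Neyman-Pearson rule $\delta^n_{\rm NP}(\alpha)$: let $W_i=\pi_0f_0(X_i)/f(X_i)$, and let $W=\pi_0f_0(X)/f(X)$ with $X\sim f$, $G(t)=\mathbb P(W\le t)$, $G^{-1}(u)=\inf\{t\in[0,1]:G(t)\ge u\}$ for $u\in[0,1]$. For $u\in[0,1]$ choose $p(u)\in[0,1]$ with $\mathbb P(W<G^{-1}(u))+p(u)\mathbb P(W=G^{-1}(u))=u$. Let $S_u=1$ if $W<G^{-1}(u)$, $S_u\sim\mathrm{Bern}(p(u))$ (independent coin) if $W=G^{-1}(u)$, $S_u=0$ if $W>G^{-1}(u)$. Set $a(u)=\mathbb E[W\mid S_u=1]$ for $u\in(0,1]$, $a(0)=0$, and $u^*(\alpha)=\sup\{u\in[0,1]:a(u)\le\alpha\}$. Then $\delta^n_{\rm NP}(\alpha)=(\delta_1,\dots,\delta_n)$ where $\delta_i=1$ if $W_i<G^{-1}(u^*(\alpha))$, $\delta_i\sim\mathrm{Bern}(p(u^*(\alpha)))$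 (independent coins over $i$) if $W_i=G^{-1}(u^*(\alpha))$, and $\delta_i=0$ if $W_i>G^{-1}(u^*(\alpha))$. *)

theory Defs
  imports "HOL-Probability.Probability"
begin

text \<open>
  Coordinates are indexed by \<open>{..<n}\<close>, and the values 0 and 1 of labels and decisions are the
  booleans \<open>False\<close> and \<open>True\<close>.
\<close>

definition prob_density :: "'x measure \<Rightarrow> ('x \<Rightarrow> real) \<Rightarrow> bool" where
  "prob_density M g \<longleftrightarrow>
     g \<in> borel_measurable M \<and> (\<forall>x\<in>space M. 0 \<le> g x) \<and> (\<integral>\<^sup>+x. ennreal (g x) \<partial>M) = 1"

definition binary_space :: "nat \<Rightarrow> (nat \<Rightarrow> bool) measure" where
  "binary_space n = PiM {..<n} (\<lambda>_. count_space UNIV)"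

definition sample_space :: "'x measure \<Rightarrow> nat \<Rightarrow> (nat \<Rightarrow> 'x) measure" where
  "sample_space M n = PiM {..<n} (\<lambda>_. M)"

definition decision_rule :: "'x measure \<Rightarrow> nat \<Rightarrow> ((nat \<Rightarrow> 'x) \<Rightarrow> (nat \<Rightarrow> bool) measure) \<Rightarrow> bool" where
  "decision_rule M n K \<longleftrightarrow> K \<in> sample_space M n \<rightarrow>\<^sub>M prob_algebra (binary_space n)"

definition label_law :: "real \<Rightarrow> nat \<Rightarrow> (nat \<Rightarrow> bool) measure" where
  "label_law \<pi>1 n = PiM {..<n} (\<lambda>_. measure_pmf (bernoulli_pmf \<pi>1))"

definition observation_law ::
  "'x measure \<Rightarrow> ('x \<Rightarrow> real) \<Rightarrow> ('x \<Rightarrow> real) \<Rightarrow> nat \<Rightarrow> (nat \<Rightarrow> bool) \<Rightarrow> (nat \<Rightarrow> 'x) measure" where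
  "observation_law M f0 f1 n \<theta> =
     PiM {..<n} (\<lambda>i. density M (\<lambda>x. ennreal ((if \<theta> i then f1 else f0) x)))"

text \<open>
  The joint law of labels, observations and decisions \<open>(\<theta>, X, \<delta>)\<close>. The decisions are drawn from
  the kernel at \<open>X\<close> alone, so they are conditionally independent of the labels given \<open>X\<close>.
\<close>

definition joint_law ::
  "'x measure \<Rightarrow> real \<Rightarrow> ('x \<Rightarrow> real) \<Rightarrow> ('x \<Rightarrow> real) \<Rightarrow> nat \<Rightarrow>
   ((nat \<Rightarrow> 'x) \<Rightarrow> (nat \<Rightarrow> bool) measure) \<Rightarrow>
   ((nat \<Rightarrow> bool) \<times> (nat \<Rightarrow> 'x) \<times> (nat \<Rightarrow> bool)) measure" where
  "joint_law M \<pi>1 f0 f1 n K =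
     label_law \<pi>1 n \<bind> (\<lambda>\<theta>.
     observation_law M f0 f1 n \<theta> \<bind> (\<lambda>x.
     K x \<bind> (\<lambda>d.
     return (binary_space n \<Otimes>\<^sub>M (sample_space M n \<Otimes>\<^sub>M binary_space n)) (\<theta>, x, d))))"

definition discoveries :: "nat \<Rightarrow> (nat \<Rightarrow> bool) \<Rightarrow> real" where
  "discoveries n d = (\<Sum>i<n. of_bool (d i))"

definition false_discoveries :: "nat \<Rightarrow> (nat \<Rightarrow> bool) \<Rightarrow> (nat \<Rightarrow> bool) \<Rightarrow> real" where
  "false_discoveries n \<theta> d = (\<Sum>i<n. of_bool (d i) * (1 - of_bool (\<theta> i)))"

definition nondiscoveries :: "nat \<Rightarrow> (nat \<Rightarrow> bool) \<Rightarrow> real" where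
  "nondiscoveries n d = (\<Sum>i<n. 1 - of_bool (d i))"

definition false_nondiscoveries :: "nat \<Rightarrow> (nat \<Rightarrow> bool) \<Rightarrow> (nat \<Rightarrow> bool) \<Rightarrow> real" where
  "false_nondiscoveries n \<theta> d = (\<Sum>i<n. (1 - of_bool (d i)) * of_bool (\<theta> i))"

definition FDP :: "nat \<Rightarrow> (nat \<Rightarrow> bool) \<Rightarrow> (nat \<Rightarrow> bool) \<Rightarrow> real" where
  "FDP n \<theta> d = false_discoveries n \<theta> d / max 1 (discoveries n d)"

definition FNP :: "nat \<Rightarrow> (nat \<Rightarrow> bool) \<Rightarrow> (nat \<Rightarrow> bool) \<Rightarrow> real" where
  "FNP n \<theta> d = false_nondiscoveries n \<theta> d / max 1 (nondiscoveries n d)"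

definition FNR ::
  "'x measure \<Rightarrow> real \<Rightarrow> ('x \<Rightarrow> real) \<Rightarrow> ('x \<Rightarrow> real) \<Rightarrow> nat \<Rightarrow>
   ((nat \<Rightarrow> 'x) \<Rightarrow> (nat \<Rightarrow> bool) measure) \<Rightarrow> real" where
  "FNR M \<pi>1 f0 f1 n K = (\<integral>(\<theta>, x, d). FNP n \<theta> d \<partial>joint_law M \<pi>1 f0 f1 n K)"

text \<open>The convention 0/0 = 0 is the one built into division on the reals.\<close>

definition mFDR ::
  "'x measure \<Rightarrow> real \<Rightarrow> ('x \<Rightarrow> real) \<Rightarrow> ('x \<Rightarrow> real) \<Rightarrow> nat \<Rightarrow>
   ((nat \<Rightarrow> 'x) \<Rightarrow> (nat \<Rightarrow> bool) measure) \<Rightarrow> real" where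
  "mFDR M \<pi>1 f0 f1 n K =
     (\<integral>(\<theta>, x, d). false_discoveries n \<theta> d \<partial>joint_law M \<pi>1 f0 f1 n K) /
     (\<integral>(\<theta>, x, d). discoveries n d \<partial>joint_law M \<pi>1 f0 f1 n K)"

definition mFNR ::
  "'x measure \<Rightarrow> real \<Rightarrow> ('x \<Rightarrow> real) \<Rightarrow> ('x \<Rightarrow> real) \<Rightarrow> nat \<Rightarrow>
   ((nat \<Rightarrow> 'x) \<Rightarrow> (nat \<Rightarrow> bool) measure) \<Rightarrow> real" where
  "mFNR M \<pi>1 f0 f1 n K =
     (\<integral>(\<theta>, x, d). false_nondiscoveries n \<theta> d \<partial>joint_law M \<pi>1 f0 f1 n K) /
     (\<integral>(\<theta>, x, d). nondiscoveries n d \<partial>joint_law M \<pi>1 f0 f1 n K)"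

text \<open>
  The set below is bounded below by 0, and for \<open>\<alpha> \<ge> 0\<close> it is nonempty, because the rule that
  never rejects has mFDR 0/0 = 0.
\<close>

definition mFNR_star ::
  "'x measure \<Rightarrow> real \<Rightarrow> ('x \<Rightarrow> real) \<Rightarrow> ('x \<Rightarrow> real) \<Rightarrow> nat \<Rightarrow> real \<Rightarrow> real" where
  "mFNR_star M \<pi>1 f0 f1 n \<alpha> =
     Inf {mFNR M \<pi>1 f0 f1 n K | K. decision_rule M n K \<and> mFDR M \<pi>1 f0 f1 n K \<le> \<alpha>}"

definition mixture_density ::
  "real \<Rightarrow> real \<Rightarrow> ('x \<Rightarrow> real) \<Rightarrow> ('x \<Rightarrow> real) \<Rightarrow> 'x \<Rightarrow> real" where
  "mixture_density \<pi>0 \<pi>1 f0 f1 x = \<pi>0 * f0 x + \<pi>1 * f1 x"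

definition mixture_law ::
  "'x measure \<Rightarrow> real \<Rightarrow> real \<Rightarrow> ('x \<Rightarrow> real) \<Rightarrow> ('x \<Rightarrow> real) \<Rightarrow> 'x measure" where
  "mixture_law M \<pi>0 \<pi>1 f0 f1 = density M (\<lambda>x. ennreal (mixture_density \<pi>0 \<pi>1 f0 f1 x))"

text \<open>
  The statistic \<open>W\<close> as a function of the observation. Where the mixture density vanishes, a null
  set of the mixture law, the quotient is 0.
\<close>

definition W_stat :: "real \<Rightarrow> real \<Rightarrow> ('x \<Rightarrow> real) \<Rightarrow> ('x \<Rightarrow> real) \<Rightarrow> 'x \<Rightarrow> real" where
  "W_stat \<pi>0 \<pi>1 f0 f1 x = \<pi>0 * f0 x / mixture_density \<pi>0 \<pi>1 f0 f1 x"

definition W_cdf ::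
  "'x measure \<Rightarrow> real \<Rightarrow> real \<Rightarrow> ('x \<Rightarrow> real) \<Rightarrow> ('x \<Rightarrow> real) \<Rightarrow> real \<Rightarrow> real" where
  "W_cdf M \<pi>0 \<pi>1 f0 f1 t = \<P>(x in mixture_law M \<pi>0 \<pi>1 f0 f1. W_stat \<pi>0 \<pi>1 f0 f1 x \<le> t)"

definition W_quantile ::
  "'x measure \<Rightarrow> real \<Rightarrow> real \<Rightarrow> ('x \<Rightarrow> real) \<Rightarrow> ('x \<Rightarrow> real) \<Rightarrow> real \<Rightarrow> real" where
  "W_quantile M \<pi>0 \<pi>1 f0 f1 u = Inf {t \<in> {0..1}. W_cdf M \<pi>0 \<pi>1 f0 f1 t \<ge> u}"

definition tie_breaking ::
  "'x measure \<Rightarrow> real \<Rightarrow> real \<Rightarrow> ('x \<Rightarrow> real) \<Rightarrow> ('x \<Rightarrow> real) \<Rightarrow> (real \<Rightarrow> real) \<Rightarrow> bool" where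
  "tie_breaking M \<pi>0 \<pi>1 f0 f1 p \<longleftrightarrow>
     (\<forall>u\<in>{0..1}. p u \<in> {0..1} \<and>
        \<P>(x in mixture_law M \<pi>0 \<pi>1 f0 f1. W_stat \<pi>0 \<pi>1 f0 f1 x < W_quantile M \<pi>0 \<pi>1 f0 f1 u) +
        p u * \<P>(x in mixture_law M \<pi>0 \<pi>1 f0 f1. W_stat \<pi>0 \<pi>1 f0 f1 x = W_quantile M \<pi>0 \<pi>1 f0 f1 u)
        = u)"

definition select_prob ::
  "'x measure \<Rightarrow> real \<Rightarrow> real \<Rightarrow> ('x \<Rightarrow> real) \<Rightarrow> ('x \<Rightarrow> real) \<Rightarrow> (real \<Rightarrow> real) \<Rightarrow> real \<Rightarrow> 'x \<Rightarrow> real" where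
  "select_prob M \<pi>0 \<pi>1 f0 f1 p u x =
     (if W_stat \<pi>0 \<pi>1 f0 f1 x < W_quantile M \<pi>0 \<pi>1 f0 f1 u then 1
      else if W_stat \<pi>0 \<pi>1 f0 f1 x = W_quantile M \<pi>0 \<pi>1 f0 f1 u then p u
      else 0)"

text \<open>
  The joint law of \<open>X\<close>, drawn from the mixture, and the indicator \<open>S\<^sub>u\<close>. A Bernoulli variable with
  parameter 1 or 0 is the constant \<open>True\<close> or \<open>False\<close>.
\<close>

definition select_law ::
  "'x measure \<Rightarrow> real \<Rightarrow> real \<Rightarrow> ('x \<Rightarrow> real) \<Rightarrow> ('x \<Rightarrow> real) \<Rightarrow> (real \<Rightarrow> real) \<Rightarrow> real \<Rightarrow>
   ('x \<times> bool) measure" where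
  "select_law M \<pi>0 \<pi>1 f0 f1 p u =
     mixture_law M \<pi>0 \<pi>1 f0 f1 \<bind> (\<lambda>x.
     measure_pmf (bernoulli_pmf (select_prob M \<pi>0 \<pi>1 f0 f1 p u x)) \<bind> (\<lambda>s.
     return (M \<Otimes>\<^sub>M count_space UNIV) (x, s)))"

text \<open>
  \<open>uniform_measure N A\<close> is \<open>N\<close> conditioned on the event \<open>A\<close>, so that the integral is the
  conditional expectation of \<open>W\<close> given \<open>S\<^sub>u = 1\<close>.
\<close>

definition cond_W ::
  "'x measure \<Rightarrow> real \<Rightarrow> real \<Rightarrow> ('x \<Rightarrow> real) \<Rightarrow> ('x \<Rightarrow> real) \<Rightarrow> (real \<Rightarrow> real) \<Rightarrow> real \<Rightarrow> real" where
  "cond_W M \<pi>0 \<pi>1 f0 f1 p u =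
     (if u = 0 then 0
      else \<integral>(x, s). W_stat \<pi>0 \<pi>1 f0 f1 x
             \<partial>uniform_measure (select_law M \<pi>0 \<pi>1 f0 f1 p u) (space M \<times> {True}))"

definition u_star ::
  "'x measure \<Rightarrow> real \<Rightarrow> real \<Rightarrow> ('x \<Rightarrow> real) \<Rightarrow> ('x \<Rightarrow> real) \<Rightarrow> (real \<Rightarrow> real) \<Rightarrow> real \<Rightarrow> real" where
  "u_star M \<pi>0 \<pi>1 f0 f1 p \<alpha> = Sup {u \<in> {0..1}. cond_W M \<pi>0 \<pi>1 f0 f1 p u \<le> \<alpha>}"

definition NP_rule ::
  "'x measure \<Rightarrow> real \<Rightarrow> real \<Rightarrow> ('x \<Rightarrow> real) \<Rightarrow> ('x \<Rightarrow> real) \<Rightarrow> (real \<Rightarrow> real) \<Rightarrow> real \<Rightarrow> nat \<Rightarrow>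
   (nat \<Rightarrow> 'x) \<Rightarrow> (nat \<Rightarrow> bool) measure" where
  "NP_rule M \<pi>0 \<pi>1 f0 f1 p \<alpha> n x =
     PiM {..<n} (\<lambda>i. measure_pmf (bernoulli_pmf
       (select_prob M \<pi>0 \<pi>1 f0 f1 p (u_star M \<pi>0 \<pi>1 f0 f1 p \<alpha>) (x i))))"

end

theory Submission imports Defs begin

text \<open>
  By Bayes' rule the labels are independent given the observations, with \<open>\<theta>\<^sub>i = 0\<close> of probability
  \<open>W\<^sub>i\<close>; so \<open>1 - \<theta>\<^sub>i\<close> may be replaced by \<open>W\<^sub>i\<close> in expectations and, by Hoeffding's inequality, in
  averages. Let \<open>A(u) = E[W S\<^sub>u]\<close> (\<open>risk\<close> below), \<open>t = G\<^sup>-\<^sup>1(u)\<close>, and let \<open>s\<close> be the selection probability of \<open>S\<^sub>u\<close>.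
  The pointwise inequality \<open>(W - t) s \<le> (W - t) \<phi>\<close>, for any \<open>0 \<le> \<phi> \<le> 1\<close>, makes \<open>t\<close> a subgradient of
  \<open>A\<close> at \<open>u\<close>. Hence \<open>A\<close> is convex, a rule with a fraction \<open>u\<close> of discoveries has marginal false
  nondiscovery rate at least \<open>b(u) = (1 - u - \<pi>0 + A(u)) / (1 - u)\<close> (\<open>fnr_at\<close>), and since \<open>b\<close> is decreasing the
  optimal rate at level \<open>\<alpha>\<close> is \<open>b(u*)\<close>.

  Part (i) is then the law of large numbers. For part (ii), take \<open>v > u*\<close>, so that \<open>A(v) > \<alpha> v\<close> and
  the threshold at \<open>v\<close> exceeds \<open>\<alpha>\<close>. Summed over the sample, the pointwise inequality at \<open>v\<close> and
  \<open>FDP \<le> \<alpha>\<close> force a fraction of discoveries of at most \<open>v\<close>, whence the conditional mean of \<open>FNP\<close>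
  given the observations and decisions is at least \<open>b(v) - o(1)\<close>; finally \<open>v \<rightarrow> u*\<close>.
\<close>

section \<open>Products of probability measures\<close>

text \<open>The model draws the labels first, but a decision may depend on the whole sample, so in
  that order labels and decisions are entangled. Drawing observations, then decisions, then labels
  separates them: the observations are iid from the mixture whatever the rule, and the labels are
  independent given the rest. Hoeffding bounds can then be taken conditionally, with tails that do
  not depend on what is held fixed. The converse cannot be read off from the optimality of the
  marginal rates: the FDP is controlled only with high probability, while mFDR is a ratio of
  expectations. At \<open>ustar\<close> itself \<open>risk u - \<alpha> * u\<close> is at most 0,
  which leaves no room for fluctuations of order n e. Beyond \<open>ustar\<close> the gap is
  strictly positive and absorbs them. Returning to \<open>ustar\<close> is possible because
  thresholds lie in [0,1], which makes \<open>risk\<close> Lipschitz. The end points 0 and 1 of the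
  range of \<open>ustar\<close> are separate, since there the denominator of FDP or of FNP need not
  grow with n.\<close>

lemma emeasure_PiM_prob:
  assumes "finite I" "\<And>i. i \<in> I \<Longrightarrow> prob_space (N i)" "\<And>i. i \<in> I \<Longrightarrow> A i \<in> sets (N i)"
  shows "emeasure (PiM I N) (PiE I A) = (\<Prod>i\<in>I. emeasure (N i) (A i))"
proof -
  \<comment> \<open>Product measures are treated with a probability measure at every index, so the
    family is padded outside \<open>I\<close> by a point mass; \<open>PiM I\<close> does not see the
    padding.\<close>
  define N' where "N' i = (if i \<in> I then N i else return (count_space UNIV) undefined)" for i
  interpret product_prob_space N' I
    unfolding N'_def
    by (intro product_prob_spaceI) (auto intro: assms prob_space_return)
  have "PiM I N = PiM I N'"
    by (intro PiM_cong) (auto simp: N'_def)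
  moreover have "emeasure (PiM I N') (PiE I A) = (\<Prod>i\<in>I. emeasure (N' i) (A i))"
    using assms by (intro emeasure_PiM) (auto simp: N'_def)
  ultimately show ?thesis by (simp add: N'_def)
qed

text \<open>Boxes generate the product and are stable under intersection, so only the mass of a box
  has to be measurable, and that is a finite product of measurable masses.\<close>

lemma measurable_PiM_kernel:
  assumes I: "finite I" and N: "\<And>i. i \<in> I \<Longrightarrow> N i \<in> L \<rightarrow>\<^sub>M prob_algebra (S i)"
  shows "(\<lambda>x. PiM I (\<lambda>i. N i x)) \<in> L \<rightarrow>\<^sub>M prob_algebra (PiM I S)"
proof (rule measurable_prob_algebra_generated[OF sets_PiM Int_stable_prod_algebra])
  have *: "prob_space (N i x)" "sets (N i x) = sets (S i)" if "i \<in> I" "x \<in> space L" for i x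
    using measurable_space[OF N[OF that(1)] that(2)] by (auto simp: space_prob_algebra)
  show "prod_algebra I S \<subseteq> Pow (PiE I (\<lambda>i. space (S i)))"
    by (rule prod_algebra_sets_into_space)
  fix x assume x: "x \<in> space L"
  show "prob_space (PiM I (\<lambda>i. N i x))"
    using * x by (intro prob_space_PiM) auto
  show "sets (PiM I (\<lambda>i. N i x)) = sets (PiM I S)"
    using * x by (intro sets_PiM_cong) auto
next
  have *: "prob_space (N i x)" "sets (N i x) = sets (S i)" if "i \<in> I" "x \<in> space L" for i x
    using measurable_space[OF N[OF that(1)] that(2)] by (auto simp: space_prob_algebra)
  fix A assume "A \<in> prod_algebra I S"
  then obtain X where X: "A = PiE I X" "X \<in> (\<Pi> i\<in>I. sets (S i))"
    using I by (auto simp: prod_algebra_eq_finite)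
  have "(\<lambda>x. emeasure (PiM I (\<lambda>i. N i x)) A) \<in> borel_measurable L \<longleftrightarrow>
        (\<lambda>x. \<Prod>i\<in>I. emeasure (N i x) (X i)) \<in> borel_measurable L"
    using X I * by (intro measurable_cong) (auto intro!: emeasure_PiM_prob)
  also have "\<dots>"
  proof (intro borel_measurable_prod_ennreal)
    fix i assume i: "i \<in> I"
    have "X i \<in> sets (S i)" using X i by auto
    then show "(\<lambda>x. emeasure (N i x) (X i)) \<in> borel_measurable L"
      using measurable_compose[OF measurable_prob_algebraD[OF N[OF i]] measurable_emeasure_subprob_algebra]
      by auto
  qed
  finally show "(\<lambda>x. emeasure (PiM I (\<lambda>i. N i x)) A) \<in> borel_measurable L" .
qed

text \<open>Both sides are determined by their values on boxes, where the integral of a product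
  splits into a product of integrals.\<close>

lemma PiM_density:
  assumes I: "finite I" and N: "\<And>i. prob_space (N i)"
    and g: "\<And>i. g i \<in> borel_measurable (N i)" "\<And>i. prob_space (density (N i) (g i))"
  shows "PiM I (\<lambda>i. density (N i) (g i)) = density (PiM I N) (\<lambda>x. \<Prod>i\<in>I. g i (x i))"
proof -
  interpret D: product_prob_space "\<lambda>i. density (N i) (g i)" I
    by (intro product_prob_spaceI g)
  interpret N: product_prob_space N I
    by (intro product_prob_spaceI N)
  have m: "(\<lambda>x. \<Prod>i\<in>I. g i (x i)) \<in> borel_measurable (PiM I N)"
    using g(1) by (intro borel_measurable_prod_ennreal) (auto intro: measurable_compose[OF measurable_component_singleton])
  show ?thesis
  proof (rule D.PiM_eqI[symmetric, OF I])
    show "sets (density (PiM I N) (\<lambda>x. \<Prod>i\<in>I. g i (x i))) = sets (PiM I (\<lambda>i. density (N i) (g i)))"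
      by (simp cong: sets_PiM_cong)
    fix A assume A: "\<And>i. i \<in> I \<Longrightarrow> A i \<in> sets (density (N i) (g i))"
    have "emeasure (density (PiM I N) (\<lambda>x. \<Prod>i\<in>I. g i (x i))) (PiE I A)
        = (\<integral>\<^sup>+x. (\<Prod>i\<in>I. g i (x i)) * indicator (PiE I A) x \<partial>PiM I N)"
      using A I by (intro emeasure_density m sets_PiM_I_finite) auto
    also have "\<dots> = (\<integral>\<^sup>+x. (\<Prod>i\<in>I. g i (x i) * indicator (A i) (x i)) \<partial>PiM I N)"
    proof (rule nn_integral_cong)
      \<comment> \<open>A box also forces the value \<open>undefined\<close> outside
        \<open>I\<close>, so its indicator factors over coordinates only for extensional x.\<close>
      fix x assume "x \<in> space (PiM I N)"
      then have "x \<in> extensional I" by (auto simp: space_PiM PiE_def)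
      then have "indicator (PiE I A) x = (\<Prod>i\<in>I. indicator (A i) (x i) :: ennreal)"
        using I by (auto simp: indicator_def PiE_def Pi_def prod_zero_iff split: if_splits)
      then show "(\<Prod>i\<in>I. g i (x i)) * indicator (PiE I A) x = (\<Prod>i\<in>I. g i (x i) * indicator (A i) (x i))"
        by (simp add: prod.distrib)
    qed
    also have "\<dots> = (\<Prod>i\<in>I. \<integral>\<^sup>+x. g i x * indicator (A i) x \<partial>N i)"
      using A g(1) I by (intro N.product_nn_integral_prod) auto
    also have "\<dots> = (\<Prod>i\<in>I. emeasure (density (N i) (g i)) (A i))"
      using A g(1) by (intro prod.cong refl emeasure_density[symmetric]) auto
    finally show "emeasure (density (PiM I N) (\<lambda>x. \<Prod>i\<in>I. g i (x i))) (PiE I A) =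
      (\<Prod>i\<in>I. emeasure (density (N i) (g i)) (A i))" .
  qed
qed

lemma nn_integral_finite_space:
  assumes "finite (space N)" "sets N = Pow (space N)"
  shows "(\<integral>\<^sup>+x. F x \<partial>N) = (\<Sum>x\<in>space N. F x * emeasure N {x})"
proof -
  have "(\<integral>\<^sup>+x. F x \<partial>N) = (\<integral>\<^sup>+x. (\<Sum>y\<in>space N. F y * indicator {y} x) \<partial>N)"
    using assms(1) by (intro nn_integral_cong) (auto simp: indicator_def if_distrib sum.delta cong: if_cong)
  also have "\<dots> = (\<Sum>y\<in>space N. \<integral>\<^sup>+x. F y * indicator {y} x \<partial>N)"
    using assms by (intro nn_integral_sum) (auto simp: measurable_def)
  also have "\<dots> = (\<Sum>y\<in>space N. F y * emeasure N {y})"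
    using assms by (intro sum.cong refl nn_integral_cmult_indicator) auto
  finally show ?thesis .
qed

text \<open>Transferred from nonnegative integrals: the bound \<open>C\<close> makes
  \<open>f\<close> integrable under each probability measure \<open>N x\<close>, so that the two
  kinds of inner integral agree.\<close>

lemma integral_bind_bounded:
  fixes f :: "'a \<Rightarrow> real"
  assumes f[measurable]: "f \<in> borel_measurable B" and N: "N \<in> M \<rightarrow>\<^sub>M prob_algebra B" and M: "prob_space M"
    and bnd: "\<And>x. x \<in> space B \<Longrightarrow> 0 \<le> f x \<and> f x \<le> C"
  shows "(\<integral>x. f x \<partial>(M \<bind> N)) = (\<integral>x. (\<integral>y. f y \<partial>N x) \<partial>M)"
    and "(\<lambda>x. \<integral>y. f y \<partial>N x) \<in> borel_measurable M"
    and "\<And>x. x \<in> space M \<Longrightarrow> 0 \<le> (\<integral>y. f y \<partial>N x) \<and> (\<integral>y. f y \<partial>N x) \<le> C"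
proof -
  interpret M: prob_space M by fact
  have Nx: "prob_space (N x)" "sets (N x) = sets B" "space (N x) = space B" if "x \<in> space M" for x
    using measurable_space[OF N that] sets_eq_imp_space_eq[of "N x" B] by (auto simp: space_prob_algebra)
  have meas: "f \<in> borel_measurable (N x)" if "x \<in> space M" for x
    using f Nx[OF that] by (simp cong: measurable_cong_sets)
  show m: "(\<lambda>x. \<integral>y. f y \<partial>N x) \<in> borel_measurable M"
    by (rule measurable_compose[OF measurable_prob_algebraD[OF N] integral_measurable_subprob_algebra[OF f]])
  have int: "integrable (N x) f" if x: "x \<in> space M" for x
  proof -
    interpret prob_space "N x" using Nx x by auto
    show ?thesis using x meas Nx bnd by (intro integrable_const_bound[of _ C]) (auto intro!: AE_I2)
  qed
  show b: "0 \<le> (\<integral>y. f y \<partial>N x) \<and> (\<integral>y. f y \<partial>N x) \<le> C" if x: "x \<in> space M" for x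
  proof -
    interpret prob_space "N x" using Nx x by auto
    show ?thesis using int[OF x] bnd x Nx
      by (auto intro!: integral_le_const integral_nonneg_AE AE_I2)
  qed
  have sp: "M \<in> space (prob_algebra M)" using M by (simp add: space_prob_algebra)
  have sB: "sets (M \<bind> N) = sets B" by (rule sets_bind'[OF sp N])
  have "(\<integral>x. f x \<partial>(M \<bind> N)) = enn2real (\<integral>\<^sup>+x. f x \<partial>(M \<bind> N))"
    using f sB bnd sets_eq_imp_space_eq[OF sB] by (intro integral_eq_nn_integral AE_I2) (auto cong: measurable_cong_sets)
  also have "(\<integral>\<^sup>+x. f x \<partial>(M \<bind> N)) = (\<integral>\<^sup>+x. \<integral>\<^sup>+y. f y \<partial>N x \<partial>M)"
    using N by (intro nn_integral_bind[where B=B] measurable_prob_algebraD) auto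
  also have "\<dots> = (\<integral>\<^sup>+x. ennreal (\<integral>y. f y \<partial>N x) \<partial>M)"
    using int bnd Nx by (intro nn_integral_cong nn_integral_eq_integral) (auto intro!: AE_I2)
  also have "enn2real \<dots> = (\<integral>x. (\<integral>y. f y \<partial>N x) \<partial>M)"
    using m b by (intro integral_eq_nn_integral[symmetric] AE_I2) auto
  finally show "(\<integral>x. f x \<partial>(M \<bind> N)) = (\<integral>x. (\<integral>y. f y \<partial>N x) \<partial>M)" .
qed

text \<open>Restriction to \<open>I\<close> is the identity on extensional functions, so the joint
  law of the coordinates is the product itself, hence the product of their marginals.\<close>

lemma indep_vars_PiM_component:
  assumes I: "I \<noteq> {}" and N: "\<And>i. i \<in> I \<Longrightarrow> prob_space (N i)"
  shows "prob_space.indep_vars (PiM I N) N (\<lambda>i \<omega>. \<omega> i) I"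
proof -
  interpret prob_space "PiM I N" using N by (rule prob_space_PiM)
  have "distr (PiM I N) (PiM I N) (\<lambda>\<omega>. \<lambda>i\<in>I. \<omega> i) = distr (PiM I N) (PiM I N) (\<lambda>\<omega>. \<omega>)"
    by (intro distr_cong) (auto simp: space_PiM)
  also have "\<dots> = PiM I N" by simp
  also have "\<dots> = PiM I (\<lambda>i. distr (PiM I N) (N i) (\<lambda>\<omega>. \<omega> i))"
    using N by (intro PiM_cong) (auto intro!: distr_PiM_component[symmetric])
  finally show ?thesis
    by (subst indep_vars_iff_distr_eq_PiM'[OF I]) auto
qed

section \<open>Hoeffding's inequality on a product space\<close>

definition hoeffding_tail :: "nat \<Rightarrow> real \<Rightarrow> real" where
  "hoeffding_tail n e = 2 * exp (- 2 * real n * e\<^sup>2)"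

lemma hoeffding_tail_nonneg: "0 \<le> hoeffding_tail n e"
  by (simp add: hoeffding_tail_def)

lemma hoeffding_tail_tendsto_0:
  assumes "e > 0" shows "(\<lambda>n. hoeffding_tail n e) \<longlonglongrightarrow> 0"
proof -
  have "(\<lambda>n. 2 * exp (- 2 * e\<^sup>2) ^ n) \<longlonglongrightarrow> 2 * 0"
    using assms by (intro tendsto_intros LIMSEQ_realpow_zero) auto
  moreover have "hoeffding_tail n e = 2 * exp (- 2 * e\<^sup>2) ^ n" for n
    by (simp add: hoeffding_tail_def mult_ac flip: exp_of_nat_mult)
  ultimately show ?thesis by simp
qed

text \<open>Factors and functions may vary with \<open>i\<close> because the bound is also applied
  to conditional laws: labels given the observations, and the coins of the Neyman-Pearson rule. Its
  tail depends on \<open>n\<close> and \<open>e\<close> alone and so survives averaging over what is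
  held fixed.\<close>

lemma PiM_hoeffding:
  fixes g :: "nat \<Rightarrow> 'a \<Rightarrow> real" and e :: real
  assumes n: "n \<ge> 1" and e: "e > 0" and N: "\<And>i. i < n \<Longrightarrow> prob_space (N i)"
    and g: "\<And>i. i < n \<Longrightarrow> g i \<in> borel_measurable (N i)"
    and bnd: "\<And>i x. i < n \<Longrightarrow> x \<in> space (N i) \<Longrightarrow> 0 \<le> g i x \<and> g i x \<le> 1"
  shows "measure (PiM {..<n} N) {\<omega>\<in>space (PiM {..<n} N).
      \<bar>(\<Sum>i<n. g i (\<omega> i)) - (\<Sum>i<n. \<integral>x. g i x \<partial>N i)\<bar> \<ge> real n * e} \<le> hoeffding_tail n e"
proof -
  let ?M = "PiM {..<n} N"
  interpret prob_space ?M using N by (intro prob_space_PiM) auto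
  have ex: "(\<integral>\<omega>. g i (\<omega> i) \<partial>?M) = (\<integral>x. g i x \<partial>N i)" if "i < n" for i
    using that g N distr_PiM_component[of "{..<n}" N i]
    by (subst integral_distr[of "\<lambda>\<omega>. \<omega> i" ?M "N i" "g i", symmetric]) auto
  interpret Hoeffding_ineq ?M "{..<n}" "\<lambda>i \<omega>. g i (\<omega> i)" "\<lambda>_. 0" "\<lambda>_. 1" "\<Sum>i<n. \<integral>\<omega>. g i (\<omega> i) \<partial>?M"
  proof (unfold_locales, goal_cases)
    case 2
    have "indep_vars N (\<lambda>i \<omega>. \<omega> i) {..<n}"
      using n N by (intro indep_vars_PiM_component) (auto simp: lessThan_empty_iff)
    then show ?case by (rule indep_vars_compose2) (use g in auto)
  next
    case (3 i)
    then have "\<omega> i \<in> space (N i)" if "\<omega> \<in> space ?M" for \<omega>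
      using that by (auto simp: space_PiM)
    then show ?case using 3 bnd[of i] by (auto intro!: AE_I2)
  qed auto
  have "prob {\<omega>\<in>space ?M. \<bar>(\<Sum>i<n. g i (\<omega> i)) - (\<Sum>i<n. \<integral>\<omega>. g i (\<omega> i) \<partial>?M)\<bar> \<ge> real n * e} \<le>
     2 * exp (-2 * (real n * e)\<^sup>2 / (\<Sum>i<n. (1 - 0)\<^sup>2))"
    using n e by (intro Hoeffding_ineq_abs_ge) auto
  \<comment> \<open>The squared ranges add up to n, so the exponent -2 (n e)^2 / n equals -2 n
    e^2.\<close>
  also have "\<dots> = hoeffding_tail n e"
    using n by (simp add: hoeffding_tail_def power2_eq_square field_simps)
  finally show ?thesis using ex by simp
qed

section \<open>The joint law via the posterior of the labels\<close>

lemma binary_space_eq: "binary_space n = count_space (PiE {..<n} (\<lambda>_. UNIV))"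
  unfolding binary_space_def by (rule count_space_PiM_finite) auto

lemma space_binary_space: "space (binary_space n) = PiE {..<n} (\<lambda>_. UNIV)"
  and sets_binary_space: "sets (binary_space n) = Pow (PiE {..<n} (\<lambda>_. UNIV))"
  and finite_binary_space: "finite (PiE {..<n} (\<lambda>_. UNIV :: bool set))"
  by (simp_all add: binary_space_eq finite_PiE)

lemma measurable_binary_component:
  "i < n \<Longrightarrow> (\<lambda>d. d i) \<in> binary_space n \<rightarrow>\<^sub>M count_space UNIV"
  unfolding binary_space_def by simp

lemma measurable_sample_component:
  "i < n \<Longrightarrow> (\<lambda>x. x i) \<in> sample_space M n \<rightarrow>\<^sub>M M"
  unfolding sample_space_def by simp

lemma measurable_bernoulli_kernel:
  assumes q[measurable]: "q \<in> borel_measurable L" and "\<And>x. x \<in> space L \<Longrightarrow> 0 \<le> q x \<and> q x \<le> 1"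
  shows "(\<lambda>x. measure_pmf (bernoulli_pmf (q x))) \<in> L \<rightarrow>\<^sub>M prob_algebra (count_space UNIV)"
proof (intro measurable_prob_algebraI measurable_subprob_algebra prob_space_measure_pmf)
  fix A :: "bool set"
  have "(\<lambda>x. emeasure (measure_pmf (bernoulli_pmf (q x))) A) \<in> borel_measurable L \<longleftrightarrow>
     (\<lambda>x. \<Sum>b\<in>A. ennreal (if b then q x else 1 - q x)) \<in> borel_measurable L"
    using assms(2) by (intro measurable_cong) (auto simp: emeasure_measure_pmf_finite intro!: sum.cong arg_cong[where f=ennreal])
  then show "(\<lambda>x. emeasure (measure_pmf (bernoulli_pmf (q x))) A) \<in> borel_measurable L"
    by simp
qed (auto intro: prob_space_imp_subprob_space prob_space_measure_pmf)

lemma bernoulli_PiM_in_binary: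
  "sets (PiM {..<n} (\<lambda>i. measure_pmf (bernoulli_pmf (q i)))) = sets (binary_space n)"
  unfolding binary_space_def by (intro sets_PiM_cong) auto

lemma emeasure_bernoulli_PiM_singleton:
  fixes n :: nat
  assumes "\<theta> \<in> PiE {..<n} (\<lambda>_. UNIV)"
  shows "emeasure (PiM {..<n} (\<lambda>i. measure_pmf (bernoulli_pmf (q i)))) {\<theta>} =
    (\<Prod>i<n. ennreal (pmf (bernoulli_pmf (q i)) (\<theta> i)))"
proof -
  have *: "{\<theta>} = PiE {..<n} (\<lambda>i. {\<theta> i})"
    using assms by (intro PiE_singleton[symmetric]) (auto simp: PiE_def)
  show ?thesis
    unfolding * by (subst emeasure_PiM_prob) (auto simp: prob_space_measure_pmf emeasure_pmf_single)
qed

lemma integral_bernoulli_component: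
  fixes n :: nat
  assumes "0 \<le> q i" "q i \<le> 1" "i < n"
  shows "(\<integral>\<theta>. c (\<theta> i) \<partial>PiM {..<n} (\<lambda>i. measure_pmf (bernoulli_pmf (q i)))) = c True * q i + (c False :: real) * (1 - q i)"
proof -
  have "(\<integral>\<theta>. c (\<theta> i) \<partial>PiM {..<n} (\<lambda>i. measure_pmf (bernoulli_pmf (q i)))) =
    (\<integral>b. c b \<partial>distr (PiM {..<n} (\<lambda>i. measure_pmf (bernoulli_pmf (q i)))) (measure_pmf (bernoulli_pmf (q i))) (\<lambda>\<theta>. \<theta> i))"
    using assms by (intro integral_distr[symmetric] measurable_component_singleton) auto
  also have "\<dots> = (\<integral>b. c b \<partial>measure_pmf (bernoulli_pmf (q i)))"
    using assms by (subst distr_PiM_component) (auto simp: prob_space_measure_pmf)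
  finally show ?thesis using assms by (simp add: mult_ac)
qed

abbreviation triple_space :: "'x measure \<Rightarrow> nat \<Rightarrow> ((nat \<Rightarrow> bool) \<times> (nat \<Rightarrow> 'x) \<times> (nat \<Rightarrow> bool)) measure" where
  "triple_space M n \<equiv> binary_space n \<Otimes>\<^sub>M (sample_space M n \<Otimes>\<^sub>M binary_space n)"

section \<open>The mixture and the posterior of the labels\<close>

locale two_group =
  fixes M :: "'x measure" and f0 f1 :: "'x \<Rightarrow> real" and \<pi>0 \<pi>1 :: real
  assumes \<pi>: "0 < \<pi>0" "\<pi>0 < 1" "0 < \<pi>1" "\<pi>1 < 1" "\<pi>0 + \<pi>1 = 1"
    and dens: "prob_density M f0" "prob_density M f1"
begin

abbreviation "P \<equiv> mixture_law M \<pi>0 \<pi>1 f0 f1"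
abbreviation "W \<equiv> W_stat \<pi>0 \<pi>1 f0 f1"
abbreviation "mix \<equiv> mixture_density \<pi>0 \<pi>1 f0 f1"

lemma f_measurable [measurable]: "f0 \<in> borel_measurable M" "f1 \<in> borel_measurable M"
  using dens by (auto simp: prob_density_def)

lemma f_nonneg: "x \<in> space M \<Longrightarrow> 0 \<le> f0 x" "x \<in> space M \<Longrightarrow> 0 \<le> f1 x"
  using dens by (auto simp: prob_density_def)

lemma mix_measurable [measurable]: "mix \<in> borel_measurable M"
  unfolding mixture_density_def[abs_def] by measurable

lemma mix_nonneg: "x \<in> space M \<Longrightarrow> 0 \<le> mix x"
  using f_nonneg[of x] \<pi> by (auto simp: mixture_density_def)

lemma W_measurable [measurable]: "W \<in> borel_measurable M"
  unfolding W_stat_def[abs_def] by measurable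

lemma W_bounds: assumes "x \<in> space M" shows "0 \<le> W x" "W x \<le> 1"
proof -
  show "0 \<le> W x" using f_nonneg[OF assms] mix_nonneg[OF assms] \<pi> by (simp add: W_stat_def)
  have "\<pi>0 * f0 x \<le> mix x" using f_nonneg[OF assms] \<pi> by (simp add: mixture_density_def)
  then show "W x \<le> 1" using mix_nonneg[OF assms] by (simp add: W_stat_def divide_le_eq)
qed

lemma sets_P [measurable_cong]: "sets P = sets M" and space_P: "space P = space M"
  by (simp_all add: mixture_law_def)

lemma prob_space_P: "prob_space P"
proof
  have "emeasure P (space P) = (\<integral>\<^sup>+x. ennreal (mix x) \<partial>M)"
    by (simp add: mixture_law_def emeasure_density cong: nn_integral_cong)
  also have "\<dots> = (\<integral>\<^sup>+x. ennreal \<pi>0 * ennreal (f0 x) + ennreal \<pi>1 * ennreal (f1 x) \<partial>M)"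
    using f_nonneg \<pi> by (intro nn_integral_cong) (auto simp: mixture_density_def ennreal_mult' ennreal_plus)
  also have "\<dots> = ennreal \<pi>0 + ennreal \<pi>1"
    using dens by (simp add: nn_integral_add nn_integral_cmult prob_density_def)
  finally show "emeasure P (space P) = 1" using \<pi> by (simp flip: ennreal_plus)
qed

text \<open>The density of f_b relative to the mixture, written through \<open>W\<close>: where f is
  positive, f_0 / f = W / \<pi>0 and f_1 / f = (1 - W) / \<pi>1.\<close>

definition lr :: "bool \<Rightarrow> 'x \<Rightarrow> real" where
  "lr b x = (if b then (1 - W x) / \<pi>1 else W x / \<pi>0)"

lemma lr_measurable [measurable]: "lr b \<in> borel_measurable M"
  unfolding lr_def[abs_def] by measurable

lemma lr_nonneg: "x \<in> space M \<Longrightarrow> 0 \<le> lr b x"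
  using W_bounds[of x] \<pi> by (auto simp: lr_def)

lemma density_component: "density M (\<lambda>x. ennreal ((if b then f1 else f0) x)) = density P (\<lambda>x. ennreal (lr b x))"
proof -
  have "density P (\<lambda>x. ennreal (lr b x)) = density M (\<lambda>x. ennreal (mix x) * ennreal (lr b x))"
    unfolding mixture_law_def by (intro density_density_eq) auto
  also have "\<dots> = density M (\<lambda>x. ennreal ((if b then f1 else f0) x))"
  proof (intro density_cong AE_I2)
    fix x assume x: "x \<in> space M"
    have "mix x * lr b x = (if b then f1 else f0) x"
    proof (cases "mix x = 0")
      \<comment> \<open>Both weights are positive, so f_0 and f_1 vanish wherever the mixture does,
        and both sides are 0 whatever the default value of \<open>W\<close> there.\<close>
      case True
      then have "\<pi>0 * f0 x = 0" "\<pi>1 * f1 x = 0"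
        using f_nonneg[OF x] \<pi>
        by (simp_all add: mixture_density_def add_nonneg_eq_0_iff)
      then show ?thesis using True \<pi> by auto
    next
      case False
      then have "mix x * W x = \<pi>0 * f0 x" "mix x * (1 - W x) = \<pi>1 * f1 x"
        by (simp_all add: W_stat_def right_diff_distrib) (simp add: mixture_density_def)
      then show ?thesis using \<pi> by (simp add: lr_def)
    qed
    then show "ennreal (mix x) * ennreal (lr b x) = ennreal ((if b then f1 else f0) x)"
      using mix_nonneg[OF x] lr_nonneg[OF x, of b] by (simp flip: ennreal_mult)
  qed auto
  finally show ?thesis ..
qed

lemma prob_space_component: "prob_space (density M (\<lambda>x. ennreal ((if b then f1 else f0) x)))"
  using dens by (intro prob_spaceI) (auto simp: emeasure_density prob_density_def cong: nn_integral_cong)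

abbreviation Pn :: "nat \<Rightarrow> (nat \<Rightarrow> 'x) measure" where "Pn n \<equiv> PiM {..<n} (\<lambda>_. P)"

lemma sets_Pn [measurable_cong]: "sets (Pn n) = sets (sample_space M n)"
  unfolding sample_space_def by (intro sets_PiM_cong) (auto simp: sets_P)

lemma space_Pn: "space (Pn n) = space (sample_space M n)"
  by (rule sets_eq_imp_space_eq[OF sets_Pn])

lemma prob_space_Pn: "prob_space (Pn n)"
  by (intro prob_space_PiM prob_space_P)

lemma sample_in_space: "x \<in> space (sample_space M n) \<Longrightarrow> i < n \<Longrightarrow> x i \<in> space M"
  by (auto simp: sample_space_def space_PiM)

text \<open>All conditional laws of the observations get one dominating measure, that of an iid
  sample from the mixture. This lets a sum over label vectors move inside an integral over
  observations.\<close>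

lemma observation_law_eq:
  "observation_law M f0 f1 n \<theta> = density (Pn n) (\<lambda>x. \<Prod>i<n. ennreal (lr (\<theta> i) (x i)))"
proof -
  have "observation_law M f0 f1 n \<theta> = PiM {..<n} (\<lambda>i. density P (\<lambda>x. ennreal (lr (\<theta> i) x)))"
    unfolding observation_law_def density_component ..
  also have "\<dots> = density (Pn n) (\<lambda>x. \<Prod>i<n. ennreal (lr (\<theta> i) (x i)))"
  proof (intro PiM_density prob_space_P)
    show "(\<lambda>x. ennreal (lr (\<theta> i) x)) \<in> borel_measurable P" for i
      by (simp cong: measurable_cong_sets add: sets_P)
    show "prob_space (density P (\<lambda>x. ennreal (lr (\<theta> i) x)))" for i
      using prob_space_component[of "\<theta> i"] by (simp add: density_component)
  qed auto
  finally show ?thesis .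
qed

definition posterior :: "nat \<Rightarrow> (nat \<Rightarrow> 'x) \<Rightarrow> (nat \<Rightarrow> bool) measure" where
  "posterior n x = PiM {..<n} (\<lambda>i. measure_pmf (bernoulli_pmf (1 - W (x i))))"

lemma posterior_kernel [measurable]: "posterior n \<in> sample_space M n \<rightarrow>\<^sub>M prob_algebra (binary_space n)"
  unfolding posterior_def[abs_def] binary_space_def
proof (intro measurable_PiM_kernel measurable_bernoulli_kernel)
  fix i assume "i \<in> {..<n}"
  then have [measurable]: "(\<lambda>x. x i) \<in> sample_space M n \<rightarrow>\<^sub>M M" by (simp add: measurable_sample_component)
  show "(\<lambda>x. 1 - W (x i)) \<in> borel_measurable (sample_space M n)" by measurable
qed (use W_bounds sample_in_space in auto)

lemma observation_kernel:
  "observation_law M f0 f1 n \<in> label_law \<pi>1 n \<rightarrow>\<^sub>M prob_algebra (sample_space M n)"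
proof (rule measurable_prob_algebraI)
  show "prob_space (observation_law M f0 f1 n \<theta>)" for \<theta>
    unfolding observation_law_def using prob_space_component by (intro prob_space_PiM)
  then have "observation_law M f0 f1 n \<theta> \<in> space (subprob_algebra (sample_space M n))" for \<theta>
    by (auto simp: space_subprob_algebra sample_space_def observation_law_def
        intro!: prob_space_imp_subprob_space sets_PiM_cong)
  moreover have "sets (label_law \<pi>1 n) = Pow (space (label_law \<pi>1 n))"
    using bernoulli_PiM_in_binary[of n "\<lambda>_. \<pi>1"]
    by (simp add: label_law_def sets_binary_space space_PiM)
  ultimately show "observation_law M f0 f1 n \<in> label_law \<pi>1 n \<rightarrow>\<^sub>M subprob_algebra (sample_space M n)"
    by (auto simp: measurable_def)
qed

section \<open>Reordering the draws of labels, observations and decisions\<close>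

definition inner_law where
  "inner_law n K \<theta> x = K x \<bind> (\<lambda>d. return (triple_space M n) (\<theta>, x, d))"

definition posterior_law where
  "posterior_law n x d = posterior n x \<bind> (\<lambda>\<theta>. return (triple_space M n) (\<theta>, x, d))"

lemma kernels:
  assumes "decision_rule M n K"
  shows "K \<in> sample_space M n \<rightarrow>\<^sub>M prob_algebra (binary_space n)"
    and "(\<lambda>(\<theta>, x). inner_law n K \<theta> x) \<in> binary_space n \<Otimes>\<^sub>M sample_space M n \<rightarrow>\<^sub>M prob_algebra (triple_space M n)"
    and "(\<lambda>(x, d). posterior_law n x d) \<in> sample_space M n \<Otimes>\<^sub>M binary_space n \<rightarrow>\<^sub>M prob_algebra (triple_space M n)"
    and "(\<lambda>x. K x \<bind> posterior_law n x) \<in> sample_space M n \<rightarrow>\<^sub>M prob_algebra (triple_space M n)"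
proof -
  show K[measurable]: "K \<in> sample_space M n \<rightarrow>\<^sub>M prob_algebra (binary_space n)"
    using assms by (simp add: decision_rule_def)
  show "(\<lambda>(\<theta>, x). inner_law n K \<theta> x) \<in> binary_space n \<Otimes>\<^sub>M sample_space M n \<rightarrow>\<^sub>M prob_algebra (triple_space M n)"
    unfolding inner_law_def by measurable
  show [measurable]: "(\<lambda>(x, d). posterior_law n x d) \<in> sample_space M n \<Otimes>\<^sub>M binary_space n \<rightarrow>\<^sub>M prob_algebra (triple_space M n)"
    unfolding posterior_law_def by measurable
  show "(\<lambda>x. K x \<bind> posterior_law n x) \<in> sample_space M n \<rightarrow>\<^sub>M prob_algebra (triple_space M n)"
    by measurable
qed

text \<open>Posterior equals prior times likelihood with no normalising constant, because
  \<open>lr\<close> is already relative to the mixture: \<pi>1 times \<open>lr True\<close> is 1 -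
  \<open>W\<close>, and \<pi>0 times \<open>lr False\<close> is \<open>W\<close>.\<close>

lemma emeasure_posterior_singleton:
  assumes x: "x \<in> space (sample_space M n)" and \<theta>: "\<theta> \<in> PiE {..<n} (\<lambda>_. UNIV)"
  shows "emeasure (posterior n x) {\<theta>} =
    emeasure (label_law \<pi>1 n) {\<theta>} * (\<Prod>i<n. ennreal (lr (\<theta> i) (x i)))"
proof -
  have "pmf (bernoulli_pmf (1 - W (x i))) (\<theta> i) = pmf (bernoulli_pmf \<pi>1) (\<theta> i) * lr (\<theta> i) (x i)" if "i < n" for i
  proof -
    have *: "1 - \<pi>1 = \<pi>0" using \<pi> by simp
    show ?thesis
      using W_bounds[OF sample_in_space[OF x that]] \<pi> by (cases "\<theta> i") (simp_all add: lr_def *)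
  qed
  then show ?thesis
    unfolding posterior_def label_law_def emeasure_bernoulli_PiM_singleton[OF \<theta>] prod.distrib[symmetric]
    using sample_in_space[OF x] by (intro prod.cong refl) (simp add: lr_nonneg ennreal_mult)
qed

text \<open>This is Bayes' rule, with the labels drawn last.\<close>

lemma joint_law_eq:
  assumes K: "decision_rule M n K"
  shows "joint_law M \<pi>1 f0 f1 n K = Pn n \<bind> (\<lambda>x. K x \<bind> posterior_law n x)"
    (is "_ = ?R")
proof (rule measure_eqI)
  let ?T = "PiE {..<n} (\<lambda>_. UNIV) :: (nat \<Rightarrow> bool) set"
  note [measurable] = kernels[OF K] observation_kernel
  have labset [measurable_cong]: "sets (label_law \<pi>1 n) = sets (binary_space n)"
    by (simp add: label_law_def bernoulli_PiM_in_binary)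
  have lab: "label_law \<pi>1 n \<in> space (prob_algebra (binary_space n))"
    by (auto simp: space_prob_algebra labset)
      (auto simp: label_law_def intro!: prob_space_PiM prob_space_measure_pmf)
  have Pn: "Pn n \<in> space (prob_algebra (sample_space M n))"
    by (simp add: space_prob_algebra sets_Pn prob_space_Pn)
  have obs: "observation_law M f0 f1 n \<in> binary_space n \<rightarrow>\<^sub>M prob_algebra (sample_space M n)"
    using observation_kernel[of n] by (simp add: labset cong: measurable_cong_sets)
  have obs': "observation_law M f0 f1 n \<theta> \<in> space (prob_algebra (sample_space M n))" if "\<theta> \<in> ?T" for \<theta>
    using measurable_space[OF obs] that by (simp add: space_binary_space)
  have J: "joint_law M \<pi>1 f0 f1 n K = label_law \<pi>1 n \<bind> (\<lambda>\<theta>. observation_law M f0 f1 n \<theta> \<bind> inner_law n K \<theta>)"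
    unfolding joint_law_def inner_law_def ..
  have k1: "(\<lambda>\<theta>. observation_law M f0 f1 n \<theta> \<bind> inner_law n K \<theta>) \<in> binary_space n \<rightarrow>\<^sub>M prob_algebra (triple_space M n)"
    by measurable
  have sJ: "sets (joint_law M \<pi>1 f0 f1 n K) = sets (triple_space M n)"
    unfolding J using lab k1 by (rule sets_bind')
  have sR: "sets ?R = sets (triple_space M n)"
    using Pn kernels(4)[OF K] by (rule sets_bind')
  show "sets (joint_law M \<pi>1 f0 f1 n K) = sets ?R" using sJ sR by simp
  fix A assume "A \<in> sets (joint_law M \<pi>1 f0 f1 n K)"
  then have A[measurable]: "A \<in> sets (triple_space M n)" using sJ by simp
  \<comment> \<open>\<open>G\<close> is the mass of \<open>A\<close> when only the decisions remain
    to be drawn. Both orders of drawing reduce to sums over label vectors of weighted integrals of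
    \<open>G\<close>.\<close>
  define G where "G \<theta> x = emeasure (inner_law n K \<theta> x) A" for \<theta> x
  have ik: "inner_law n K \<theta> \<in> sample_space M n \<rightarrow>\<^sub>M prob_algebra (triple_space M n)" if "\<theta> \<in> ?T" for \<theta>
    using measurable_Pair2[OF kernels(2)[OF K], of \<theta>] that by (simp add: space_binary_space)
  have Gm: "G \<theta> \<in> borel_measurable (Pn n)" if "\<theta> \<in> ?T" for \<theta>
    unfolding G_def measurable_cong_sets[OF sets_Pn refl]
    using measurable_compose[OF measurable_prob_algebraD[OF ik[OF that]] measurable_emeasure_subprob_algebra[OF A]] .
  have Lm: "(\<lambda>x. \<Prod>i<n. ennreal (lr (\<theta> i) (x i))) \<in> borel_measurable (Pn n)" for \<theta>
    unfolding measurable_cong_sets[OF sets_Pn refl]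
    by (intro borel_measurable_prod_ennreal measurable_compose[OF measurable_sample_component]) auto
  have Kx: "K x \<in> space (prob_algebra (binary_space n))" if "x \<in> space (sample_space M n)" for x
    using measurable_space[OF kernels(1)[OF K] that] .
  have Geq: "G \<theta> x = (\<integral>\<^sup>+d. indicator A (\<theta>, x, d) \<partial>K x)" if "\<theta> \<in> ?T" "x \<in> space (sample_space M n)" for \<theta> x
  proof -
    have m: "(\<lambda>d. return (triple_space M n) (\<theta>, x, d)) \<in> binary_space n \<rightarrow>\<^sub>M prob_algebra (triple_space M n)"
      using that by (auto intro!: measurable_compose[OF _ measurable_return_prob_space] simp: space_binary_space)
    show ?thesis
      unfolding G_def inner_law_def emeasure_bind_prob_algebra[OF Kx[OF that(2)] m A]
      using A by simp
  qed
  have "emeasure (joint_law M \<pi>1 f0 f1 n K) A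
     = (\<integral>\<^sup>+\<theta>. emeasure (observation_law M f0 f1 n \<theta> \<bind> inner_law n K \<theta>) A \<partial>label_law \<pi>1 n)"
    unfolding J using lab k1 A by (rule emeasure_bind_prob_algebra)
  \<comment> \<open>There are finitely many label vectors, so the integral over labels is a sum and
    can be exchanged with the integral over observations by additivity.\<close>
  also have "\<dots> = (\<Sum>\<theta>\<in>?T. emeasure (observation_law M f0 f1 n \<theta> \<bind> inner_law n K \<theta>) A * emeasure (label_law \<pi>1 n) {\<theta>})"
    using sets_eq_imp_space_eq[OF labset]
    by (subst nn_integral_finite_space) (auto simp: space_binary_space sets_binary_space labset finite_binary_space)
  also have "\<dots> = (\<Sum>\<theta>\<in>?T. (\<integral>\<^sup>+x. (\<Prod>i<n. ennreal (lr (\<theta> i) (x i))) * G \<theta> x \<partial>Pn n) * emeasure (label_law \<pi>1 n) {\<theta>})"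
  proof (intro sum.cong refl arg_cong2[where f="(*)"])
    fix \<theta> assume \<theta>: "\<theta> \<in> ?T"
    have "emeasure (observation_law M f0 f1 n \<theta> \<bind> inner_law n K \<theta>) A = (\<integral>\<^sup>+x. G \<theta> x \<partial>observation_law M f0 f1 n \<theta>)"
      unfolding G_def using obs'[OF \<theta>] ik[OF \<theta>] A by (rule emeasure_bind_prob_algebra)
    also have "\<dots> = (\<integral>\<^sup>+x. (\<Prod>i<n. ennreal (lr (\<theta> i) (x i))) * G \<theta> x \<partial>Pn n)"
      unfolding observation_law_eq using \<theta> by (intro nn_integral_density Lm Gm)
    finally show "emeasure (observation_law M f0 f1 n \<theta> \<bind> inner_law n K \<theta>) A = \<dots>" .
  qed
  also have "\<dots> = (\<Sum>\<theta>\<in>?T. (\<integral>\<^sup>+x. emeasure (label_law \<pi>1 n) {\<theta>} * ((\<Prod>i<n. ennreal (lr (\<theta> i) (x i))) * G \<theta> x) \<partial>Pn n))"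
    by (intro sum.cong refl)
      (subst nn_integral_cmult[OF borel_measurable_times_ennreal[OF Lm Gm]], assumption, rule mult.commute)
  \<comment> \<open>Bayes' rule for each label vector; from here on the posterior stands in place of
    the prior.\<close>
  also have "\<dots> = (\<Sum>\<theta>\<in>?T. (\<integral>\<^sup>+x. emeasure (posterior n x) {\<theta>} * G \<theta> x \<partial>Pn n))"
    by (intro sum.cong refl nn_integral_cong) (simp add: space_Pn emeasure_posterior_singleton mult.assoc)
  also have "\<dots> = (\<integral>\<^sup>+x. (\<Sum>\<theta>\<in>?T. emeasure (posterior n x) {\<theta>} * G \<theta> x) \<partial>Pn n)"
  proof (intro nn_integral_sum[symmetric])
    fix \<theta> assume \<theta>: "\<theta> \<in> ?T"
    have "{\<theta>} \<in> sets (binary_space n)" using \<theta> by (simp add: sets_binary_space)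
    from measurable_compose[OF measurable_prob_algebraD[OF posterior_kernel] measurable_emeasure_subprob_algebra[OF this]]
    show "(\<lambda>x. emeasure (posterior n x) {\<theta>} * G \<theta> x) \<in> borel_measurable (Pn n)"
      by (intro borel_measurable_times_ennreal Gm \<theta>) (simp add: measurable_cong_sets[OF sets_Pn refl])
  qed
  also have "\<dots> = (\<integral>\<^sup>+x. emeasure (K x \<bind> posterior_law n x) A \<partial>Pn n)"
  proof (rule nn_integral_cong)
    fix x assume "x \<in> space (Pn n)"
    then have x: "x \<in> space (sample_space M n)" by (simp add: space_Pn)
    have k: "posterior_law n x \<in> binary_space n \<rightarrow>\<^sub>M prob_algebra (triple_space M n)"
      using measurable_Pair2[OF kernels(3)[OF K] x] by simp
    have post: "posterior n x \<in> space (prob_algebra (binary_space n))"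
      by (rule measurable_space[OF posterior_kernel x])
    then have ps: "sets (posterior n x) = sets (binary_space n)" by (simp add: space_prob_algebra)
    have Ks: "sets (K x) = sets (binary_space n)" using Kx[OF x] by (simp add: space_prob_algebra)
    have "emeasure (K x \<bind> posterior_law n x) A = (\<integral>\<^sup>+d. emeasure (posterior_law n x d) A \<partial>K x)"
      using Kx[OF x] k A by (rule emeasure_bind_prob_algebra)
    also have "\<dots> = (\<integral>\<^sup>+d. (\<Sum>\<theta>\<in>?T. emeasure (posterior n x) {\<theta>} * indicator A (\<theta>, x, d)) \<partial>K x)"
    proof (rule nn_integral_cong)
      fix d assume "d \<in> space (K x)"
      then have d: "d \<in> space (binary_space n)" using sets_eq_imp_space_eq[OF Ks] by simp
      have m: "(\<lambda>\<theta>. return (triple_space M n) (\<theta>, x, d)) \<in> binary_space n \<rightarrow>\<^sub>M prob_algebra (triple_space M n)"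
        using x d by (auto intro!: measurable_compose[OF _ measurable_return_prob_space])
      have "emeasure (posterior_law n x d) A = (\<integral>\<^sup>+\<theta>. indicator A (\<theta>, x, d) \<partial>posterior n x)"
        unfolding posterior_law_def emeasure_bind_prob_algebra[OF post m A] using A by simp
      also have "\<dots> = (\<Sum>\<theta>\<in>?T. indicator A (\<theta>, x, d) * emeasure (posterior n x) {\<theta>})"
        using sets_eq_imp_space_eq[OF ps]
        by (subst nn_integral_finite_space) (auto simp: space_binary_space sets_binary_space ps finite_binary_space)
      finally show "emeasure (posterior_law n x d) A = (\<Sum>\<theta>\<in>?T. emeasure (posterior n x) {\<theta>} * indicator A (\<theta>, x, d))"
        by (simp add: mult.commute)
    qed
    also have "\<dots> = (\<Sum>\<theta>\<in>?T. emeasure (posterior n x) {\<theta>} * G \<theta> x)"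
    proof -
      have m: "(\<lambda>d. indicator A (\<theta>, x, d) :: ennreal) \<in> borel_measurable (K x)" if "\<theta> \<in> ?T" for \<theta>
      proof -
        have "(\<lambda>d. (\<theta>, x, d)) \<in> binary_space n \<rightarrow>\<^sub>M triple_space M n"
          using that x by (simp add: space_binary_space)
        from measurable_compose[OF this borel_measurable_indicator[OF A]]
        show ?thesis by (simp add: measurable_cong_sets[OF Ks refl])
      qed
      have "(\<integral>\<^sup>+d. (\<Sum>\<theta>\<in>?T. emeasure (posterior n x) {\<theta>} * indicator A (\<theta>, x, d)) \<partial>K x)
          = (\<Sum>\<theta>\<in>?T. \<integral>\<^sup>+d. emeasure (posterior n x) {\<theta>} * indicator A (\<theta>, x, d) \<partial>K x)"
        by (intro nn_integral_sum borel_measurable_times_ennreal m) auto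
      also have "\<dots> = (\<Sum>\<theta>\<in>?T. emeasure (posterior n x) {\<theta>} * G \<theta> x)"
        by (intro sum.cong refl) (simp add: nn_integral_cmult[OF m] Geq x)
      finally show ?thesis .
    qed
    finally show "(\<Sum>\<theta>\<in>?T. emeasure (posterior n x) {\<theta>} * G \<theta> x) = emeasure (K x \<bind> posterior_law n x) A" ..
  qed
  also have "\<dots> = emeasure ?R A"
    using Pn kernels(4)[OF K] A by (rule emeasure_bind_prob_algebra[symmetric])
  finally show "emeasure (joint_law M \<pi>1 f0 f1 n K) A = emeasure ?R A" .
qed

end

section \<open>Concentration\<close>

text \<open>A non-integrable \<open>f\<close> has integral 0 by default, and
  \<open>0 \<le> c\<close> covers that case; a pointwise bound is then all that has to be
  supplied.\<close>

lemma (in prob_space) expectation_le_const: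
  assumes "0 \<le> c" "\<And>x. x \<in> space M \<Longrightarrow> f x \<le> c"
  shows "expectation f \<le> (c::real)"
  using assms by (cases "integrable M f") (auto intro!: integral_le_const simp: not_integrable_integral_eq)

text \<open>The exceptional sets \<open>A n\<close> are measurable even where \<open>Q n\<close> is not, so that \<open>whp\<close> is monotone in \<open>Q\<close>.\<close>

definition whp :: "(nat \<Rightarrow> 'a measure) \<Rightarrow> (nat \<Rightarrow> 'a \<Rightarrow> bool) \<Rightarrow> bool" where
  "whp N Q \<longleftrightarrow> (\<exists>A. (\<forall>n\<ge>1. A n \<in> sets (N n) \<and> (\<forall>\<omega>\<in>space (N n) - A n. Q n \<omega>)) \<and>
     (\<lambda>n. measure (N n) (A n)) \<longlonglongrightarrow> 0)"

lemma whpI: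
  assumes "\<And>n. n \<ge> 1 \<Longrightarrow> {\<omega>\<in>space (N n). \<not> Q n \<omega>} \<in> sets (N n)"
    and "\<And>n. n \<ge> 1 \<Longrightarrow> measure (N n) {\<omega>\<in>space (N n). \<not> Q n \<omega>} \<le> c n" and "c \<longlonglongrightarrow> 0"
  shows "whp N Q"
  unfolding whp_def
proof (intro exI conjI allI impI ballI)
  show "(\<lambda>n. measure (N n) {\<omega>\<in>space (N n). \<not> Q n \<omega>}) \<longlonglongrightarrow> 0"
    using assms by (intro tendsto_sandwich[OF _ _ tendsto_const assms(3)] eventually_sequentiallyI[of 1]) auto
qed (use assms in auto)

lemma whpE:
  assumes "whp N Q"
  obtains A where "\<And>n. n \<ge> 1 \<Longrightarrow> A n \<in> sets (N n)" "(\<lambda>n. measure (N n) (A n)) \<longlonglongrightarrow> 0"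
    "\<And>n \<omega>. n \<ge> 1 \<Longrightarrow> \<omega> \<in> space (N n) - A n \<Longrightarrow> Q n \<omega>"
  using assms unfolding whp_def by blast

lemma whp_conj:
  assumes "whp N Q" "whp N R"
  shows "whp N (\<lambda>n \<omega>. Q n \<omega> \<and> R n \<omega>)"
proof -
  from whpE[OF assms(1)] obtain A where A: "\<And>n. n \<ge> 1 \<Longrightarrow> A n \<in> sets (N n)" "(\<lambda>n. measure (N n) (A n)) \<longlonglongrightarrow> 0"
    "\<And>n \<omega>. n \<ge> 1 \<Longrightarrow> \<omega> \<in> space (N n) - A n \<Longrightarrow> Q n \<omega>" by blast
  from whpE[OF assms(2)] obtain B where B: "\<And>n. n \<ge> 1 \<Longrightarrow> B n \<in> sets (N n)" "(\<lambda>n. measure (N n) (B n)) \<longlonglongrightarrow> 0"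
    "\<And>n \<omega>. n \<ge> 1 \<Longrightarrow> \<omega> \<in> space (N n) - B n \<Longrightarrow> R n \<omega>" by blast
  show ?thesis
    unfolding whp_def
  proof (intro exI[of _ "\<lambda>n. A n \<union> B n"] conjI allI impI ballI)
    show "(\<lambda>n. measure (N n) (A n \<union> B n)) \<longlonglongrightarrow> 0"
    proof (rule tendsto_sandwich[OF _ _ tendsto_const])
      show "\<forall>\<^sub>F n in sequentially. measure (N n) (A n \<union> B n) \<le> measure (N n) (A n) + measure (N n) (B n)"
        using A B by (intro eventually_sequentiallyI[of 1] measure_Un_le) auto
      show "(\<lambda>n. measure (N n) (A n) + measure (N n) (B n)) \<longlonglongrightarrow> 0"
        using tendsto_add[OF A(2) B(2)] by simp
    qed auto
    fix n :: nat assume n: "n \<ge> 1"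
    show "A n \<union> B n \<in> sets (N n)" using A(1) B(1) n by blast
    fix \<omega> assume "\<omega> \<in> space (N n) - (A n \<union> B n)"
    then show "Q n \<omega>" "R n \<omega>" using A(3)[OF n] B(3)[OF n] by blast+
  qed
qed

lemma whp_mono:
  assumes "whp N Q" "\<And>n \<omega>. n \<ge> 1 \<Longrightarrow> \<omega> \<in> space (N n) \<Longrightarrow> Q n \<omega> \<Longrightarrow> R n \<omega>"
  shows "whp N R"
  using assms unfolding whp_def by blast

lemma prob_tendsto_1_of_whp:
  assumes Q: "whp N Q" and N: "\<And>n. n \<ge> 1 \<Longrightarrow> prob_space (N n)"
    and m: "\<And>n. n \<ge> 1 \<Longrightarrow> {\<omega>\<in>space (N n). Q n \<omega>} \<in> sets (N n)"
  shows "(\<lambda>n. measure (N n) {\<omega>\<in>space (N n). Q n \<omega>}) \<longlonglongrightarrow> 1"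
proof -
  from whpE[OF Q] obtain A where A: "\<And>n. n \<ge> 1 \<Longrightarrow> A n \<in> sets (N n)" "(\<lambda>n. measure (N n) (A n)) \<longlonglongrightarrow> 0"
    "\<And>n \<omega>. n \<ge> 1 \<Longrightarrow> \<omega> \<in> space (N n) - A n \<Longrightarrow> Q n \<omega>" by blast
  show ?thesis
  proof (rule tendsto_sandwich[OF _ _ _ tendsto_const])
    show "(\<lambda>n. 1 - measure (N n) (A n)) \<longlonglongrightarrow> 1"
      using tendsto_diff[OF tendsto_const A(2), of 1] by simp
    show "\<forall>\<^sub>F n in sequentially. 1 - measure (N n) (A n) \<le> measure (N n) {\<omega>\<in>space (N n). Q n \<omega>}"
    proof (rule eventually_sequentiallyI)
      fix n :: nat assume n: "n \<ge> 1"
      interpret prob_space "N n" using N n .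
      have "1 - prob (A n) = prob (space (N n) - A n)" using A n by (simp add: prob_compl)
      also have "\<dots> \<le> prob {\<omega>\<in>space (N n). Q n \<omega>}"
        using A n m by (intro finite_measure_mono) auto
      finally show "1 - prob (A n) \<le> \<dots>" .
    qed
    show "\<forall>\<^sub>F n in sequentially. measure (N n) {\<omega>\<in>space (N n). Q n \<omega>} \<le> 1"
      using N by (intro eventually_sequentiallyI[of 1] prob_space.prob_le_1)
  qed
qed

lemma whp_of_prob_tendsto_1:
  assumes N: "\<And>n. n \<ge> 1 \<Longrightarrow> prob_space (N n)"
    and m: "\<And>n. n \<ge> 1 \<Longrightarrow> {\<omega>\<in>space (N n). Q n \<omega>} \<in> sets (N n)"
    and Q: "(\<lambda>n. measure (N n) {\<omega>\<in>space (N n). Q n \<omega>}) \<longlonglongrightarrow> 1"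
  shows "whp N Q"
proof (rule whpI)
  have e: "{\<omega>\<in>space (N n). \<not> Q n \<omega>} = space (N n) - {\<omega>\<in>space (N n). Q n \<omega>}" for n by auto
  show "{\<omega>\<in>space (N n). \<not> Q n \<omega>} \<in> sets (N n)" if "n \<ge> 1" for n
    using m[OF that] unfolding e by auto
  show "measure (N n) {\<omega>\<in>space (N n). \<not> Q n \<omega>} \<le> 1 - measure (N n) {\<omega>\<in>space (N n). Q n \<omega>}" if "n \<ge> 1" for n
    unfolding e using prob_space.prob_compl[OF N m, of n] that by simp
  show "(\<lambda>n. 1 - measure (N n) {\<omega>\<in>space (N n). Q n \<omega>}) \<longlonglongrightarrow> 0"
    using tendsto_diff[OF tendsto_const Q, of 1] by simp
qed

lemma whp_AE:
  assumes N: "\<And>n. n \<ge> 1 \<Longrightarrow> prob_space (N n)" and Q: "\<And>n. n \<ge> 1 \<Longrightarrow> AE \<omega> in N n. Q n \<omega>"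
  shows "whp N Q"
proof -
  have "\<exists>A. n \<ge> 1 \<longrightarrow> A \<in> sets (N n) \<and> (\<forall>\<omega>\<in>space (N n) - A. Q n \<omega>) \<and> measure (N n) A = 0" for n
  proof (cases "n \<ge> 1")
    case True
    from AE_E[OF Q[OF this]] obtain A where "{\<omega> \<in> space (N n). \<not> Q n \<omega>} \<subseteq> A" "emeasure (N n) A = 0" "A \<in> sets (N n)" .
    then show ?thesis by (intro exI[of _ A]) (auto simp: measure_def)
  qed auto
  then obtain A where A: "\<And>n. n \<ge> 1 \<Longrightarrow> A n \<in> sets (N n) \<and> (\<forall>\<omega>\<in>space (N n) - A n. Q n \<omega>) \<and> measure (N n) (A n) = 0"
    by metis
  have "(\<lambda>n. measure (N n) (A n)) \<longlonglongrightarrow> 0"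
    using A by (intro tendsto_eventually eventually_sequentiallyI[of 1]) auto
  then show ?thesis unfolding whp_def using A by blast
qed

section \<open>Measurability of the counts and proportions\<close>

abbreviation "lab \<omega> \<equiv> fst \<omega>"
abbreviation "obs \<omega> \<equiv> fst (snd \<omega>)"
abbreviation "dec \<omega> \<equiv> snd (snd \<omega>)"

lemma measurable_triple_component:
  assumes "i < n"
  shows "(\<lambda>\<omega>. (c (lab \<omega> i) :: real)) \<in> borel_measurable (triple_space M n)"
    and "(\<lambda>\<omega>. (c (dec \<omega> i) :: real)) \<in> borel_measurable (triple_space M n)"
    and "g \<in> borel_measurable M \<Longrightarrow> (\<lambda>\<omega>. (g (obs \<omega> i) :: real)) \<in> borel_measurable (triple_space M n)"
proof -
  have c: "c \<in> borel_measurable (count_space UNIV)" by simp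
  show "(\<lambda>\<omega>. c (lab \<omega> i)) \<in> borel_measurable (triple_space M n)"
    by (rule measurable_compose[OF measurable_compose[OF measurable_fst measurable_binary_component[OF assms]] c])
  show "(\<lambda>\<omega>. c (dec \<omega> i)) \<in> borel_measurable (triple_space M n)"
    by (rule measurable_compose[OF measurable_compose[OF measurable_compose[OF measurable_snd measurable_snd] measurable_binary_component[OF assms]] c])
  show "(\<lambda>\<omega>. g (obs \<omega> i)) \<in> borel_measurable (triple_space M n)" if g: "g \<in> borel_measurable M"
    by (rule measurable_compose[OF measurable_compose[OF measurable_compose[OF measurable_snd measurable_fst] measurable_sample_component[OF assms]] g])
qed

lemma measurable_counts:
  shows "(\<lambda>\<omega>. discoveries n (dec \<omega>)) \<in> borel_measurable (triple_space M n)"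
    and "(\<lambda>\<omega>. nondiscoveries n (dec \<omega>)) \<in> borel_measurable (triple_space M n)"
    and "(\<lambda>\<omega>. false_discoveries n (lab \<omega>) (dec \<omega>)) \<in> borel_measurable (triple_space M n)"
    and "(\<lambda>\<omega>. false_nondiscoveries n (lab \<omega>) (dec \<omega>)) \<in> borel_measurable (triple_space M n)"
  unfolding discoveries_def nondiscoveries_def false_discoveries_def false_nondiscoveries_def
  by (intro borel_measurable_sum borel_measurable_times borel_measurable_diff borel_measurable_const
      measurable_triple_component(1)[where c="of_bool"] measurable_triple_component(2)[where c="of_bool"]; simp)+

lemma measurable_FDP_FNP:
  shows "(\<lambda>\<omega>. FDP n (lab \<omega>) (dec \<omega>)) \<in> borel_measurable (triple_space M n)"
    and "(\<lambda>\<omega>. FNP n (lab \<omega>) (dec \<omega>)) \<in> borel_measurable (triple_space M n)"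
  unfolding FDP_def FNP_def using measurable_counts by (auto intro!: borel_measurable_divide borel_measurable_max)

section \<open>Integration and tail bounds under the joint law\<close>

context two_group
begin

abbreviation "J n K \<equiv> joint_law M \<pi>1 f0 f1 n K"

lemma Pn_in: "Pn n \<in> space (prob_algebra (sample_space M n))"
  by (simp add: space_prob_algebra sets_Pn prob_space_Pn)

lemma sets_J: "decision_rule M n K \<Longrightarrow> sets (J n K) = sets (triple_space M n)"
  unfolding joint_law_eq by (rule sets_bind'[OF Pn_in kernels(4)])

lemma space_J: "decision_rule M n K \<Longrightarrow> space (J n K) = space (triple_space M n)"
  by (rule sets_eq_imp_space_eq[OF sets_J])

lemma prob_space_J: "decision_rule M n K \<Longrightarrow> prob_space (J n K)"
  unfolding joint_law_eq by (rule prob_space_bind'[OF Pn_in kernels(4)])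

lemma measurable_J: "decision_rule M n K \<Longrightarrow> measurable (J n K) N = measurable (triple_space M n) N"
  by (intro measurable_cong_sets sets_J refl)

text \<open>Bayes' rule in its working form: the labels are integrated innermost, against their
  posterior, while observations and decisions are held fixed.\<close>

lemma integral_J:
  fixes h :: "_ \<Rightarrow> real"
  assumes K: "decision_rule M n K" and h: "h \<in> borel_measurable (triple_space M n)"
    and bnd: "\<And>\<omega>. \<omega> \<in> space (triple_space M n) \<Longrightarrow> 0 \<le> h \<omega> \<and> h \<omega> \<le> C"
  shows "(\<integral>\<omega>. h \<omega> \<partial>J n K) = (\<integral>x. (\<integral>d. (\<integral>\<theta>. h (\<theta>, x, d) \<partial>posterior n x) \<partial>K x) \<partial>Pn n)"
proof -
  have k4: "(\<lambda>x. K x \<bind> posterior_law n x) \<in> Pn n \<rightarrow>\<^sub>M prob_algebra (triple_space M n)"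
    using kernels(4)[OF K] by (simp add: measurable_cong_sets[OF sets_Pn refl])
  have "(\<integral>\<omega>. h \<omega> \<partial>J n K) = (\<integral>x. (\<integral>\<omega>. h \<omega> \<partial>(K x \<bind> posterior_law n x)) \<partial>Pn n)"
    unfolding joint_law_eq[OF K] by (rule integral_bind_bounded(1)[OF h k4 prob_space_Pn bnd])
  also have "\<dots> = (\<integral>x. (\<integral>d. (\<integral>\<theta>. h (\<theta>, x, d) \<partial>posterior n x) \<partial>K x) \<partial>Pn n)"
  proof (rule Bochner_Integration.integral_cong[OF refl])
    fix x assume "x \<in> space (Pn n)"
    then have x: "x \<in> space (sample_space M n)" by (simp add: space_Pn)
    have Kx: "prob_space (K x)" "sets (K x) = sets (binary_space n)"
      using measurable_space[OF kernels(1)[OF K] x] by (auto simp: space_prob_algebra)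
    have px: "prob_space (posterior n x)" "sets (posterior n x) = sets (binary_space n)"
      using measurable_space[OF posterior_kernel x] by (auto simp: space_prob_algebra)
    have k: "posterior_law n x \<in> K x \<rightarrow>\<^sub>M prob_algebra (triple_space M n)"
      using measurable_Pair2[OF kernels(3)[OF K] x] by (simp add: measurable_cong_sets[OF Kx(2) refl])
    have "(\<integral>\<omega>. h \<omega> \<partial>(K x \<bind> posterior_law n x)) = (\<integral>d. (\<integral>\<omega>. h \<omega> \<partial>posterior_law n x d) \<partial>K x)"
      by (rule integral_bind_bounded(1)[OF h k Kx(1) bnd])
    also have "\<dots> = (\<integral>d. (\<integral>\<theta>. h (\<theta>, x, d) \<partial>posterior n x) \<partial>K x)"
    proof (rule Bochner_Integration.integral_cong[OF refl])
      fix d assume "d \<in> space (K x)"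
      then have d: "d \<in> space (binary_space n)" using sets_eq_imp_space_eq[OF Kx(2)] by simp
      have m: "(\<lambda>\<theta>. return (triple_space M n) (\<theta>, x, d)) \<in> posterior n x \<rightarrow>\<^sub>M prob_algebra (triple_space M n)"
        unfolding measurable_cong_sets[OF px(2) refl]
        using x d by (auto intro!: measurable_compose[OF _ measurable_return_prob_space])
      have "(\<integral>\<omega>. h \<omega> \<partial>posterior_law n x d) = (\<integral>\<theta>. (\<integral>\<omega>. h \<omega> \<partial>return (triple_space M n) (\<theta>, x, d)) \<partial>posterior n x)"
        unfolding posterior_law_def by (rule integral_bind_bounded(1)[OF h m px(1) bnd])
      also have "\<dots> = (\<integral>\<theta>. h (\<theta>, x, d) \<partial>posterior n x)"
        using x d sets_eq_imp_space_eq[OF px(2)]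
        by (intro Bochner_Integration.integral_cong refl integral_return h) (auto simp: space_pair_measure)
      finally show "(\<integral>\<omega>. h \<omega> \<partial>posterior_law n x d) = (\<integral>\<theta>. h (\<theta>, x, d) \<partial>posterior n x)" .
    qed
    finally show "(\<integral>\<omega>. h \<omega> \<partial>(K x \<bind> posterior_law n x)) = (\<integral>d. (\<integral>\<theta>. h (\<theta>, x, d) \<partial>posterior n x) \<partial>K x)" .
  qed
  finally show ?thesis .
qed

lemma K_facts:
  assumes "decision_rule M n K" "x \<in> space (sample_space M n)"
  shows "prob_space (K x)" "sets (K x) = sets (binary_space n)" "space (K x) = space (binary_space n)"
    "measure (K x) (space (binary_space n)) = 1"
  using measurable_space[OF kernels(1)[OF assms(1)] assms(2)] sets_eq_imp_space_eq[of "K x" "binary_space n"]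
    prob_space.prob_space[of "K x"]
  by (auto simp: space_prob_algebra)

lemma posterior_facts:
  assumes "x \<in> space (sample_space M n)"
  shows "prob_space (posterior n x)" "sets (posterior n x) = sets (binary_space n)"
    "space (posterior n x) = space (binary_space n)"
    "measure (posterior n x) (space (binary_space n)) = 1"
  using measurable_space[OF posterior_kernel assms] sets_eq_imp_space_eq[of "posterior n x" "binary_space n"]
    prob_space.prob_space[of "posterior n x"]
  by (auto simp: space_prob_algebra)

text \<open>The integrals over labels and decisions see a constant, so under every rule the
  observations are an iid sample from the mixture.\<close>

lemma integral_J_obs:
  fixes g :: "_ \<Rightarrow> real"
  assumes K: "decision_rule M n K" and g: "g \<in> borel_measurable (sample_space M n)"
    and bnd: "\<And>x. x \<in> space (sample_space M n) \<Longrightarrow> 0 \<le> g x \<and> g x \<le> C"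
  shows "(\<integral>\<omega>. g (obs \<omega>) \<partial>J n K) = (\<integral>x. g x \<partial>Pn n)"
proof -
  have "(\<integral>\<omega>. g (obs \<omega>) \<partial>J n K) = (\<integral>x. (\<integral>d. (\<integral>\<theta>. g x \<partial>posterior n x) \<partial>K x) \<partial>Pn n)"
    using K by (subst integral_J[where C=C]) (use bnd g in \<open>auto simp: space_pair_measure\<close>)
  also have "\<dots> = (\<integral>x. g x \<partial>Pn n)"
    using K_facts[OF K] posterior_facts
    by (intro Bochner_Integration.integral_cong refl) (simp add: space_Pn prob_space.prob_space)
  finally show ?thesis .
qed

lemma integral_Pn_component:
  fixes g :: "_ \<Rightarrow> real"
  assumes "i < n" "g \<in> borel_measurable M"
  shows "(\<integral>x. g (x i) \<partial>Pn n) = (\<integral>x. g x \<partial>P)"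
  using assms distr_PiM_component[of "{..<n}" "\<lambda>_. P" i] prob_space_P
  by (subst integral_distr[of "\<lambda>\<omega>. \<omega> i" "Pn n" P g, symmetric]) (auto simp: measurable_cong_sets[OF sets_P refl])

text \<open>The weight \<open>v\<close> sees observations and decisions only, so it is constant in
  the innermost integral, where 1 - \<theta>_i has mean \<open>W\<close> at x_i. Randomization of
  the rule brings no bias, being independent of the labels given the observations.\<close>

lemma integral_J_null_weight:
  fixes v :: "_ \<Rightarrow> real"
  assumes K: "decision_rule M n K" and i: "i < n"
    and v: "v \<in> borel_measurable (sample_space M n \<Otimes>\<^sub>M binary_space n)"
    and bnd: "\<And>z. z \<in> space (sample_space M n \<Otimes>\<^sub>M binary_space n) \<Longrightarrow> 0 \<le> v z \<and> v z \<le> 1"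
  shows "(\<integral>\<omega>. v (snd \<omega>) * (1 - of_bool (lab \<omega> i)) \<partial>J n K) = (\<integral>\<omega>. v (snd \<omega>) * W (obs \<omega> i) \<partial>J n K)"
proof -
  have vm: "(\<lambda>\<omega>. v (snd \<omega>)) \<in> borel_measurable (triple_space M n)"
    by (rule measurable_compose[OF measurable_snd v])
  have "(\<integral>\<omega>. v (snd \<omega>) * (1 - of_bool (lab \<omega> i)) \<partial>J n K) =
     (\<integral>x. (\<integral>d. (\<integral>\<theta>. v (x, d) * (1 - of_bool (\<theta> i)) \<partial>posterior n x) \<partial>K x) \<partial>Pn n)"
    using bnd i vm by (subst integral_J[OF K, where C=1])
      (auto simp: space_pair_measure intro!: borel_measurable_times measurable_triple_component mult_le_one)
  also have "\<dots> = (\<integral>x. (\<integral>d. (\<integral>\<theta>. v (x, d) * W (x i) \<partial>posterior n x) \<partial>K x) \<partial>Pn n)"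
  proof (rule Bochner_Integration.integral_cong[OF refl])
    fix x assume "x \<in> space (Pn n)"
    then have x: "x \<in> space (sample_space M n)" by (simp add: space_Pn)
    have "(\<integral>\<theta>. 1 - of_bool (\<theta> i) \<partial>posterior n x) = W (x i)"
      unfolding posterior_def using W_bounds[OF sample_in_space[OF x i]] i
      by (subst integral_bernoulli_component[where c="\<lambda>b. 1 - of_bool b"]) auto
    then show "(\<integral>d. (\<integral>\<theta>. v (x, d) * (1 - of_bool (\<theta> i)) \<partial>posterior n x) \<partial>K x) =
        (\<integral>d. (\<integral>\<theta>. v (x, d) * W (x i) \<partial>posterior n x) \<partial>K x)"
      using posterior_facts[OF x] by simp
  qed
  also have "\<dots> = (\<integral>\<omega>. v (snd \<omega>) * W (obs \<omega> i) \<partial>J n K)"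
    using bnd i vm W_bounds sample_in_space by (subst integral_J[OF K, where C=1])
      (auto simp: space_pair_measure intro!: borel_measurable_times measurable_triple_component mult_le_one)
  finally show ?thesis .
qed

lemma measure_J_eq:
  assumes "decision_rule M n K" "A \<in> sets (triple_space M n)"
  shows "measure (J n K) A = (\<integral>\<omega>. indicator A \<omega> \<partial>J n K)"
  using assms sets.sets_into_space[OF assms(2)] by (simp add: sets_J space_J Int_absorb2)

text \<open>A bound uniform in the observations survives integration over them. The average over the
  decisions is kept in the premise because for the Neyman-Pearson coins it is the decisions, not the
  labels, that fluctuate.\<close>

lemma measure_J_le:
  assumes K: "decision_rule M n K" and A: "A \<in> sets (triple_space M n)" and c: "0 \<le> c"
    and le: "\<And>x. x \<in> space (sample_space M n) \<Longrightarrow>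
      (\<integral>d. measure (posterior n x) {\<theta>\<in>space (binary_space n). (\<theta>, x, d) \<in> A} \<partial>K x) \<le> c"
  shows "measure (J n K) A \<le> c"
proof -
  interpret Pn: prob_space "Pn n" by (rule prob_space_Pn)
  have "measure (J n K) A = (\<integral>\<omega>. indicator A \<omega> \<partial>J n K)"
    by (rule measure_J_eq[OF K A])
  also have "\<dots> = (\<integral>x. (\<integral>d. (\<integral>\<theta>. indicator A (\<theta>, x, d) \<partial>posterior n x) \<partial>K x) \<partial>Pn n)"
    using A by (intro integral_J[OF K, where C=1]) (auto simp: indicator_def)
  also have "\<dots> \<le> c"
  proof (rule Pn.expectation_le_const[OF c])
    fix x assume "x \<in> space (Pn n)"
    then have x: "x \<in> space (sample_space M n)" by (simp add: space_Pn)
    have "(\<integral>\<theta>. indicator A (\<theta>, x, d) \<partial>posterior n x) = measure (posterior n x) {\<theta>\<in>space (binary_space n). (\<theta>, x, d) \<in> A}" for d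
    proof -
      have "(\<integral>\<theta>. indicator A (\<theta>, x, d) \<partial>posterior n x) =
        (\<integral>\<theta>. indicat_real {\<theta>\<in>space (binary_space n). (\<theta>, x, d) \<in> A} \<theta> \<partial>posterior n x)"
        using posterior_facts[OF x] by (intro Bochner_Integration.integral_cong refl) (auto simp: indicator_def)
      then show ?thesis using posterior_facts[OF x] by (simp add: Int_absorb2)
    qed
    then show "(\<integral>d. (\<integral>\<theta>. indicator A (\<theta>, x, d) \<partial>posterior n x) \<partial>K x) \<le> c"
      using le[OF x] by simp
  qed
  finally show ?thesis .
qed

text \<open>Given observations and decisions the labels are independent, so Hoeffding applies under
  the posterior. The weight \<open>c\<close> serves two purposes: \<open>of_bool\<close> gives the
  false discoveries, the constant 1 the total number of true nulls.\<close>

lemma posterior_concentration: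
  fixes c :: "bool \<Rightarrow> real"
  assumes K: "\<And>n. n \<ge> 1 \<Longrightarrow> decision_rule M n (K n)" and e: "e > 0" and c: "\<And>b. 0 \<le> c b \<and> c b \<le> 1"
  shows "whp (\<lambda>n. J n (K n)) (\<lambda>n \<omega>.
    \<bar>(\<Sum>i<n. c (dec \<omega> i) * (1 - of_bool (lab \<omega> i))) - (\<Sum>i<n. c (dec \<omega> i) * W (obs \<omega> i))\<bar> < real n * e)"
proof (rule whpI[where c="\<lambda>n. hoeffding_tail n e"])
  fix n :: nat assume n: "n \<ge> 1"
  define Q where "Q \<omega> = \<bar>(\<Sum>i<n. c (dec \<omega> i) * (1 - of_bool (lab \<omega> i))) - (\<Sum>i<n. c (dec \<omega> i) * W (obs \<omega> i))\<bar>" for \<omega> :: "(nat \<Rightarrow> bool) \<times> (nat \<Rightarrow> 'x) \<times> (nat \<Rightarrow> bool)"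
  define A where "A = {\<omega>\<in>space (triple_space M n). \<not> Q \<omega> < real n * e}"
  have "Q \<in> borel_measurable (triple_space M n)"
    unfolding Q_def
    by (intro borel_measurable_abs borel_measurable_diff borel_measurable_sum borel_measurable_times
        measurable_triple_component(1)[where c="\<lambda>b. 1 - of_bool b"] measurable_triple_component(2)[where c=c]
        measurable_triple_component(3) W_measurable) auto
  then have A: "A \<in> sets (triple_space M n)" unfolding A_def by measurable
  have eqA: "{\<omega>\<in>space (J n (K n)). \<not> \<bar>(\<Sum>i<n. c (dec \<omega> i) * (1 - of_bool (lab \<omega> i))) - (\<Sum>i<n. c (dec \<omega> i) * W (obs \<omega> i))\<bar> < real n * e} = A"
    unfolding A_def Q_def space_J[OF K[OF n]] ..
  show "{\<omega>\<in>space (J n (K n)). \<not> \<bar>(\<Sum>i<n. c (dec \<omega> i) * (1 - of_bool (lab \<omega> i))) - (\<Sum>i<n. c (dec \<omega> i) * W (obs \<omega> i))\<bar> < real n * e} \<in> sets (J n (K n))"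
    unfolding eqA sets_J[OF K[OF n]] by (rule A)
  show "measure (J n (K n)) {\<omega>\<in>space (J n (K n)). \<not> \<bar>(\<Sum>i<n. c (dec \<omega> i) * (1 - of_bool (lab \<omega> i))) - (\<Sum>i<n. c (dec \<omega> i) * W (obs \<omega> i))\<bar> < real n * e} \<le> hoeffding_tail n e"
    unfolding eqA
  proof (rule measure_J_le[OF K[OF n] A hoeffding_tail_nonneg])
    fix x assume x: "x \<in> space (sample_space M n)"
    interpret Kx: prob_space "K n x" using K_facts[OF K[OF n] x] by simp
    show "(\<integral>d. measure (posterior n x) {\<theta>\<in>space (binary_space n). (\<theta>, x, d) \<in> A} \<partial>K n x) \<le> hoeffding_tail n e"
    proof (rule Kx.expectation_le_const[OF hoeffding_tail_nonneg])
      fix d assume "d \<in> space (K n x)"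
      then have d: "d \<in> space (binary_space n)" using K_facts[OF K[OF n] x] by simp
      have ex: "(\<Sum>i<n. \<integral>b. c (d i) * (1 - of_bool b) \<partial>measure_pmf (bernoulli_pmf (1 - W (x i)))) = (\<Sum>i<n. c (d i) * W (x i))"
      proof (intro sum.cong refl)
        fix i assume "i \<in> {..<n}"
        then show "(\<integral>b. c (d i) * (1 - of_bool b) \<partial>measure_pmf (bernoulli_pmf (1 - W (x i)))) = c (d i) * W (x i)"
          using W_bounds[OF sample_in_space[OF x, of i]] by (subst integral_bernoulli_pmf) auto
      qed
      have "measure (posterior n x) {\<theta>\<in>space (posterior n x).
          \<bar>(\<Sum>i<n. c (d i) * (1 - of_bool (\<theta> i))) - (\<Sum>i<n. \<integral>b. c (d i) * (1 - of_bool b) \<partial>measure_pmf (bernoulli_pmf (1 - W (x i))))\<bar> \<ge> real n * e} \<le> hoeffding_tail n e"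
        unfolding posterior_def using n e c by (intro PiM_hoeffding) (auto intro: prob_space_measure_pmf)
      also have "{\<theta>\<in>space (posterior n x).
          \<bar>(\<Sum>i<n. c (d i) * (1 - of_bool (\<theta> i))) - (\<Sum>i<n. \<integral>b. c (d i) * (1 - of_bool b) \<partial>measure_pmf (bernoulli_pmf (1 - W (x i))))\<bar> \<ge> real n * e}
         = {\<theta>\<in>space (binary_space n). (\<theta>, x, d) \<in> A}" unfolding ex A_def Q_def using posterior_facts(3)[OF x] x d
        by (simp add: space_pair_measure mem_Times_iff not_less)
      finally show "measure (posterior n x) {\<theta>\<in>space (binary_space n). (\<theta>, x, d) \<in> A} \<le> hoeffding_tail n e" .
    qed
  qed
qed (rule hoeffding_tail_tendsto_0[OF e])

lemma observation_concentration:
  fixes g :: "'x \<Rightarrow> real"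
  assumes K: "\<And>n. n \<ge> 1 \<Longrightarrow> decision_rule M n (K n)" and e: "e > 0"
    and g: "g \<in> borel_measurable M" "\<And>x. x \<in> space M \<Longrightarrow> 0 \<le> g x \<and> g x \<le> 1"
  shows "whp (\<lambda>n. J n (K n)) (\<lambda>n \<omega>. \<bar>(\<Sum>i<n. g (obs \<omega> i)) - real n * (\<integral>x. g x \<partial>P)\<bar> < real n * e)"
proof (rule whpI[where c="\<lambda>n. hoeffding_tail n e"])
  fix n :: nat assume n: "n \<ge> 1"
  define Q where "Q x = \<bar>(\<Sum>i<n. g (x i)) - real n * (\<integral>x. g x \<partial>P)\<bar>" for x
  have Qm: "Q \<in> borel_measurable (sample_space M n)"
    unfolding Q_def
    by (intro borel_measurable_abs borel_measurable_diff borel_measurable_sum borel_measurable_const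
        measurable_compose[OF measurable_sample_component g(1)]) auto
  define B where "B = {x\<in>space (sample_space M n). Q x \<ge> real n * e}"
  define A where "A = {\<omega>\<in>space (triple_space M n). \<not> Q (obs \<omega>) < real n * e}"
  have B: "B \<in> sets (sample_space M n)" unfolding B_def using Qm by measurable
  have "(\<lambda>\<omega>. Q (obs \<omega>)) \<in> borel_measurable (triple_space M n)"
    by (rule measurable_compose[OF measurable_compose[OF measurable_snd measurable_fst] Qm])
  then have A: "A \<in> sets (triple_space M n)" unfolding A_def by measurable
  have eqA: "{\<omega>\<in>space (J n (K n)). \<not> \<bar>(\<Sum>i<n. g (obs \<omega> i)) - real n * (\<integral>x. g x \<partial>P)\<bar> < real n * e} = A"
    unfolding A_def Q_def space_J[OF K[OF n]] ..
  show "{\<omega>\<in>space (J n (K n)). \<not> \<bar>(\<Sum>i<n. g (obs \<omega> i)) - real n * (\<integral>x. g x \<partial>P)\<bar> < real n * e} \<in> sets (J n (K n))"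
    unfolding eqA sets_J[OF K[OF n]] by (rule A)
  have "measure (J n (K n)) A = (\<integral>\<omega>. indicator A \<omega> \<partial>J n (K n))"
    by (rule measure_J_eq[OF K[OF n] A])
  also have "\<dots> = (\<integral>\<omega>. indicator B (obs \<omega>) \<partial>J n (K n))"
    unfolding A_def B_def using space_J[OF K[OF n]]
    by (intro Bochner_Integration.integral_cong refl) (simp add: indicator_def space_pair_measure mem_Times_iff not_less)
  also have "\<dots> = (\<integral>x. indicator B x \<partial>Pn n)"
    using B by (intro integral_J_obs[OF K[OF n], where C=1]) (auto simp: indicator_def)
  also have "\<dots> = measure (Pn n) B"
    using B sets.sets_into_space[OF B] by (simp add: space_Pn Int_absorb2)
  also have "\<dots> \<le> hoeffding_tail n e"
    using PiM_hoeffding[OF n e, of "\<lambda>_. P" "\<lambda>_. g"] prob_space_P g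
    unfolding B_def Q_def space_Pn[symmetric]
    by (simp add: measurable_cong_sets[OF sets_P refl] space_P)
  finally show "measure (J n (K n)) {\<omega>\<in>space (J n (K n)). \<not> \<bar>(\<Sum>i<n. g (obs \<omega> i)) - real n * (\<integral>x. g x \<partial>P)\<bar> < real n * e} \<le> hoeffding_tail n e"
    unfolding eqA .
qed (rule hoeffding_tail_tendsto_0[OF e])

end

section \<open>The Neyman-Pearson risk curve\<close>

context two_group
begin

lemma integrable_P:
  assumes "g \<in> borel_measurable M" "\<And>x. x \<in> space M \<Longrightarrow> \<bar>g x\<bar> \<le> (C::real)"
  shows "integrable P g"
proof -
  interpret prob_space P by (rule prob_space_P)
  show ?thesis
    using assms by (intro integrable_const_bound[where B=C] AE_I2) (auto simp: space_P measurable_cong_sets[OF sets_P refl])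
qed

lemma integrable_W: "integrable P W"
  using W_bounds by (intro integrable_P[where C=1]) auto

text \<open>\<open>W\<close> / \<pi>0 is the density of f_0 relative to the mixture and therefore
  has total mass 1.\<close>

lemma integral_W: "(\<integral>x. W x \<partial>P) = \<pi>0"
proof -
  have "ennreal (\<integral>x. W x \<partial>P) = (\<integral>\<^sup>+x. ennreal (W x) \<partial>P)"
    using integrable_W W_bounds by (intro nn_integral_eq_integral[symmetric] AE_I2) (auto simp: space_P)
  also have "\<dots> = (\<integral>\<^sup>+x. ennreal \<pi>0 * ennreal (lr False x) \<partial>P)"
    using \<pi> W_bounds by (intro nn_integral_cong) (simp add: lr_def space_P flip: ennreal_mult')
  also have "\<dots> = ennreal \<pi>0 * (\<integral>\<^sup>+x. ennreal (lr False x) \<partial>P)"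
    by (intro nn_integral_cmult) (simp add: measurable_cong_sets[OF sets_P refl])
  also have "(\<integral>\<^sup>+x. ennreal (lr False x) \<partial>P) = emeasure (density P (\<lambda>x. ennreal (lr False x))) (space P)"
    by (subst emeasure_density) (auto simp: measurable_cong_sets[OF sets_P refl] cong: nn_integral_cong)
  also have "\<dots> = 1"
    using prob_space.emeasure_space_1[OF prob_space_component[of False]] density_component[of False] by (simp add: space_P)
  finally have "ennreal (\<integral>x. W x \<partial>P) = ennreal \<pi>0" by simp
  moreover have "0 \<le> (\<integral>x. W x \<partial>P)"
    using W_bounds by (intro integral_nonneg_AE AE_I2) (auto simp: space_P)
  ultimately show ?thesis using \<pi> by simp
qed

text \<open>The converse speaks of no tie-breaking, but its proof runs along the curve
  \<open>risk\<close>, which requires one. It exists because P(W < q) \<le> u \<le> P(W \<le> q) at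
  the quantile q of u, so that an atom at q can be split.\<close>

lemma ex_tie_breaking: "\<exists>p. tie_breaking M \<pi>0 \<pi>1 f0 f1 p"
proof -
  interpret P: prob_space P by (rule prob_space_P)
  have Wm: "W \<in> P \<rightarrow>\<^sub>M borel" using measurable_cong_sets[OF sets_P refl] by auto
  interpret D: real_distribution "distr P borel W"
    using Wm by (rule P.real_distribution_distr)
  define q where "q = W_quantile M \<pi>0 \<pi>1 f0 f1"
  define G where "G = W_cdf M \<pi>0 \<pi>1 f0 f1"
  define lower where "lower u = \<P>(x in P. W x < q u)" for u
  define atom where "atom u = \<P>(x in P. W x = q u)" for u
  have G: "G t = cdf (distr P borel W) t" for t
    unfolding G_def W_cdf_def cdf_def using Wm by (subst measure_distr) (auto simp: vimage_def Int_def conj_commute)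
  have G0: "G t = 0" if "t < 0" for t
  proof -
    have "{x\<in>space P. W x \<le> t} = {}" using that W_bounds(1) by (force simp: space_P)
    then show ?thesis unfolding G_def W_cdf_def by (simp only: measure_empty)
  qed
  have G1: "G 1 = 1"
  proof -
    have "{x\<in>space P. W x \<le> 1} = space P" using W_bounds(2) by (auto simp: space_P)
    then show ?thesis by (simp add: G_def W_cdf_def P.prob_space)
  qed
  have q: "q u = Inf {t\<in>{0..1}. u \<le> G t}" for u
    by (simp add: q_def G_def W_quantile_def)
  have lower_le: "lower u \<le> u" and le_upper: "u \<le> G (q u)" if u: "u \<in> {0..1}" for u
  proof -
    let ?S = "{t\<in>{0..1}. u \<le> G t}"
    have ne: "?S \<noteq> {}" using G1 u by (auto intro!: exI[of _ 1])
    have bdd: "bdd_below ?S" by (auto intro!: bdd_belowI[of _ 0])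
    have q1: "q u \<le> 1" unfolding q using G1 u by (intro cInf_lower bdd) auto
    have "G y \<le> u" if "y < q u" for y
    proof (cases "y < 0")
      case True then show ?thesis using G0 u by simp
    next
      case False
      have "y \<notin> ?S" using cInf_lower[OF _ bdd, of y] that unfolding q by auto
      then show ?thesis using False that q1 by auto
    qed
    \<comment> \<open>P(W < q) is the left limit of the distribution function at q, and to the left
      of q that function is at most u.\<close>
    then have "eventually (\<lambda>y. cdf (distr P borel W) y \<le> u) (at_left (q u))"
      by (auto simp: eventually_at_left_field G intro!: exI[of _ "q u - 1"])
    from tendsto_upperbound[OF D.cdf_at_left this]
    have "measure (distr P borel W) {..<q u} \<le> u" by simp
    also have "measure (distr P borel W) {..<q u} = lower u"
      unfolding lower_def using Wm by (subst measure_distr) (auto simp: vimage_def Int_def conj_commute)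
    finally show "lower u \<le> u" .
    show "u \<le> G (q u)"
    proof (rule ccontr)
      \<comment> \<open>By right continuity the distribution function would stay below u just to the
        right of q, although q is the infimum of the points where it has reached u.\<close>
      assume "\<not> u \<le> G (q u)"
      then have lt: "cdf (distr P borel W) (q u) < u" by (simp add: G)
      have "eventually (\<lambda>y. cdf (distr P borel W) y < u) (at_right (q u))"
        using D.cdf_is_right_cont[of "q u"] lt unfolding continuous_within by (rule order_tendstoD)
      then obtain d where d: "d > q u" "\<And>y. q u < y \<Longrightarrow> y < d \<Longrightarrow> G y < u"
        by (auto simp: eventually_at_right_field G)
      obtain y where y: "y \<in> ?S" "y < d"
        using cInf_lessD[OF ne, of d] d unfolding q by auto
      have "q u \<le> y" unfolding q using y by (intro cInf_lower bdd)
      then show False using d(2)[of y] y lt by (cases "y = q u") (auto simp: G)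
    qed
  qed
  have upper: "G (q u) = lower u + atom u" for u
  proof -
    have "{x\<in>space P. W x \<le> q u} = {x\<in>space P. W x < q u} \<union> {x\<in>space P. W x = q u}" by auto
    then show ?thesis
      unfolding G_def W_cdf_def lower_def atom_def using Wm
      by (simp, subst P.finite_measure_Union) auto
  qed
  \<comment> \<open>Without an atom the two bounds force P(W < q) = u, so the value 0
    serves.\<close>
  define p where "p u = (if atom u = 0 then 0 else (u - lower u) / atom u)" for u
  have "p u \<in> {0..1} \<and> lower u + p u * atom u = u" if "u \<in> {0..1}" for u
  proof -
    have "0 \<le> atom u" by (simp add: atom_def)
    then show ?thesis
      using lower_le[OF that] le_upper[OF that] upper[of u] by (auto simp: p_def divide_le_eq)
  qed
  then have "tie_breaking M \<pi>0 \<pi>1 f0 f1 p"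
    unfolding tie_breaking_def lower_def atom_def q_def by blast
  then show ?thesis by blast
qed

end

section \<open>Selection at a given rate and its risk\<close>

locale np_rule = two_group +
  fixes p :: "real \<Rightarrow> real"
  assumes tie: "tie_breaking M \<pi>0 \<pi>1 f0 f1 p"
begin

abbreviation "sel \<equiv> select_prob M \<pi>0 \<pi>1 f0 f1 p"
abbreviation "quant \<equiv> W_quantile M \<pi>0 \<pi>1 f0 f1"

definition risk :: "real \<Rightarrow> real" where
  "risk u = (\<integral>x. W x * sel u x \<partial>P)"

lemma sel_measurable [measurable]: "sel u \<in> borel_measurable M"
  unfolding select_prob_def[abs_def] by measurable

lemma sel_bounds:
  assumes "u \<in> {0..1}" shows "0 \<le> sel u x" "sel u x \<le> 1"
  using tie assms by (auto simp: tie_breaking_def select_prob_def)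

lemma integrable_sel: "u \<in> {0..1} \<Longrightarrow> integrable P (sel u)"
  using sel_bounds by (intro integrable_P[where C=1]) auto

lemma integrable_W_sel: "u \<in> {0..1} \<Longrightarrow> integrable P (\<lambda>x. W x * sel u x)"
  using sel_bounds W_bounds by (intro integrable_P[where C=1]) (auto simp: abs_mult intro: mult_le_one)

text \<open>This is the purpose of tie-breaking: the selected fraction is exactly \<open>u\<close>
  even where the law of \<open>W\<close> has atoms.\<close>

lemma integral_sel:
  assumes "u \<in> {0..1}" shows "(\<integral>x. sel u x \<partial>P) = u"
proof -
  interpret prob_space P by (rule prob_space_P)
  have Wm: "W \<in> P \<rightarrow>\<^sub>M borel" using measurable_cong_sets[OF sets_P refl] by auto
  have "(\<integral>x. sel u x \<partial>P) = (\<integral>x. indicator {x\<in>space P. W x < quant u} x + p u * indicator {x\<in>space P. W x = quant u} x \<partial>P)"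
    by (intro Bochner_Integration.integral_cong) (auto simp: select_prob_def)
  also have "\<dots> = prob {x\<in>space P. W x < quant u} + p u * prob {x\<in>space P. W x = quant u}"
  proof -
    have m: "{x\<in>space P. W x < quant u} \<in> events" "{x\<in>space P. W x = quant u} \<in> events"
      using Wm by measurable
    then show ?thesis
      by (subst Bochner_Integration.integral_add) (auto simp: Int_absorb2 less_top[symmetric])
  qed
  also have "\<dots> = u" using tie assms by (auto simp: tie_breaking_def)
  finally show ?thesis .
qed

lemma quant_bounds:
  assumes "u \<in> {0..1}" shows "0 \<le> quant u" "quant u \<le> 1"
proof -
  interpret prob_space P by (rule prob_space_P)
  have "{x\<in>space P. W x \<le> 1} = space P" using W_bounds(2) by (auto simp: space_P)
  then have "1 \<in> {t \<in> {0..1}. W_cdf M \<pi>0 \<pi>1 f0 f1 t \<ge> u}" using assms by (simp add: W_cdf_def prob_space)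
  moreover have "bdd_below {t \<in> {0..1}. W_cdf M \<pi>0 \<pi>1 f0 f1 t \<ge> u}" by (auto intro!: bdd_belowI[of _ 0])
  ultimately show "0 \<le> quant u" "quant u \<le> 1"
    unfolding W_quantile_def by (auto intro!: cInf_greatest cInf_lower)
qed

text \<open>The Neyman-Pearson lemma, pointwise: selection is full where the coefficient
  \<open>W x - quant u\<close> is negative and empty where it is positive; at a tie the coefficient
  is 0, whatever the coin.\<close>

lemma sel_minimizes:
  assumes "u \<in> {0..1}" "0 \<le> \<phi>" "\<phi> \<le> 1"
  shows "(W x - quant u) * sel u x \<le> (W x - quant u) * \<phi>"
proof (cases "W x" "quant u" rule: linorder_cases)
  case less
  then show ?thesis using assms by (simp add: select_prob_def mult_le_cancel_left)
qed (use assms in \<open>simp_all add: select_prob_def\<close>)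

lemma integral_W_sel_shift:
  assumes "u \<in> {0..1}" "v \<in> {0..1}"
  shows "integrable P (\<lambda>x. (W x - t) * sel v x)" "(\<integral>x. (W x - t) * sel v x \<partial>P) = risk v - t * v"
  using integrable_W_sel[OF assms(2)] integrable_sel[OF assms(2)] integral_sel[OF assms(2)]
  by (auto simp: left_diff_distrib risk_def)

lemma risk_subgradient:
  assumes "u \<in> {0..1}" "v \<in> {0..1}"
  shows "risk u + quant u * (v - u) \<le> risk v"
proof -
  have "(\<integral>x. (W x - quant u) * sel u x \<partial>P) \<le> (\<integral>x. (W x - quant u) * sel v x \<partial>P)"
    using assms sel_bounds by (intro integral_mono integral_W_sel_shift sel_minimizes)
  then show ?thesis unfolding integral_W_sel_shift(2)[OF assms(1) assms(1)] integral_W_sel_shift(2)[OF assms]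
    by (simp add: algebra_simps)
qed

lemma risk_0: "risk 0 = 0"
proof -
  have "risk 0 \<le> (\<integral>x. sel 0 x \<partial>P)"
    unfolding risk_def using sel_bounds W_bounds
    by (intro integral_mono integrable_W_sel integrable_sel) (auto simp: space_P intro!: mult_left_le_one_le)
  moreover have "0 \<le> risk 0"
    unfolding risk_def using sel_bounds W_bounds by (intro integral_nonneg_AE AE_I2) (auto simp: space_P)
  ultimately show ?thesis using integral_sel[of 0] by simp
qed

text \<open>The unselected null mass \<pi>0 - \<open>risk u\<close> is E[W (1 - S_u)], which lies
  between 0 and E[1 - S_u] because \<open>W\<close> lies in [0,1].\<close>

lemma risk_upper:
  assumes "u \<in> {0..1}" shows "risk u \<le> \<pi>0" "\<pi>0 - risk u \<le> 1 - u"
proof -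
  interpret prob_space P by (rule prob_space_P)
  have "risk u \<le> (\<integral>x. W x \<partial>P)"
    unfolding risk_def using sel_bounds[OF assms] W_bounds
    by (intro integral_mono integrable_W_sel integrable_W assms) (auto simp: space_P intro!: mult_right_le_one_le)
  then show "risk u \<le> \<pi>0" by (simp add: integral_W)
  have "(\<integral>x. W x - W x * sel u x \<partial>P) \<le> (\<integral>x. 1 - sel u x \<partial>P)"
  proof (intro integral_mono)
    fix x assume "x \<in> space P"
    then have "W x * (1 - sel u x) \<le> 1 * (1 - sel u x)"
      using sel_bounds[OF assms] W_bounds by (intro mult_right_mono) (auto simp: space_P)
    then show "W x - W x * sel u x \<le> 1 - sel u x" by (simp add: algebra_simps)
  qed (use integrable_W integrable_W_sel integrable_sel assms in auto)
  then show "\<pi>0 - risk u \<le> 1 - u"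
    using integrable_W integrable_W_sel integrable_sel assms integral_sel
    by (simp add: integral_W risk_def prob_space)
qed

lemma risk_1: "risk 1 = \<pi>0"
  using risk_upper[of 1] by simp

lemma cond_W_eq:
  assumes "u \<in> {0<..1}"
  shows "cond_W M \<pi>0 \<pi>1 f0 f1 p u = risk u / u"
proof -
  have u: "u \<in> {0..1}" "u > 0" using assms by auto
  define Z where "Z = (M \<Otimes>\<^sub>M count_space (UNIV::bool set))"
  define B where "B x = measure_pmf (bernoulli_pmf (sel u x))" for x
  define N where "N = select_law M \<pi>0 \<pi>1 f0 f1 p u"
  define S where "S = space M \<times> {True}"
  have S: "S \<in> sets Z" unfolding S_def Z_def by auto
  have Bk[measurable]: "B \<in> M \<rightarrow>\<^sub>M prob_algebra (count_space UNIV)"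
    unfolding B_def using sel_bounds[OF u(1)] by (intro measurable_bernoulli_kernel) auto
  have k: "(\<lambda>x. B x \<bind> (\<lambda>s. return Z (x, s))) \<in> M \<rightarrow>\<^sub>M prob_algebra Z"
    unfolding Z_def by measurable
  then have kP: "(\<lambda>x. B x \<bind> (\<lambda>s. return Z (x, s))) \<in> P \<rightarrow>\<^sub>M prob_algebra Z"
    by (simp add: measurable_cong_sets[OF sets_P refl])
  have N: "N = P \<bind> (\<lambda>x. B x \<bind> (\<lambda>s. return Z (x, s)))"
    by (simp add: N_def select_law_def B_def Z_def)
  have PM: "P \<in> space (prob_algebra M)" by (simp add: space_prob_algebra sets_P prob_space_P)
  have sN: "sets N = sets Z" unfolding N using PM k by (rule sets_bind')
  interpret N: prob_space N unfolding N using PM k by (rule prob_space_bind')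
  \<comment> \<open>Integrating out the coin turns the event S_u = 1 into the weight
    \<open>sel u\<close>. With g = 1 this gives the conditioning event mass u, with g =
    \<open>W\<close> it gives the numerator \<open>risk u\<close>.\<close>
  have int: "(\<integral>z. indicator S z * g (fst z) \<partial>N) = (\<integral>x. g x * sel u x \<partial>P)"
    if g: "g \<in> borel_measurable M" "\<And>x. x \<in> space M \<Longrightarrow> 0 \<le> g x \<and> g x \<le> 1" for g :: "_ \<Rightarrow> real"
  proof -
    have gm: "(\<lambda>z. indicator S z * g (fst z)) \<in> borel_measurable Z"
      using S g(1) unfolding Z_def by measurable
    have bnd: "0 \<le> indicator S z * g (fst z) \<and> indicator S z * g (fst z) \<le> 1" if "z \<in> space Z" for z
      using g(2)[of "fst z"] that by (auto simp: Z_def space_pair_measure indicator_def)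
    have "(\<integral>z. indicator S z * g (fst z) \<partial>N) = (\<integral>x. (\<integral>z. indicator S z * g (fst z) \<partial>(B x \<bind> (\<lambda>s. return Z (x, s)))) \<partial>P)"
      unfolding N by (rule integral_bind_bounded(1)[OF gm kP prob_space_P bnd])
    also have "\<dots> = (\<integral>x. g x * sel u x \<partial>P)"
    proof (rule Bochner_Integration.integral_cong[OF refl])
      fix x assume "x \<in> space P"
      then have x: "x \<in> space M" by (simp add: space_P)
      have m: "(\<lambda>s. return Z (x, s)) \<in> B x \<rightarrow>\<^sub>M prob_algebra Z"
        using x by (auto simp: B_def Z_def space_pair_measure
            intro!: measurable_space[OF measurable_return_prob_space])
      have "(\<integral>z. indicator S z * g (fst z) \<partial>(B x \<bind> (\<lambda>s. return Z (x, s)))) =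
         (\<integral>s. (\<integral>z. indicator S z * g (fst z) \<partial>return Z (x, s)) \<partial>B x)"
        by (rule integral_bind_bounded(1)[OF gm m _ bnd]) (simp add: B_def prob_space_measure_pmf)
      also have "\<dots> = (\<integral>s. indicator S (x, s) * g x \<partial>B x)"
        using gm x by (intro Bochner_Integration.integral_cong refl) (subst integral_return, auto simp: Z_def space_pair_measure)
      also have "\<dots> = g x * sel u x"
        unfolding B_def using sel_bounds[OF u(1), of x] x by (subst integral_bernoulli_pmf) (auto simp: S_def)
      finally show "(\<integral>z. indicator S z * g (fst z) \<partial>(B x \<bind> (\<lambda>s. return Z (x, s)))) = g x * sel u x" .
    qed
    finally show ?thesis .
  qed
  have "measure N S = u"
    using int[of "\<lambda>_. 1"] integral_sel[OF u(1)] S sets.sets_into_space[OF S] sets_eq_imp_space_eq[OF sN]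
    by (simp add: Int_absorb2)
  then have NS: "emeasure N S = ennreal u" by (simp add: N.emeasure_eq_measure)
  have Wm: "(\<lambda>z. W (fst z)) \<in> borel_measurable N"
    unfolding measurable_cong_sets[OF sN refl] Z_def by measurable
  have "uniform_measure N S = density N (\<lambda>z. ennreal (indicator S z / u))"
    unfolding uniform_measure_def NS using u S sN
    by (intro density_cong) (auto simp: indicator_def divide_ennreal[symmetric])
  then have "(\<integral>z. W (fst z) \<partial>uniform_measure N S) = (\<integral>z. indicator S z / u * W (fst z) \<partial>N)"
    using S sN u Wm by (simp add: integral_density)
  also have "\<dots> = (\<integral>z. (indicator S z * W (fst z)) / u \<partial>N)" by simp
  also have "\<dots> = risk u / u"
    using int[of W] W_bounds by (simp add: risk_def)
  finally show ?thesis
    using u by (simp add: cond_W_def N_def S_def case_prod_unfold)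
qed

text \<open>The form without a denominator includes u = 0, where both sides hold: a(0) = 0 by
  definition, \<open>risk 0 = 0\<close>, and \<alpha> is nonnegative.\<close>

lemma cond_W_le_iff:
  assumes "u \<in> {0..1}" "0 \<le> \<alpha>"
  shows "cond_W M \<pi>0 \<pi>1 f0 f1 p u \<le> \<alpha> \<longleftrightarrow> risk u \<le> \<alpha> * u"
  using assms by (cases "u = 0") (auto simp: cond_W_eq risk_0 divide_le_eq, auto simp: cond_W_def)

text \<open>The slope \<open>quant v\<close> is at most 1 because \<open>W\<close> is. The resulting
  continuity shows that the supremum \<open>ustar\<close> is attained and lets v decrease to it in
  the converse.\<close>

lemma risk_lipschitz:
  assumes "u \<in> {0..1}" "v \<in> {0..1}" "u \<le> v"
  shows "risk v \<le> risk u + (v - u)"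
proof -
  have "risk v + quant v * (u - v) \<le> risk u" using assms by (intro risk_subgradient)
  moreover have "quant v * (v - u) \<le> 1 * (v - u)" using assms quant_bounds by (intro mult_right_mono) auto
  ultimately show ?thesis by (simp add: algebra_simps)
qed

lemma risk_mono:
  assumes "u \<in> {0..1}" "v \<in> {0..1}" "u \<le> v"
  shows "risk u \<le> risk v"
proof -
  have "risk u + quant u * (v - u) \<le> risk v" using assms by (intro risk_subgradient)
  moreover have "0 \<le> quant u * (v - u)" using assms quant_bounds by simp
  ultimately show ?thesis by simp
qed

text \<open>At \<open>u = 1\<close> this is \<open>0 / 0 = 0\<close>, in agreement with the convention for \<open>mFNR\<close>.\<close>

definition fnr_at :: "real \<Rightarrow> real" where
  "fnr_at u = (1 - u - \<pi>0 + risk u) / (1 - u)"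

lemma fnr_at_nonneg: "u \<in> {0..1} \<Longrightarrow> 0 \<le> fnr_at u"
  using risk_upper[of u] by (auto simp: fnr_at_def)

text \<open>For u < 1, 1 - \<open>fnr_at u\<close> is the slope of the chord of \<open>risk\<close>
  from u to 1, since \<open>risk 1\<close> is \<pi>0; chords of a convex function to a fixed right
  end get steeper as their left end moves right.\<close>

lemma fnr_at_antimono:
  assumes "u \<in> {0..1}" "v \<in> {0..1}" "u \<le> v"
  shows "fnr_at v \<le> fnr_at u"
proof (cases "v = 1")
  case True
  then show ?thesis using fnr_at_nonneg[OF assms(1)] by (simp add: fnr_at_def)
next
  case False
  then have v: "1 - v > 0" and u: "1 - u > 0" using assms by auto
  \<comment> \<open>The chord slope from v to 1. It dominates the subgradient at v, and that
    subgradient carries the comparison back from v to u.\<close>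
  define c where "c = (\<pi>0 - risk v) / (1 - v)"
  have cv: "\<pi>0 - risk v = c * (1 - v)" using v by (simp add: c_def)
  have "risk v + quant v * (1 - v) \<le> risk 1" using assms by (intro risk_subgradient) auto
  then have "quant v \<le> c" using v by (simp add: c_def risk_1 field_simps)
  then have "quant v * (v - u) \<le> c * (v - u)" using assms by (intro mult_right_mono) auto
  moreover have "risk v + quant v * (u - v) \<le> risk u" using assms by (intro risk_subgradient) auto
  ultimately have "\<pi>0 - risk u \<le> c * (1 - u)" using cv by (simp add: algebra_simps)
  then have "(\<pi>0 - risk u) / (1 - u) \<le> c" using u by (simp add: divide_le_eq)
  moreover have "fnr_at v = 1 - c" "fnr_at u = 1 - (\<pi>0 - risk u) / (1 - u)"
    using u v by (simp_all add: fnr_at_def c_def field_simps)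
  ultimately show ?thesis by simp
qed

end

section \<open>The critical rate at level \<alpha>\<close>

locale np_level = np_rule +
  fixes \<alpha> :: real
  assumes \<alpha>: "0 \<le> \<alpha>" "\<alpha> \<le> 1"
begin

abbreviation "ustar \<equiv> u_star M \<pi>0 \<pi>1 f0 f1 p \<alpha>"

lemma ustar_eq: "ustar = Sup {u \<in> {0..1}. risk u \<le> \<alpha> * u}"
  unfolding u_star_def using cond_W_le_iff \<alpha> by (intro arg_cong[where f=Sup]) auto

lemma ustar_upper: "u \<in> {0..1} \<Longrightarrow> risk u \<le> \<alpha> * u \<Longrightarrow> u \<le> ustar"
  unfolding ustar_eq by (rule cSup_upper) (auto intro: bdd_aboveI[of _ 1])

lemma ustar_bounds: "ustar \<in> {0..1}"
proof -
  have "0 \<le> ustar" by (rule ustar_upper) (auto simp: risk_0)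
  moreover have "ustar \<le> 1" unfolding ustar_eq by (rule cSup_least) (auto intro!: exI[of _ 0] simp: risk_0)
  ultimately show ?thesis by simp
qed

text \<open>The supremum is attained: if \<open>risk ustar\<close> exceeded \<alpha> times
  \<open>ustar\<close> by some \<delta> > 0, an admissible u would lie within \<delta> of
  \<open>ustar\<close>, and from there the Lipschitz bound allows the risk to rise by less than
  \<delta>.\<close>

lemma risk_ustar: "risk ustar \<le> \<alpha> * ustar"
proof (rule ccontr)
  assume "\<not> ?thesis"
  then have d: "ustar - (risk ustar - \<alpha> * ustar) < ustar" by simp
  have ne: "{u \<in> {0..1}. risk u \<le> \<alpha> * u} \<noteq> {}" by (auto intro!: exI[of _ 0] simp: risk_0)
  from less_cSupD[OF ne d[unfolded ustar_eq]] obtain u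
    where u: "u \<in> {0..1}" "risk u \<le> \<alpha> * u" "ustar - (risk ustar - \<alpha> * ustar) < u"
    unfolding ustar_eq by auto
  have le: "u \<le> ustar" using u by (intro ustar_upper)
  then have "\<alpha> * u \<le> \<alpha> * ustar" using \<alpha> by (intro mult_left_mono) auto
  then show False using risk_lipschitz[OF u(1) ustar_bounds le] u by simp
qed

end

section \<open>The optimal marginal rate\<close>

lemma nondiscoveries_eq: "nondiscoveries n d = real n - discoveries n d"
  by (simp add: nondiscoveries_def discoveries_def sum_subtractf)

text \<open>The labels are made to enter through 1 - \<theta>_i only, the quantity that gets
  replaced by W_i: the nulls among the nondiscoveries are all nulls less the false
  discoveries.\<close>

lemma false_nondiscoveries_eq:
  "false_nondiscoveries n \<theta> d = nondiscoveries n d - (\<Sum>i<n. 1 - of_bool (\<theta> i)) + false_discoveries n \<theta> d"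
  unfolding false_nondiscoveries_def nondiscoveries_def false_discoveries_def sum_subtractf[symmetric] sum.distrib[symmetric]
  by (intro sum.cong) (auto simp: algebra_simps)

lemma counts_bounds:
  "0 \<le> discoveries n d" "discoveries n d \<le> real n" "0 \<le> nondiscoveries n d" "nondiscoveries n d \<le> real n"
  "0 \<le> false_discoveries n \<theta> d" "false_discoveries n \<theta> d \<le> discoveries n d"
  "0 \<le> false_nondiscoveries n \<theta> d" "false_nondiscoveries n \<theta> d \<le> nondiscoveries n d"
proof -
  show d: "0 \<le> discoveries n d" unfolding discoveries_def by (intro sum_nonneg) auto
  show nd: "0 \<le> nondiscoveries n d" unfolding nondiscoveries_def by (intro sum_nonneg) auto
  show "discoveries n d \<le> real n" "nondiscoveries n d \<le> real n" using d nd by (simp_all add: nondiscoveries_eq)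
  show "0 \<le> false_discoveries n \<theta> d" unfolding false_discoveries_def by (intro sum_nonneg) auto
  show "0 \<le> false_nondiscoveries n \<theta> d" unfolding false_nondiscoveries_def by (intro sum_nonneg) auto
  show "false_discoveries n \<theta> d \<le> discoveries n d" unfolding false_discoveries_def discoveries_def by (intro sum_mono) auto
  show "false_nondiscoveries n \<theta> d \<le> nondiscoveries n d" unfolding false_nondiscoveries_def nondiscoveries_def by (intro sum_mono) auto
qed

lemma FNP_bounds: "0 \<le> FNP n \<theta> d" "FNP n \<theta> d \<le> 1"
  using counts_bounds(3)[of n d] counts_bounds(7,8)[of n \<theta> d] by (auto simp: FNP_def divide_le_eq)

section \<open>Marginal rates of an arbitrary rule\<close>

context two_group
begin

lemma integrable_J:
  fixes h :: "_ \<Rightarrow> real"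
  assumes K: "decision_rule M n K" and h: "h \<in> borel_measurable (triple_space M n)"
    and "\<And>\<omega>. \<omega> \<in> space (triple_space M n) \<Longrightarrow> \<bar>h \<omega>\<bar> \<le> C"
  shows "integrable (J n K) h"
proof -
  interpret prob_space "J n K" by (rule prob_space_J[OF K])
  show ?thesis
    using assms by (intro integrable_const_bound[where B=C] AE_I2) (auto simp: space_J measurable_J)
qed

lemma integrable_J_components:
  assumes K: "decision_rule M n K" and i: "i < n"
    and g: "g \<in> borel_measurable M" "\<And>x. x \<in> space M \<Longrightarrow> \<bar>g x\<bar> \<le> (C::real)"
  shows "integrable (J n K) (\<lambda>\<omega>. of_bool (dec \<omega> i) :: real)"
    and "integrable (J n K) (\<lambda>\<omega>. of_bool (lab \<omega> i) :: real)"
    and "integrable (J n K) (\<lambda>\<omega>. of_bool (dec \<omega> i) * (1 - of_bool (lab \<omega> i)) :: real)"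
    and "integrable (J n K) (\<lambda>\<omega>. g (obs \<omega> i))"
    and "integrable (J n K) (\<lambda>\<omega>. of_bool (dec \<omega> i) * g (obs \<omega> i))"
proof -
  note m = measurable_triple_component(1)[where c="of_bool", OF i] measurable_triple_component(1)[where c="\<lambda>b. 1 - of_bool b", OF i]
    measurable_triple_component(2)[where c="of_bool", OF i]
    measurable_triple_component(3)[OF i g(1)]
  show "integrable (J n K) (\<lambda>\<omega>. of_bool (dec \<omega> i) :: real)"
    by (rule integrable_J[OF K m(3), where C=1]) auto
  show "integrable (J n K) (\<lambda>\<omega>. of_bool (lab \<omega> i) :: real)"
    by (rule integrable_J[OF K m(1), where C=1]) auto
  show "integrable (J n K) (\<lambda>\<omega>. of_bool (dec \<omega> i) * (1 - of_bool (lab \<omega> i)) :: real)"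
    by (rule integrable_J[OF K borel_measurable_times[OF m(3) m(2)], where C=1]) auto
  have b: "\<bar>g (obs \<omega> i)\<bar> \<le> C" if "\<omega> \<in> space (triple_space M n)" for \<omega>
    using g(2)[OF sample_in_space[OF _ i]] that by (auto simp: space_pair_measure)
  show "integrable (J n K) (\<lambda>\<omega>. g (obs \<omega> i))"
    by (rule integrable_J[OF K m(4) b])
  show "integrable (J n K) (\<lambda>\<omega>. of_bool (dec \<omega> i) * g (obs \<omega> i))"
  proof (rule integrable_J[OF K borel_measurable_times[OF m(3) m(4)]])
    fix \<omega> assume "\<omega> \<in> space (triple_space M n)"
    then show "\<bar>of_bool (dec \<omega> i) * g (obs \<omega> i)\<bar> \<le> C" using b[of \<omega>] by (cases "dec \<omega> i") auto
  qed
qed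

lemma ratio_events:
  assumes "decision_rule M n K"
  shows "{\<omega>\<in>space (J n K). FDP n (lab \<omega>) (dec \<omega>) \<le> c} \<in> sets (J n K)"
    and "{\<omega>\<in>space (J n K). FNP n (lab \<omega>) (dec \<omega>) \<le> c} \<in> sets (J n K)"
  using measurable_FDP_FNP[of n M] unfolding sets_J[OF assms] space_J[OF assms] by measurable

lemma integral_J_component:
  fixes g :: "_ \<Rightarrow> real"
  assumes K: "decision_rule M n K" and i: "i < n"
    and g: "g \<in> borel_measurable M" "\<And>x. x \<in> space M \<Longrightarrow> 0 \<le> g x \<and> g x \<le> C"
  shows "(\<integral>\<omega>. g (obs \<omega> i) \<partial>J n K) = (\<integral>x. g x \<partial>P)"
  unfolding integral_Pn_component[OF i g(1), symmetric]
  using measurable_compose[OF measurable_sample_component[OF i] g(1)] g(2)[OF sample_in_space[OF _ i]]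
  by (intro integral_J_obs[OF K, where C=C and g="\<lambda>x. g (x i)"])

text \<open>A rule enters mFDR and mFNR only through \<open>avg_dec\<close> and
  \<open>avg_risk\<close>; as a point of the plane the pair is compared with the curve of the points
  u, \<open>risk u\<close>.\<close>

definition avg_dec where "avg_dec n K = (\<integral>\<omega>. discoveries n (dec \<omega>) \<partial>J n K) / real n"
definition avg_risk where "avg_risk n K = (\<integral>\<omega>. (\<Sum>i<n. of_bool (dec \<omega> i) * W (obs \<omega> i)) \<partial>J n K) / real n"

lemma expected_counts:
  assumes K: "decision_rule M n K" and n: "n \<ge> 1"
  shows "(\<integral>\<omega>. discoveries n (dec \<omega>) \<partial>J n K) = real n * avg_dec n K"
    and "(\<integral>\<omega>. nondiscoveries n (dec \<omega>) \<partial>J n K) = real n * (1 - avg_dec n K)"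
    and "(\<integral>\<omega>. false_discoveries n (lab \<omega>) (dec \<omega>) \<partial>J n K) = real n * avg_risk n K"
    and "(\<integral>\<omega>. false_nondiscoveries n (lab \<omega>) (dec \<omega>) \<partial>J n K) = real n * (1 - avg_dec n K - \<pi>0 + avg_risk n K)"
proof -
  interpret prob_space "J n K" by (rule prob_space_J[OF K])
  have W1: "x \<in> space M \<Longrightarrow> \<bar>W x\<bar> \<le> 1" for x using W_bounds[of x] by simp
  note I = integrable_J_components[OF K _ W_measurable W1]
  show 1: "(\<integral>\<omega>. discoveries n (dec \<omega>) \<partial>J n K) = real n * avg_dec n K"
    using n by (simp add: avg_dec_def)
  have id: "integrable (J n K) (\<lambda>\<omega>. discoveries n (dec \<omega>))"
    unfolding discoveries_def using I(1) by (intro Bochner_Integration.integrable_sum) auto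
  have ind: "integrable (J n K) (\<lambda>\<omega>. nondiscoveries n (dec \<omega>))"
    unfolding nondiscoveries_eq using id by auto
  show 2: "(\<integral>\<omega>. nondiscoveries n (dec \<omega>) \<partial>J n K) = real n * (1 - avg_dec n K)"
    unfolding nondiscoveries_eq using id 1 by (simp add: prob_space algebra_simps)
  have ifd: "integrable (J n K) (\<lambda>\<omega>. false_discoveries n (lab \<omega>) (dec \<omega>))"
    unfolding false_discoveries_def using I(3) by (intro Bochner_Integration.integrable_sum) auto
  have "(\<integral>\<omega>. false_discoveries n (lab \<omega>) (dec \<omega>) \<partial>J n K) = (\<Sum>i<n. \<integral>\<omega>. of_bool (dec \<omega> i) * (1 - of_bool (lab \<omega> i)) \<partial>J n K)"
    unfolding false_discoveries_def using I(3) by (intro Bochner_Integration.integral_sum) auto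
  also have "\<dots> = (\<Sum>i<n. \<integral>\<omega>. of_bool (dec \<omega> i) * W (obs \<omega> i) \<partial>J n K)"
  proof (intro sum.cong refl)
    fix i assume "i \<in> {..<n}"
    then have i: "i < n" by simp
    have "(\<lambda>z. of_bool (snd z i)) \<in> borel_measurable (sample_space M n \<Otimes>\<^sub>M binary_space n)"
      by (rule measurable_compose[OF measurable_compose[OF measurable_snd measurable_binary_component[OF i]]]) simp
    from integral_J_null_weight[OF K i this]
    show "(\<integral>\<omega>. of_bool (dec \<omega> i) * (1 - of_bool (lab \<omega> i)) \<partial>J n K) = (\<integral>\<omega>. of_bool (dec \<omega> i) * W (obs \<omega> i) \<partial>J n K)"
      by simp
  qed
  also have "\<dots> = (\<integral>\<omega>. (\<Sum>i<n. of_bool (dec \<omega> i) * W (obs \<omega> i)) \<partial>J n K)"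
    using I(5) by (intro Bochner_Integration.integral_sum[symmetric]) auto
  finally show 3: "(\<integral>\<omega>. false_discoveries n (lab \<omega>) (dec \<omega>) \<partial>J n K) = real n * avg_risk n K"
    using n by (simp add: avg_risk_def)
  have I2: "integrable (J n K) (\<lambda>\<omega>. 1 - of_bool (lab \<omega> i) :: real)" if "i < n" for i
    by (intro Bochner_Integration.integrable_diff I(2) that) simp
  have il: "integrable (J n K) (\<lambda>\<omega>. \<Sum>i<n. 1 - of_bool (lab \<omega> i) :: real)"
    using I2 by (intro Bochner_Integration.integrable_sum) auto
  \<comment> \<open>The factor 1 on the right is the trivial weight for
    \<open>integral_J_null_weight\<close>; this computes the expected number of true nulls.\<close>
  have "(\<integral>\<omega>. (\<Sum>i<n. 1 - of_bool (lab \<omega> i) :: real) \<partial>J n K) = (\<Sum>i<n. \<integral>\<omega>. 1 * (1 - of_bool (lab \<omega> i)) \<partial>J n K)"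
    unfolding mult_1 using I2 by (intro Bochner_Integration.integral_sum) auto
  also have "\<dots> = (\<Sum>i<n. \<integral>\<omega>. W (obs \<omega> i) \<partial>J n K)"
  proof (intro sum.cong refl)
    fix i assume "i \<in> {..<n}"
    then show "(\<integral>\<omega>. 1 * (1 - of_bool (lab \<omega> i)) \<partial>J n K) = (\<integral>\<omega>. W (obs \<omega> i) \<partial>J n K)"
      using integral_J_null_weight[OF K, where v="\<lambda>_. 1"] by simp
  qed
  also have "\<dots> = (\<Sum>i<n. \<pi>0)"
    using integral_J_component[OF K _ W_measurable, where C=1] W_bounds by (intro sum.cong refl) (simp add: integral_W)
  finally have 4: "(\<integral>\<omega>. (\<Sum>i<n. 1 - of_bool (lab \<omega> i)) \<partial>J n K) = real n * \<pi>0" by simp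
  show "(\<integral>\<omega>. false_nondiscoveries n (lab \<omega>) (dec \<omega>) \<partial>J n K) = real n * (1 - avg_dec n K - \<pi>0 + avg_risk n K)"
    unfolding false_nondiscoveries_eq using ind il ifd 2 3 4 by (simp add: algebra_simps)
qed

lemma mFDR_eq: "decision_rule M n K \<Longrightarrow> n \<ge> 1 \<Longrightarrow> mFDR M \<pi>1 f0 f1 n K = avg_risk n K / avg_dec n K"
  using expected_counts(1,3)[of n K] by (simp add: mFDR_def case_prod_unfold)

lemma mFNR_eq: "decision_rule M n K \<Longrightarrow> n \<ge> 1 \<Longrightarrow>
    mFNR M \<pi>1 f0 f1 n K = (1 - avg_dec n K - \<pi>0 + avg_risk n K) / (1 - avg_dec n K)"
  using expected_counts(2,4)[of n K] by (simp add: mFNR_def case_prod_unfold)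

lemma avg_dec_bounds:
  assumes K: "decision_rule M n K" and n: "n \<ge> 1"
  shows "avg_dec n K \<in> {0..1}"
proof -
  interpret prob_space "J n K" by (rule prob_space_J[OF K])
  have "0 \<le> (\<integral>\<omega>. discoveries n (dec \<omega>) \<partial>J n K)"
    by (intro integral_nonneg_AE AE_I2 counts_bounds)
  moreover have "0 \<le> (\<integral>\<omega>. nondiscoveries n (dec \<omega>) \<partial>J n K)"
    by (intro integral_nonneg_AE AE_I2 counts_bounds)
  ultimately show ?thesis using n by (simp add: expected_counts[OF K n] zero_le_mult_iff)
qed

end

context np_rule
begin

text \<open>\<open>sel_minimizes\<close> summed over the sample. It holds for every sample and every
  decision vector and is used twice: in expectation for the optimal marginal rate, and pathwise in
  the converse.\<close>

lemma sum_sel_le: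
  assumes "u \<in> {0..1}"
  shows "(\<Sum>i<n. W (x i) * sel u (x i)) - quant u * (\<Sum>i<n. sel u (x i)) \<le>
    (\<Sum>i<n. of_bool (d i) * W (x i)) - quant u * discoveries n d"
proof -
  have "(\<Sum>i<n. (W (x i) - quant u) * sel u (x i)) \<le> (\<Sum>i<n. (W (x i) - quant u) * of_bool (d i))"
    by (intro sum_mono sel_minimizes[OF assms]) auto
  also have "(\<Sum>i<n. (W (x i) - quant u) * sel u (x i)) = (\<Sum>i<n. W (x i) * sel u (x i)) - quant u * (\<Sum>i<n. sel u (x i))"
    unfolding sum_distrib_left sum_subtractf[symmetric] by (simp only: left_diff_distrib)
  also have "(\<Sum>i<n. (W (x i) - quant u) * of_bool (d i)) = (\<Sum>i<n. of_bool (d i) * W (x i)) - quant u * discoveries n d"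
    unfolding discoveries_def sum_distrib_left sum_subtractf[symmetric] by (intro sum.cong refl) (simp add: algebra_simps)
  finally show ?thesis .
qed

text \<open>No rule lies below a tangent of the curve. At u = \<open>avg_dec n K\<close> the linear
  term vanishes, and the rule is seen to lie on or above the curve.\<close>

lemma avg_risk_ge:
  assumes K: "decision_rule M n K" and n: "n \<ge> 1" and u: "u \<in> {0..1}"
  shows "risk u + quant u * (avg_dec n K - u) \<le> avg_risk n K"
proof -
  have W1: "x \<in> space M \<Longrightarrow> \<bar>W x\<bar> \<le> 1" for x using W_bounds[of x] by simp
  note I = integrable_J_components[OF K _ W_measurable W1]
  have s: "0 \<le> sel u x \<and> sel u x \<le> 1" for x using sel_bounds[OF u] by auto
  have sW: "0 \<le> W x * sel u x \<and> W x * sel u x \<le> 1" if "x \<in> space M" for x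
    using s[of x] W_bounds[OF that] by (auto intro: mult_le_one)
  note Is = integrable_J_components(4)[OF K _ sel_measurable, where C=1]
  have sWm: "(\<lambda>x. W x * sel u x) \<in> borel_measurable M" by measurable
  note IsW = integrable_J_components(4)[OF K _ sWm, where C=1]
  have i1: "integrable (J n K) (\<lambda>\<omega>. \<Sum>i<n. W (obs \<omega> i) * sel u (obs \<omega> i))"
    using IsW sW by (intro Bochner_Integration.integrable_sum) auto
  have i2: "integrable (J n K) (\<lambda>\<omega>. \<Sum>i<n. sel u (obs \<omega> i))"
    using Is s by (intro Bochner_Integration.integrable_sum) auto
  have i3: "integrable (J n K) (\<lambda>\<omega>. \<Sum>i<n. of_bool (dec \<omega> i) * W (obs \<omega> i))"
    using I(5) by (intro Bochner_Integration.integrable_sum) auto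
  have i4: "integrable (J n K) (\<lambda>\<omega>. discoveries n (dec \<omega>))"
    unfolding discoveries_def using I(1) by (intro Bochner_Integration.integrable_sum) auto
  have "(\<integral>\<omega>. (\<Sum>i<n. W (obs \<omega> i) * sel u (obs \<omega> i)) \<partial>J n K) = (\<Sum>i<n. \<integral>\<omega>. W (obs \<omega> i) * sel u (obs \<omega> i) \<partial>J n K)"
    using IsW sW by (intro Bochner_Integration.integral_sum) auto
  also have "\<dots> = (\<Sum>i<n. risk u)"
    unfolding risk_def using integral_J_component[OF K _ sWm, where C=1] sW by (intro sum.cong refl) auto
  finally have e1: "(\<integral>\<omega>. (\<Sum>i<n. W (obs \<omega> i) * sel u (obs \<omega> i)) \<partial>J n K) = real n * risk u" by simp
  have "(\<integral>\<omega>. (\<Sum>i<n. sel u (obs \<omega> i)) \<partial>J n K) = (\<Sum>i<n. \<integral>\<omega>. sel u (obs \<omega> i) \<partial>J n K)"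
    using Is s by (intro Bochner_Integration.integral_sum) auto
  also have "\<dots> = (\<Sum>i<n. u)"
    using integral_J_component[OF K _ sel_measurable, where C=1] s integral_sel[OF u] by (intro sum.cong refl) auto
  finally have e2: "(\<integral>\<omega>. (\<Sum>i<n. sel u (obs \<omega> i)) \<partial>J n K) = real n * u" by simp
  have "(\<integral>\<omega>. (\<Sum>i<n. W (obs \<omega> i) * sel u (obs \<omega> i)) - quant u * (\<Sum>i<n. sel u (obs \<omega> i)) \<partial>J n K) \<le>
    (\<integral>\<omega>. (\<Sum>i<n. of_bool (dec \<omega> i) * W (obs \<omega> i)) - quant u * discoveries n (dec \<omega>) \<partial>J n K)"
    using i1 i2 i3 i4 by (intro integral_mono sum_sel_le[OF u]) auto
  then have "real n * risk u - quant u * (real n * u) \<le> real n * avg_risk n K - quant u * (real n * avg_dec n K)"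
    using i1 i2 i3 i4 e1 e2 expected_counts(1)[OF K n] n by (simp add: avg_risk_def)
  then have "real n * (risk u + quant u * (avg_dec n K - u)) \<le> real n * avg_risk n K"
    by (simp add: algebra_simps)
  then show ?thesis using n by simp
qed

end

section \<open>Optimality of the Neyman-Pearson rule for the marginal rates\<close>

context np_level
begin

abbreviation "NP \<equiv> NP_rule M \<pi>0 \<pi>1 f0 f1 p \<alpha>"

lemma NP_decision_rule: "decision_rule M n (NP n)"
proof -
  have "(\<lambda>x. PiM {..<n} (\<lambda>i. measure_pmf (bernoulli_pmf (sel ustar (x i))))) \<in> sample_space M n \<rightarrow>\<^sub>M prob_algebra (binary_space n)"
    unfolding binary_space_def
  proof (intro measurable_PiM_kernel measurable_bernoulli_kernel)
    fix i assume "i \<in> {..<n}"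
    then show "(\<lambda>x. sel ustar (x i)) \<in> borel_measurable (sample_space M n)"
      by (intro measurable_compose[OF measurable_sample_component sel_measurable]) simp
  qed (use sel_bounds[OF ustar_bounds] in auto)
  then show ?thesis by (simp add: decision_rule_def NP_rule_def[abs_def])
qed

lemma integral_NP:
  assumes i: "i < n" and g: "g \<in> borel_measurable M" "\<And>x. x \<in> space M \<Longrightarrow> 0 \<le> g x \<and> g x \<le> (1::real)"
  shows "(\<integral>\<omega>. of_bool (dec \<omega> i) * g (obs \<omega> i) \<partial>J n (NP n)) = (\<integral>x. g x * sel ustar x \<partial>P)"
proof -
  have s: "0 \<le> sel ustar x \<and> sel ustar x \<le> 1" for x using sel_bounds[OF ustar_bounds] by auto
  have "(\<integral>\<omega>. of_bool (dec \<omega> i) * g (obs \<omega> i) \<partial>J n (NP n)) =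
    (\<integral>x. (\<integral>d. (\<integral>\<theta>. of_bool (d i) * g (x i) \<partial>posterior n x) \<partial>NP n x) \<partial>Pn n)"
    using measurable_triple_component(2)[where c="of_bool", OF i] measurable_triple_component(3)[OF i g(1)]
      g(2)[OF sample_in_space[OF _ i]]
    by (subst integral_J[OF NP_decision_rule, where C=1]) (auto simp: space_pair_measure intro!: borel_measurable_times)
  also have "\<dots> = (\<integral>x. g (x i) * sel ustar (x i) \<partial>Pn n)"
  proof (rule Bochner_Integration.integral_cong[OF refl])
    fix x assume "x \<in> space (Pn n)"
    then have x: "x \<in> space (sample_space M n)" by (simp add: space_Pn)
    have "(\<integral>d. of_bool (d i) \<partial>NP n x) = sel ustar (x i)"
      unfolding NP_rule_def using i s by (subst integral_bernoulli_component[where c="of_bool"]) auto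
    then show "(\<integral>d. (\<integral>\<theta>. of_bool (d i) * g (x i) \<partial>posterior n x) \<partial>NP n x) = g (x i) * sel ustar (x i)"
      using posterior_facts[OF x] by simp
  qed
  also have "\<dots> = (\<integral>x. g x * sel ustar x \<partial>P)"
    by (intro integral_Pn_component[OF i] borel_measurable_times g(1) sel_measurable)
  finally show ?thesis .
qed

text \<open>The rule lies exactly on the curve, since given the observations its coins have mean
  \<open>sel ustar\<close>.\<close>

lemma NP_averages:
  assumes n: "n \<ge> 1" shows "avg_dec n (NP n) = ustar" "avg_risk n (NP n) = risk ustar"
proof -
  have W1: "x \<in> space M \<Longrightarrow> \<bar>W x\<bar> \<le> 1" for x using W_bounds[of x] by simp
  note I = integrable_J_components[OF NP_decision_rule _ W_measurable W1]
  have "(\<integral>\<omega>. of_bool (dec \<omega> i) \<partial>J n (NP n)) = ustar" if "i < n" for i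
    using integral_NP[OF that, of "\<lambda>_. 1"] integral_sel[OF ustar_bounds] by simp
  then show "avg_dec n (NP n) = ustar"
    unfolding avg_dec_def discoveries_def using I(1) n by (subst Bochner_Integration.integral_sum) auto
  have "(\<integral>\<omega>. of_bool (dec \<omega> i) * W (obs \<omega> i) \<partial>J n (NP n)) = risk ustar" if "i < n" for i
    using integral_NP[OF that W_measurable] W_bounds by (simp add: risk_def)
  then show "avg_risk n (NP n) = risk ustar"
    unfolding avg_risk_def using I(5) n by (subst Bochner_Integration.integral_sum) auto
qed

text \<open>The Neyman-Pearson rule attains the infimum. A competitor with a fraction D of
  discoveries lies on or above the curve, so its mFDR constraint gives
  \<open>risk D \<le> \<alpha> * D\<close>, hence D \<le> \<open>ustar\<close>, and
  \<open>fnr_at\<close> is decreasing. As \<open>m\<close> is arbitrary, the value does not depend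
  on the sample size.\<close>

lemma mFNR_star_eq:
  assumes m: "m \<ge> 1" shows "mFNR_star M \<pi>1 f0 f1 m \<alpha> = fnr_at ustar"
proof -
  let ?S = "{mFNR M \<pi>1 f0 f1 m K | K. decision_rule M m K \<and> mFDR M \<pi>1 f0 f1 m K \<le> \<alpha>}"
  \<comment> \<open>For \<open>ustar = 0\<close> the expected number of discoveries is 0 and the
    mFDR is 0/0 = 0.\<close>
  have "mFDR M \<pi>1 f0 f1 m (NP m) \<le> \<alpha>"
    using risk_ustar ustar_bounds \<alpha>
    by (cases "ustar = 0") (auto simp: mFDR_eq[OF NP_decision_rule m] NP_averages[OF m] divide_le_eq)
  moreover have "mFNR M \<pi>1 f0 f1 m (NP m) = fnr_at ustar"
    by (simp add: mFNR_eq[OF NP_decision_rule m] NP_averages[OF m] fnr_at_def)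
  ultimately have mem: "fnr_at ustar \<in> ?S" using NP_decision_rule by force
  show ?thesis
    unfolding mFNR_star_def
  proof (rule cInf_eq_minimum[OF mem])
    fix y assume "y \<in> ?S"
    then obtain K where K: "decision_rule M m K" and le: "mFDR M \<pi>1 f0 f1 m K \<le> \<alpha>" and y: "y = mFNR M \<pi>1 f0 f1 m K"
      by auto
    define D where "D = avg_dec m K"
    have D: "D \<in> {0..1}" unfolding D_def by (rule avg_dec_bounds[OF K m])
    have B: "risk D \<le> avg_risk m K" using avg_risk_ge[OF K m D] by (simp add: D_def)
    have "risk D \<le> \<alpha> * D"
    proof (cases "D = 0")
      case False
      then have "D > 0" using D by auto
      then show ?thesis using le B by (simp add: mFDR_eq[OF K m] D_def divide_le_eq)
    qed (simp add: risk_0)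
    then have "D \<le> ustar" by (rule ustar_upper[OF D])
    then have "fnr_at ustar \<le> fnr_at D" by (rule fnr_at_antimono[OF D ustar_bounds])
    also have "\<dots> \<le> y"
      unfolding y mFNR_eq[OF K m] fnr_at_def using D B by (auto simp: D_def intro!: divide_right_mono)
    finally show "fnr_at ustar \<le> y" .
  qed
qed

end

section \<open>Achievability and converse\<close>

text \<open>The margin \<open>e\<close> solves r w + 7 e = (r + \<epsilon>) (w - 2 e). The 2 is the
  deviation of the denominators in \<open>NP_concentration\<close>, the 7 the largest deviation of a
  numerator there.\<close>

lemma ratio_le_of_near_averages:
  fixes r w \<epsilon> e :: real
  assumes r: "0 \<le> r" and \<epsilon>: "0 < \<epsilon>" and e: "e = \<epsilon> * w / (7 + 2 * (r + \<epsilon>))"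
    and num: "num \<le> real n * (r * w + 7 * e)" and den: "real n * (w - 2 * e) \<le> den"
  shows "num / max 1 den \<le> r + \<epsilon>"
proof -
  have pos: "7 + 2 * (r + \<epsilon>) > 0" using r \<epsilon> by simp
  then have "e * (7 + 2 * (r + \<epsilon>)) = \<epsilon> * w" by (simp add: e)
  then have "r * w + 7 * e = (r + \<epsilon>) * (w - 2 * e)" by (simp add: algebra_simps)
  then have "num \<le> (r + \<epsilon>) * (real n * (w - 2 * e))" using num by (simp add: mult_ac)
  also have "\<dots> \<le> (r + \<epsilon>) * max 1 den" using den r \<epsilon> by (intro mult_left_mono) auto
  finally show ?thesis by (simp add: divide_le_eq)
qed

text \<open>The count is an integer, so once it is positive the \<open>max 1\<close> in the
  denominator disappears.\<close>

lemma discoveries_ge_1: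
  assumes "discoveries n d \<noteq> 0" shows "1 \<le> discoveries n d"
proof -
  have "discoveries n d = real (card ({..<n} \<inter> {i. d i}))"
    by (simp add: discoveries_def of_bool_def sum.If_cases)
  then obtain k where "discoveries n d = real k" by blast
  then show ?thesis using assms by (cases k) auto
qed

text \<open>FNP is linear in the labels, with weights that depend on the decisions alone,
  denominator included. Labels may therefore be replaced by their posterior means exactly, and the
  new integrand is the conditional mean of FNP given observations and decisions.\<close>

lemma (in two_group) FNR_eq_posterior:
  assumes K: "decision_rule M n K"
  shows "FNR M \<pi>1 f0 f1 n K =
    (\<integral>\<omega>. (\<Sum>i<n. (1 - of_bool (dec \<omega> i)) * (1 - W (obs \<omega> i))) / max 1 (nondiscoveries n (dec \<omega>)) \<partial>J n K)"
proof -
  interpret prob_space "J n K" by (rule prob_space_J[OF K])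
  define v where "v i z = (1 - of_bool (snd z i)) / max 1 (nondiscoveries n (snd z))"
    for i and z :: "(nat \<Rightarrow> 'x) \<times> (nat \<Rightarrow> bool)"
  have vm: "v i \<in> borel_measurable (sample_space M n \<Otimes>\<^sub>M binary_space n)" if i: "i < n" for i
  proof -
    have d: "(\<lambda>z. of_bool (snd z j) :: real) \<in> borel_measurable (sample_space M n \<Otimes>\<^sub>M binary_space n)" if "j < n" for j
      by (rule measurable_compose[OF measurable_compose[OF measurable_snd measurable_binary_component[OF that]]]) simp
    show ?thesis
      unfolding v_def nondiscoveries_def using d i
      by (intro borel_measurable_divide borel_measurable_max borel_measurable_sum borel_measurable_diff borel_measurable_const) auto
  qed
  have vb: "0 \<le> v i z \<and> v i z \<le> 1" for i z
    by (auto simp: v_def divide_le_eq)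
  have vJ: "(\<lambda>\<omega>. v i (snd \<omega>)) \<in> borel_measurable (triple_space M n)" if "i < n" for i
    by (rule measurable_compose[OF measurable_snd vm[OF that]])
  have i1: "integrable (J n K) (\<lambda>\<omega>. v i (snd \<omega>))" if "i < n" for i
    by (rule integrable_J[OF K vJ[OF that], where C=1]) (use vb in auto)
  have i2: "integrable (J n K) (\<lambda>\<omega>. v i (snd \<omega>) * (1 - of_bool (lab \<omega> i)))" if i: "i < n" for i
    using vb by (intro integrable_J[OF K borel_measurable_times[OF vJ[OF i] measurable_triple_component(1)[where c="\<lambda>b. 1 - of_bool b", OF i]], where C=1])
      (auto simp: abs_mult)
  have i3: "integrable (J n K) (\<lambda>\<omega>. v i (snd \<omega>) * W (obs \<omega> i))" if i: "i < n" for i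
    using vb W_bounds sample_in_space[OF _ i]
    by (intro integrable_J[OF K borel_measurable_times[OF vJ[OF i] measurable_triple_component(3)[OF i W_measurable]], where C=1])
      (auto simp: abs_mult space_pair_measure intro!: mult_le_one)
  have "FNR M \<pi>1 f0 f1 n K = (\<integral>\<omega>. (\<Sum>i<n. v i (snd \<omega>) - v i (snd \<omega>) * (1 - of_bool (lab \<omega> i))) \<partial>J n K)"
    unfolding FNR_def case_prod_unfold FNP_def false_nondiscoveries_def v_def sum_divide_distrib
    by (intro Bochner_Integration.integral_cong sum.cong refl) (simp add: field_simps)
  also have "\<dots> = (\<Sum>i<n. (\<integral>\<omega>. v i (snd \<omega>) \<partial>J n K) - (\<integral>\<omega>. v i (snd \<omega>) * (1 - of_bool (lab \<omega> i)) \<partial>J n K))"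
    using i1 i2 by (subst Bochner_Integration.integral_sum) auto
  also have "\<dots> = (\<Sum>i<n. (\<integral>\<omega>. v i (snd \<omega>) \<partial>J n K) - (\<integral>\<omega>. v i (snd \<omega>) * W (obs \<omega> i) \<partial>J n K))"
    using integral_J_null_weight[OF K _ vm] vb by (intro sum.cong refl arg_cong2[where f="(-)"]) auto
  also have "\<dots> = (\<integral>\<omega>. (\<Sum>i<n. v i (snd \<omega>) - v i (snd \<omega>) * W (obs \<omega> i)) \<partial>J n K)"
    using i1 i3 by (subst Bochner_Integration.integral_sum) auto
  also have "\<dots> = (\<integral>\<omega>. (\<Sum>i<n. (1 - of_bool (dec \<omega> i)) * (1 - W (obs \<omega> i))) / max 1 (nondiscoveries n (dec \<omega>)) \<partial>J n K)"
    unfolding v_def sum_divide_distrib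
    by (intro Bochner_Integration.integral_cong sum.cong refl) (simp add: field_simps)
  finally show ?thesis .
qed

section \<open>Achievability\<close>

context np_level
begin

text \<open>Given the observations the coins of the Neyman-Pearson rule are independent with means
  \<open>sel ustar\<close>, so Hoeffding applies under \<open>NP n x\<close>.\<close>

lemma decision_concentration:
  assumes e: "e > 0" and g: "g \<in> borel_measurable M" "\<And>x. x \<in> space M \<Longrightarrow> 0 \<le> g x \<and> g x \<le> (1::real)"
  shows "whp (\<lambda>n. J n (NP n)) (\<lambda>n \<omega>.
    \<bar>(\<Sum>i<n. of_bool (dec \<omega> i) * g (obs \<omega> i)) - (\<Sum>i<n. g (obs \<omega> i) * sel ustar (obs \<omega> i))\<bar> < real n * e)"
proof (rule whpI[where c="\<lambda>n. hoeffding_tail n e"])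
  fix n :: nat assume n: "n \<ge> 1"
  note K = NP_decision_rule[of n]
  have s: "0 \<le> sel ustar x \<and> sel ustar x \<le> 1" for x using sel_bounds[OF ustar_bounds] by auto
  define Q where "Q \<omega> = \<bar>(\<Sum>i<n. of_bool (dec \<omega> i) * g (obs \<omega> i)) - (\<Sum>i<n. g (obs \<omega> i) * sel ustar (obs \<omega> i))\<bar>"
    for \<omega> :: "(nat \<Rightarrow> bool) \<times> (nat \<Rightarrow> 'a) \<times> (nat \<Rightarrow> bool)"
  define A where "A = {\<omega>\<in>space (triple_space M n). \<not> Q \<omega> < real n * e}"
  have "Q \<in> borel_measurable (triple_space M n)"
    unfolding Q_def
    by (intro borel_measurable_abs borel_measurable_diff borel_measurable_sum borel_measurable_times
        measurable_triple_component(2)[where c="of_bool"] measurable_triple_component(3) g(1) sel_measurable) auto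
  then have A: "A \<in> sets (triple_space M n)" unfolding A_def by measurable
  have eqA: "{\<omega>\<in>space (J n (NP n)). \<not> \<bar>(\<Sum>i<n. of_bool (dec \<omega> i) * g (obs \<omega> i)) - (\<Sum>i<n. g (obs \<omega> i) * sel ustar (obs \<omega> i))\<bar> < real n * e} = A"
    unfolding A_def Q_def space_J[OF K] ..
  show "{\<omega>\<in>space (J n (NP n)). \<not> \<bar>(\<Sum>i<n. of_bool (dec \<omega> i) * g (obs \<omega> i)) - (\<Sum>i<n. g (obs \<omega> i) * sel ustar (obs \<omega> i))\<bar> < real n * e} \<in> sets (J n (NP n))"
    unfolding eqA sets_J[OF K] by (rule A)
  show "measure (J n (NP n)) {\<omega>\<in>space (J n (NP n)). \<not> \<bar>(\<Sum>i<n. of_bool (dec \<omega> i) * g (obs \<omega> i)) - (\<Sum>i<n. g (obs \<omega> i) * sel ustar (obs \<omega> i))\<bar> < real n * e} \<le> hoeffding_tail n e"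
    unfolding eqA
  proof (rule measure_J_le[OF K A hoeffding_tail_nonneg])
    fix x assume x: "x \<in> space (sample_space M n)"
    define B where "B = {d\<in>space (binary_space n). \<bar>(\<Sum>i<n. of_bool (d i) * g (x i)) - (\<Sum>i<n. g (x i) * sel ustar (x i))\<bar> \<ge> real n * e}"
    \<comment> \<open>The event does not involve the labels, so its posterior mass is 0 or
      1.\<close>
    have "measure (posterior n x) {\<theta>\<in>space (binary_space n). (\<theta>, x, d) \<in> A} = indicator B d"
      if d: "d \<in> space (NP n x)" for d
    proof -
      have d: "d \<in> space (binary_space n)" using d K_facts[OF K x] by simp
      have "{\<theta>\<in>space (binary_space n). (\<theta>, x, d) \<in> A} = (if d \<in> B then space (binary_space n) else {})"
        using x d by (simp add: A_def Q_def B_def space_pair_measure not_less)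
      then show ?thesis using posterior_facts[OF x] by simp
    qed
    then have "(\<integral>d. measure (posterior n x) {\<theta>\<in>space (binary_space n). (\<theta>, x, d) \<in> A} \<partial>NP n x) = (\<integral>d. indicator B d \<partial>NP n x)"
      by (intro Bochner_Integration.integral_cong refl) simp
    also have "\<dots> = measure (NP n x) B"
    proof -
      have "B \<subseteq> space (binary_space n)" by (auto simp: B_def)
      then show ?thesis using K_facts[OF K x] by (simp add: Int_absorb2)
    qed
    also have "B = {d\<in>space (NP n x). \<bar>(\<Sum>i<n. of_bool (d i) * g (x i)) -
        (\<Sum>i<n. \<integral>b. of_bool b * g (x i) \<partial>measure_pmf (bernoulli_pmf (sel ustar (x i))))\<bar> \<ge> real n * e}"
      unfolding B_def K_facts(3)[OF K x] using s by (simp add: mult.commute)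
    also have "measure (NP n x) \<dots> \<le> hoeffding_tail n e"
      unfolding NP_rule_def using n e g(2)[OF sample_in_space[OF x]]
      by (intro PiM_hoeffding) (auto intro: prob_space_measure_pmf)
    finally show "(\<integral>d. measure (posterior n x) {\<theta>\<in>space (binary_space n). (\<theta>, x, d) \<in> A} \<partial>NP n x) \<le> hoeffding_tail n e" .
  qed
qed (rule hoeffding_tail_tendsto_0[OF e])

text \<open>The constants count Hoeffding errors. Discoveries pass through the sum of
  \<open>sel\<close> (2), false discoveries through two sums of \<open>W\<close> (3), and the number
  of true nulls through the sum of \<open>W\<close> (2). False nondiscoveries combine all of them: 2
  + 3 + 2 = 7.\<close>

lemma NP_concentration:
  assumes e: "e > 0"
  shows "whp (\<lambda>n. J n (NP n)) (\<lambda>n \<omega>.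
      \<bar>discoveries n (dec \<omega>) - real n * ustar\<bar> < 2 * (real n * e) \<and>
      \<bar>false_discoveries n (lab \<omega>) (dec \<omega>) - real n * risk ustar\<bar> < 3 * (real n * e) \<and>
      \<bar>false_nondiscoveries n (lab \<omega>) (dec \<omega>) - real n * (1 - ustar - \<pi>0 + risk ustar)\<bar> < 7 * (real n * e))"
proof -
  have K: "\<And>n. n \<ge> 1 \<Longrightarrow> decision_rule M n (NP n)" by (rule NP_decision_rule)
  have s: "0 \<le> sel ustar x \<and> sel ustar x \<le> 1" for x using sel_bounds[OF ustar_bounds] by auto
  have Wb: "0 \<le> W x \<and> W x \<le> 1" if "x \<in> space M" for x using W_bounds[OF that] by simp
  have sWm: "(\<lambda>x. W x * sel ustar x) \<in> borel_measurable M"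
    by (intro borel_measurable_times W_measurable sel_measurable)
  have sW: "0 \<le> W x * sel ustar x \<and> W x * sel ustar x \<le> 1" if "x \<in> space M" for x
    using s[of x] Wb[OF that] by (auto intro: mult_le_one)
  have h1: "whp (\<lambda>n. J n (NP n)) (\<lambda>n \<omega>.
      \<bar>(\<Sum>i<n. of_bool (dec \<omega> i) * 1) - (\<Sum>i<n. 1 * sel ustar (obs \<omega> i))\<bar> < real n * e)"
    by (rule decision_concentration[OF e]) auto
  have h2: "whp (\<lambda>n. J n (NP n)) (\<lambda>n \<omega>.
      \<bar>(\<Sum>i<n. of_bool (dec \<omega> i) * (1 - of_bool (lab \<omega> i))) - (\<Sum>i<n. of_bool (dec \<omega> i) * W (obs \<omega> i))\<bar> < real n * e)"
    by (rule posterior_concentration[OF K e, where c="of_bool"]) auto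
  have h3: "whp (\<lambda>n. J n (NP n)) (\<lambda>n \<omega>.
      \<bar>(\<Sum>i<n. 1 * (1 - of_bool (lab \<omega> i))) - (\<Sum>i<n. 1 * W (obs \<omega> i))\<bar> < real n * e)"
    by (rule posterior_concentration[OF K e, where c="\<lambda>_. 1"]) auto
  note h = whp_conj[OF h1
      whp_conj[OF observation_concentration[OF K e sel_measurable s]
      whp_conj[OF h2
      whp_conj[OF decision_concentration[OF e W_measurable Wb]
      whp_conj[OF observation_concentration[OF K e sWm sW]
      whp_conj[OF h3
      observation_concentration[OF K e W_measurable Wb]]]]]]]
  show ?thesis
  proof (rule whp_mono[OF h])
    fix n and \<omega> :: "(nat \<Rightarrow> bool) \<times> (nat \<Rightarrow> 'a) \<times> (nat \<Rightarrow> bool)"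
    let ?s = "\<Sum>i<n. sel ustar (obs \<omega> i)"
    let ?Ws = "\<Sum>i<n. W (obs \<omega> i) * sel ustar (obs \<omega> i)" and ?dW = "\<Sum>i<n. of_bool (dec \<omega> i) * W (obs \<omega> i)"
    let ?W = "\<Sum>i<n. W (obs \<omega> i)" and ?l = "\<Sum>i<n. 1 - of_bool (lab \<omega> i) :: real"
    assume "\<bar>(\<Sum>i<n. of_bool (dec \<omega> i) * 1) - (\<Sum>i<n. 1 * sel ustar (obs \<omega> i))\<bar> < real n * e \<and>
      \<bar>?s - real n * (\<integral>x. sel ustar x \<partial>P)\<bar> < real n * e \<and>
      \<bar>(\<Sum>i<n. of_bool (dec \<omega> i) * (1 - of_bool (lab \<omega> i))) - ?dW\<bar> < real n * e \<and>
      \<bar>?dW - ?Ws\<bar> < real n * e \<and>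
      \<bar>?Ws - real n * (\<integral>x. W x * sel ustar x \<partial>P)\<bar> < real n * e \<and>
      \<bar>(\<Sum>i<n. 1 * (1 - of_bool (lab \<omega> i))) - (\<Sum>i<n. 1 * W (obs \<omega> i))\<bar> < real n * e \<and>
      \<bar>?W - real n * (\<integral>x. W x \<partial>P)\<bar> < real n * e"
    then have a: "\<bar>discoveries n (dec \<omega>) - ?s\<bar> < real n * e" "\<bar>?s - real n * ustar\<bar> < real n * e"
      "\<bar>false_discoveries n (lab \<omega>) (dec \<omega>) - ?dW\<bar> < real n * e" "\<bar>?dW - ?Ws\<bar> < real n * e"
      "\<bar>?Ws - real n * risk ustar\<bar> < real n * e" "\<bar>?l - ?W\<bar> < real n * e" "\<bar>?W - real n * \<pi>0\<bar> < real n * e"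
      unfolding mult_1 mult_1_right discoveries_def[symmetric] false_discoveries_def[symmetric]
        integral_sel[OF ustar_bounds] risk_def[symmetric] integral_W by blast+
    have "false_nondiscoveries n (lab \<omega>) (dec \<omega>) = real n - discoveries n (dec \<omega>) - ?l + false_discoveries n (lab \<omega>) (dec \<omega>)"
      unfolding false_nondiscoveries_eq nondiscoveries_eq ..
    then have b: "false_nondiscoveries n (lab \<omega>) (dec \<omega>) - real n * (1 - ustar - \<pi>0 + risk ustar) =
        (- (discoveries n (dec \<omega>) - real n * ustar)
        - (?l - real n * \<pi>0)) + (false_discoveries n (lab \<omega>) (dec \<omega>) - real n * risk ustar)"
      by (simp add: algebra_simps)
    have "\<bar>discoveries n (dec \<omega>) - real n * ustar\<bar> < 2 * (real n * e)" using a(1,2) by linarith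
    moreover have "\<bar>false_discoveries n (lab \<omega>) (dec \<omega>) - real n * risk ustar\<bar> < 3 * (real n * e)"
      using a(3-5) by linarith
    moreover have "\<bar>?l - real n * \<pi>0\<bar> < 2 * (real n * e)" using a(6,7) by linarith
    ultimately show "\<bar>discoveries n (dec \<omega>) - real n * ustar\<bar> < 2 * (real n * e) \<and>
      \<bar>false_discoveries n (lab \<omega>) (dec \<omega>) - real n * risk ustar\<bar> < 3 * (real n * e) \<and>
      \<bar>false_nondiscoveries n (lab \<omega>) (dec \<omega>) - real n * (1 - ustar - \<pi>0 + risk ustar)\<bar> < 7 * (real n * e)"
      unfolding b by linarith
  qed
qed

lemma NP_FDP_whp:
  assumes \<epsilon>: "\<epsilon> > 0"
  shows "whp (\<lambda>n. J n (NP n)) (\<lambda>n \<omega>. FDP n (lab \<omega>) (dec \<omega>) \<le> \<alpha> + \<epsilon>)"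
proof (cases "ustar = 0")
  \<comment> \<open>The discoveries give no denominator of order n, but their expected number is 0,
    so almost surely there are none and FDP is 0.\<close>
  case True
  have "AE \<omega> in J n (NP n). FDP n (lab \<omega>) (dec \<omega>) \<le> \<alpha> + \<epsilon>" if n: "n \<ge> 1" for n
  proof -
    note K = NP_decision_rule[of n]
    have "integrable (J n (NP n)) (\<lambda>\<omega>. discoveries n (dec \<omega>))"
      using counts_bounds by (intro integrable_J[OF K measurable_counts(1), where C="real n"]) auto
    moreover have "(\<integral>\<omega>. discoveries n (dec \<omega>) \<partial>J n (NP n)) = 0"
      by (simp add: expected_counts(1)[OF K n] NP_averages(1)[OF n] True)
    ultimately have "AE \<omega> in J n (NP n). discoveries n (dec \<omega>) = 0"
      by (subst (asm) integral_nonneg_eq_0_iff_AE) (auto simp: counts_bounds)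
    then show ?thesis
    proof eventually_elim
      case (elim \<omega>)
      then have "false_discoveries n (lab \<omega>) (dec \<omega>) = 0"
        using counts_bounds(5,6)[of n "lab \<omega>" "dec \<omega>"] by simp
      then show ?case using \<alpha> \<epsilon> by (simp add: FDP_def)
    qed
  qed
  then show ?thesis by (intro whp_AE prob_space_J NP_decision_rule)
next
  case False
  then have u: "ustar > 0" using ustar_bounds by auto
  define e where "e = \<epsilon> * ustar / (7 + 2 * (\<alpha> + \<epsilon>))"
  have "e > 0" unfolding e_def using u \<epsilon> \<alpha> by (intro divide_pos_pos mult_pos_pos) auto
  show ?thesis
  proof (rule whp_mono[OF NP_concentration[OF \<open>e > 0\<close>]])
    fix n and \<omega> :: "(nat \<Rightarrow> bool) \<times> (nat \<Rightarrow> 'a) \<times> (nat \<Rightarrow> bool)"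
    assume a: "\<bar>discoveries n (dec \<omega>) - real n * ustar\<bar> < 2 * (real n * e) \<and>
      \<bar>false_discoveries n (lab \<omega>) (dec \<omega>) - real n * risk ustar\<bar> < 3 * (real n * e) \<and>
      \<bar>false_nondiscoveries n (lab \<omega>) (dec \<omega>) - real n * (1 - ustar - \<pi>0 + risk ustar)\<bar> < 7 * (real n * e)"
    have "real n * risk ustar \<le> real n * (\<alpha> * ustar)" using risk_ustar by (intro mult_left_mono) auto
    moreover have "0 \<le> real n * e" using \<open>e > 0\<close> by simp
    ultimately have "false_discoveries n (lab \<omega>) (dec \<omega>) \<le> real n * (\<alpha> * ustar + 7 * e)"
      "real n * (ustar - 2 * e) \<le> discoveries n (dec \<omega>)"
      using a by (simp_all add: ring_distribs) linarith+
    then show "FDP n (lab \<omega>) (dec \<omega>) \<le> \<alpha> + \<epsilon>"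
      unfolding FDP_def by (rule ratio_le_of_near_averages[OF \<alpha>(1) \<epsilon> e_def])
  qed
qed

lemma NP_FNP_whp:
  assumes \<epsilon>: "\<epsilon> > 0"
  shows "whp (\<lambda>n. J n (NP n)) (\<lambda>n \<omega>. FNP n (lab \<omega>) (dec \<omega>) \<le> fnr_at ustar + \<epsilon>)"
proof (cases "ustar = 1")
  \<comment> \<open>The mirror image of the case \<open>ustar = 0\<close> for FDP: almost surely
    there are no nondiscoveries.\<close>
  case True
  have "AE \<omega> in J n (NP n). FNP n (lab \<omega>) (dec \<omega>) \<le> fnr_at ustar + \<epsilon>" if n: "n \<ge> 1" for n
  proof -
    note K = NP_decision_rule[of n]
    have "integrable (J n (NP n)) (\<lambda>\<omega>. nondiscoveries n (dec \<omega>))"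
      using counts_bounds by (intro integrable_J[OF K measurable_counts(2), where C="real n"]) auto
    moreover have "(\<integral>\<omega>. nondiscoveries n (dec \<omega>) \<partial>J n (NP n)) = 0"
      by (simp add: expected_counts(2)[OF K n] NP_averages(1)[OF n] True)
    ultimately have "AE \<omega> in J n (NP n). nondiscoveries n (dec \<omega>) = 0"
      by (subst (asm) integral_nonneg_eq_0_iff_AE) (auto simp: counts_bounds)
    then show ?thesis
    proof eventually_elim
      case (elim \<omega>)
      then have "false_nondiscoveries n (lab \<omega>) (dec \<omega>) = 0"
        using counts_bounds(7,8)[of n "lab \<omega>" "dec \<omega>"] by simp
      then show ?case using \<epsilon> fnr_at_nonneg[OF ustar_bounds] by (simp add: FNP_def)
    qed
  qed
  then show ?thesis by (intro whp_AE prob_space_J NP_decision_rule)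
next
  case False
  then have u: "1 - ustar > 0" using ustar_bounds by auto
  define b where "b = fnr_at ustar"
  have b: "0 \<le> b" "b * (1 - ustar) = 1 - ustar - \<pi>0 + risk ustar"
    using fnr_at_nonneg[OF ustar_bounds] u by (simp_all add: b_def fnr_at_def)
  define e where "e = \<epsilon> * (1 - ustar) / (7 + 2 * (b + \<epsilon>))"
  have "e > 0" unfolding e_def using u \<epsilon> b by (intro divide_pos_pos mult_pos_pos) auto
  show ?thesis
    unfolding b_def[symmetric]
  proof (rule whp_mono[OF NP_concentration[OF \<open>e > 0\<close>]])
    fix n and \<omega> :: "(nat \<Rightarrow> bool) \<times> (nat \<Rightarrow> 'a) \<times> (nat \<Rightarrow> bool)"
    assume a: "\<bar>discoveries n (dec \<omega>) - real n * ustar\<bar> < 2 * (real n * e) \<and>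
      \<bar>false_discoveries n (lab \<omega>) (dec \<omega>) - real n * risk ustar\<bar> < 3 * (real n * e) \<and>
      \<bar>false_nondiscoveries n (lab \<omega>) (dec \<omega>) - real n * (1 - ustar - \<pi>0 + risk ustar)\<bar> < 7 * (real n * e)"
    have "false_nondiscoveries n (lab \<omega>) (dec \<omega>) \<le> real n * (b * (1 - ustar) + 7 * e)"
      using a unfolding b(2) by (simp add: ring_distribs) linarith
    moreover have "real n * (1 - ustar - 2 * e) \<le> nondiscoveries n (dec \<omega>)"
      using a by (simp add: ring_distribs nondiscoveries_eq) linarith
    ultimately show "FNP n (lab \<omega>) (dec \<omega>) \<le> b + \<epsilon>"
      unfolding FNP_def by (rule ratio_le_of_near_averages[OF b(1) \<epsilon> e_def])
  qed
qed

text \<open>Going strictly beyond \<open>ustar\<close> leaves a positive gap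
  \<open>risk v - \<alpha> * v\<close>, large enough to absorb fluctuations of order n e. On the
  event of small fluctuations and FDP \<le> \<alpha>, the conditional mean of FNP is then bounded
  below pathwise.\<close>

lemma fnr_at_le_beyond_ustar:
  assumes K: "\<And>n. n \<ge> 1 \<Longrightarrow> decision_rule M n (K n)"
    and fdp: "whp (\<lambda>n. J n (K n)) (\<lambda>n \<omega>. FDP n (lab \<omega>) (dec \<omega>) \<le> \<alpha>)"
    and fnr: "\<And>n. n \<ge> 1 \<Longrightarrow> FNR M \<pi>1 f0 f1 n (K n) \<le> \<beta>"
    and v: "ustar < v" "v < 1"
  shows "fnr_at v \<le> \<beta>"
proof (rule field_le_epsilon)
  fix \<eta> :: real assume \<eta>: "\<eta> > 0"
  have v01: "v \<in> {0..1}" "v > 0" using v ustar_bounds by auto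
  have s: "0 \<le> sel v x \<and> sel v x \<le> 1" for x using sel_bounds[OF v01(1)] by auto
  have Wb: "0 \<le> W x \<and> W x \<le> 1" if "x \<in> space M" for x using W_bounds[OF that] by simp
  have sWm: "(\<lambda>x. W x * sel v x) \<in> borel_measurable M"
    by (intro borel_measurable_times W_measurable sel_measurable)
  have sW: "0 \<le> W x * sel v x \<and> W x * sel v x \<le> 1" if "x \<in> space M" for x
    using s[of x] Wb[OF that] by (auto intro: mult_le_one)
  have gap: "risk v > \<alpha> * v" using ustar_upper[OF v01(1)] v by force
  \<comment> \<open>At 0 the tangent at v lies below \<open>risk 0\<close>, which is 0, so its slope
    is at least that of the chord from 0 to v; by the gap this chord is steeper than
    \<alpha>.\<close>
  have "risk v + quant v * (0 - v) \<le> risk 0" by (intro risk_subgradient v01) simp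
  then have "\<alpha> * v < quant v * v" using gap by (simp add: risk_0)
  then have q: "\<alpha> < quant v" using v01 by simp
  have "risk v + quant v * (1 - v) \<le> risk 1" by (intro risk_subgradient v01) simp
  then have qv: "quant v * (1 - v) \<le> \<pi>0 - risk v" by (simp add: risk_1)
  \<comment> \<open>The first bound pays for the three fluctuations in the bound on the discoveries,
    the second for those in the bound on the nulls among the nondiscoveries.\<close>
  define e where "e = min ((risk v - \<alpha> * v) / 3) (\<eta> * (1 - v) / 4)"
  have e: "e > 0" "3 * e \<le> risk v - \<alpha> * v" "4 * e \<le> \<eta> * (1 - v)"
    using gap \<eta> v min.cobounded1[of "(risk v - \<alpha> * v) / 3" "\<eta> * (1 - v) / 4"]
      min.cobounded2[of "(risk v - \<alpha> * v) / 3" "\<eta> * (1 - v) / 4"] by (simp_all add: e_def)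
  define F where "F n \<omega> = (\<Sum>i<n. (1 - of_bool (dec \<omega> i)) * (1 - W (obs \<omega> i))) / max 1 (nondiscoveries n (dec \<omega>))"
    for n and \<omega> :: "(nat \<Rightarrow> bool) \<times> (nat \<Rightarrow> 'a) \<times> (nat \<Rightarrow> bool)"
  have h2: "whp (\<lambda>n. J n (K n)) (\<lambda>n \<omega>.
      \<bar>(\<Sum>i<n. of_bool (dec \<omega> i) * (1 - of_bool (lab \<omega> i))) - (\<Sum>i<n. of_bool (dec \<omega> i) * W (obs \<omega> i))\<bar> < real n * e)"
    by (rule posterior_concentration[OF K e(1), where c="of_bool"]) auto
  note h = whp_conj[OF fdp
      whp_conj[OF h2
      whp_conj[OF observation_concentration[OF K e(1) sel_measurable s]
      whp_conj[OF observation_concentration[OF K e(1) sWm sW]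
      observation_concentration[OF K e(1) W_measurable Wb]]]]]
  have good: "whp (\<lambda>n. J n (K n)) (\<lambda>n \<omega>. fnr_at v - \<eta> \<le> F n \<omega>)"
  proof (rule whp_mono[OF h])
    fix n :: nat and \<omega> :: "(nat \<Rightarrow> bool) \<times> (nat \<Rightarrow> 'a) \<times> (nat \<Rightarrow> bool)"
    assume n: "n \<ge> 1"
    let ?D = "discoveries n (dec \<omega>)" and ?fd = "false_discoveries n (lab \<omega>) (dec \<omega>)"
    let ?s = "\<Sum>i<n. sel v (obs \<omega> i)"
    let ?Ws = "\<Sum>i<n. W (obs \<omega> i) * sel v (obs \<omega> i)" and ?dW = "\<Sum>i<n. of_bool (dec \<omega> i) * W (obs \<omega> i)"
    let ?W = "\<Sum>i<n. W (obs \<omega> i)"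
    assume "FDP n (lab \<omega>) (dec \<omega>) \<le> \<alpha> \<and>
      \<bar>(\<Sum>i<n. of_bool (dec \<omega> i) * (1 - of_bool (lab \<omega> i))) - ?dW\<bar> < real n * e \<and>
      \<bar>?s - real n * (\<integral>x. sel v x \<partial>P)\<bar> < real n * e \<and>
      \<bar>?Ws - real n * (\<integral>x. W x * sel v x \<partial>P)\<bar> < real n * e \<and>
      \<bar>?W - real n * (\<integral>x. W x \<partial>P)\<bar> < real n * e"
    then have a: "FDP n (lab \<omega>) (dec \<omega>) \<le> \<alpha>" "\<bar>?fd - ?dW\<bar> < real n * e" "\<bar>?s - real n * v\<bar> < real n * e"
      "\<bar>?Ws - real n * risk v\<bar> < real n * e" "\<bar>?W - real n * \<pi>0\<bar> < real n * e"
      unfolding false_discoveries_def[symmetric] integral_sel[OF v01(1)] risk_def[symmetric] integral_W by blast+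
    have fd: "?fd \<le> \<alpha> * ?D"
    proof (cases "?D = 0")
      case True
      then show ?thesis using counts_bounds(6)[of n "lab \<omega>" "dec \<omega>"] by simp
    next
      case False
      then have "?D \<ge> 1" by (rule discoveries_ge_1)
      then show ?thesis using a(1) by (simp add: FDP_def divide_le_eq)
    qed
    have np: "?Ws - quant v * ?s \<le> ?dW - quant v * ?D" by (rule sum_sel_le[OF v01(1)])
    have q01: "0 \<le> quant v" "quant v \<le> 1" using quant_bounds[OF v01(1)] by auto
    have qs: "\<bar>quant v * ?s - quant v * (real n * v)\<bar> \<le> real n * e"
    proof -
      have "\<bar>quant v * ?s - quant v * (real n * v)\<bar> = quant v * \<bar>?s - real n * v\<bar>"
        using q01 by (simp add: abs_mult flip: right_diff_distrib)
      also have "\<dots> \<le> 1 * \<bar>?s - real n * v\<bar>" using q01 by (intro mult_right_mono) auto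
      finally show ?thesis using a(3) by simp
    qed
    have low: "real n * risk v - 2 * (real n * e) + quant v * (?D - real n * v) \<le> ?dW"
      using np qs a(4) by (simp add: algebra_simps)
    \<comment> \<open>At n v discoveries the least possible null weight already exceeds the level by
      the gap, and by \<open>q\<close> each further discovery costs more than \<alpha>, so a larger
      count would violate FDP \<le> \<alpha>.\<close>
    have D: "?D \<le> real n * v"
    proof (rule ccontr)
      assume "\<not> ?thesis"
      then have D: "?D - real n * v > 0" by simp
      have "real n * (risk v - \<alpha> * v) - 3 * (real n * e) + (quant v - \<alpha>) * (?D - real n * v) < 0"
        using low fd a(2) by (simp add: algebra_simps)
      moreover have "real n * (3 * e) \<le> real n * (risk v - \<alpha> * v)" using e by (intro mult_left_mono) auto
      moreover have "(quant v - \<alpha>) * (?D - real n * v) > 0" using D q by simp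
      ultimately show False by simp
    qed
    have nd: "nondiscoveries n (dec \<omega>) \<ge> real n * (1 - v)" using D by (simp add: nondiscoveries_eq algebra_simps)
    moreover have "real n * (1 - v) > 0" using n v by simp
    ultimately have nd0: "nondiscoveries n (dec \<omega>) > 0" by linarith
    have "nondiscoveries n (dec \<omega>) = discoveries n (\<lambda>i. \<not> dec \<omega> i)"
      unfolding nondiscoveries_def discoveries_def by (intro sum.cong refl) simp
    then have nd1: "nondiscoveries n (dec \<omega>) \<ge> 1" using nd0 discoveries_ge_1[of n "\<lambda>i. \<not> dec \<omega> i"] by simp
    have num: "(\<Sum>i<n. (1 - of_bool (dec \<omega> i)) * (1 - W (obs \<omega> i))) = nondiscoveries n (dec \<omega>) - ?W + ?dW"
      unfolding nondiscoveries_def sum_subtractf[symmetric] sum.distrib[symmetric]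
      by (intro sum.cong refl) (simp add: algebra_simps)
    \<comment> \<open>The chord slope of \<open>risk\<close> from v to 1, which dominates the slope
      \<open>quant v\<close>. As D \<le> n v, replacing \<open>quant v\<close> by c only weakens the
      bound, and its terms then add up to c times the nondiscoveries.\<close>
    define c where "c = (\<pi>0 - risk v) / (1 - v)"
    have c: "fnr_at v = 1 - c" "\<pi>0 - risk v = c * (1 - v)"
      using v by (simp_all add: c_def fnr_at_def field_simps)
    have "quant v \<le> c" unfolding c_def using qv v by (simp add: le_divide_eq)
    then have "quant v * (real n * v - ?D) \<le> c * (real n * v - ?D)" using D by (intro mult_right_mono) auto
    moreover have "real n * (\<pi>0 - risk v) = c * (real n * (1 - v))" unfolding c by simp
    ultimately have "?W - ?dW \<le> c * nondiscoveries n (dec \<omega>) + 3 * (real n * e)"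
      using low a(5) by (simp add: nondiscoveries_eq algebra_simps)
    moreover have "real n * (4 * e) \<le> real n * (\<eta> * (1 - v))" using e by (intro mult_left_mono) auto
    moreover have "\<eta> * (real n * (1 - v)) \<le> \<eta> * nondiscoveries n (dec \<omega>)" using nd \<eta> by (intro mult_left_mono) auto
    moreover have "0 \<le> real n * e" using e by simp
    ultimately have "?W - ?dW \<le> (c + \<eta>) * nondiscoveries n (dec \<omega>)"
      by (simp add: algebra_simps)
    then show "fnr_at v - \<eta> \<le> F n \<omega>"
      unfolding F_def num c(1) using nd1 nd0 by (simp add: le_divide_eq algebra_simps)
  qed
  from whpE[OF good] obtain A where A: "\<And>n. n \<ge> 1 \<Longrightarrow> A n \<in> sets (J n (K n))" "(\<lambda>n. measure (J n (K n)) (A n)) \<longlonglongrightarrow> 0"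
    "\<And>n \<omega>. n \<ge> 1 \<Longrightarrow> \<omega> \<in> space (J n (K n)) - A n \<Longrightarrow> fnr_at v - \<eta> \<le> F n \<omega>" by blast
  have "(fnr_at v - \<eta>) * (1 - measure (J n (K n)) (A n)) \<le> \<beta>" if n: "n \<ge> 1" for n
  proof -
    interpret prob_space "J n (K n)" by (rule prob_space_J[OF K[OF n]])
    have W01: "0 \<le> 1 - W (obs \<omega> i) \<and> 1 - W (obs \<omega> i) \<le> 1" if "\<omega> \<in> space (triple_space M n)" "i < n" for \<omega> i
      using Wb[OF sample_in_space[OF _ that(2)]] that(1) by (auto simp: space_pair_measure)
    have Fb: "0 \<le> F n \<omega> \<and> F n \<omega> \<le> 1" if \<omega>: "\<omega> \<in> space (triple_space M n)" for \<omega>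
    proof -
      have 1: "0 \<le> (\<Sum>i<n. (1 - of_bool (dec \<omega> i)) * (1 - W (obs \<omega> i)))"
        using W01[OF \<omega>] by (intro sum_nonneg) auto
      have "(\<Sum>i<n. (1 - of_bool (dec \<omega> i)) * (1 - W (obs \<omega> i))) \<le> nondiscoveries n (dec \<omega>)"
        unfolding nondiscoveries_def using W01[OF \<omega>] by (intro sum_mono) auto
      with 1 show ?thesis unfolding F_def by (auto simp: divide_le_eq)
    qed
    have Fm: "F n \<in> borel_measurable (triple_space M n)"
      unfolding F_def
      by (intro borel_measurable_divide borel_measurable_max borel_measurable_sum borel_measurable_times borel_measurable_const
          measurable_counts measurable_triple_component(2)[where c="\<lambda>b. 1 - of_bool b"]
          borel_measurable_diff measurable_triple_component(3) W_measurable) auto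
    \<comment> \<open>\<open>F\<close> is nonnegative, so the exceptional set may be discarded, at
      the cost of a factor that tends to 1.\<close>
    have "(fnr_at v - \<eta>) * (1 - prob (A n)) = (\<integral>\<omega>. (fnr_at v - \<eta>) * indicator (space (J n (K n)) - A n) \<omega> \<partial>J n (K n))"
      using A(1)[OF n] sets.sets_into_space[OF A(1)[OF n]] by (simp add: prob_compl Int_absorb1 Int_Diff)
    also have "\<dots> \<le> (\<integral>\<omega>. F n \<omega> \<partial>J n (K n))"
    proof (rule integral_mono)
      show "integrable (J n (K n)) (F n)"
        using Fb by (intro integrable_J[OF K[OF n] Fm, where C=1]) auto
      show "integrable (J n (K n)) (\<lambda>\<omega>. (fnr_at v - \<eta>) * indicator (space (J n (K n)) - A n) \<omega>)"
        using A(1)[OF n] by (intro integrable_mult_right integrable_real_indicator) (auto simp: less_top[symmetric])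
      fix \<omega> assume "\<omega> \<in> space (J n (K n))"
      then show "(fnr_at v - \<eta>) * indicator (space (J n (K n)) - A n) \<omega> \<le> F n \<omega>"
        using A(3)[OF n, of \<omega>] Fb[of \<omega>] space_J[OF K[OF n]] by (auto simp: indicator_def)
    qed
    also have "\<dots> = FNR M \<pi>1 f0 f1 n (K n)"
      unfolding FNR_eq_posterior[OF K[OF n]] F_def ..
    also have "\<dots> \<le> \<beta>" by (rule fnr[OF n])
    finally show ?thesis .
  qed
  moreover have "(\<lambda>n. (fnr_at v - \<eta>) * (1 - measure (J n (K n)) (A n))) \<longlonglongrightarrow> (fnr_at v - \<eta>) * (1 - 0)"
    by (intro tendsto_intros A(2))
  ultimately have "fnr_at v - \<eta> \<le> \<beta>"
    by (intro LIMSEQ_le_const2[where X="\<lambda>n. (fnr_at v - \<eta>) * (1 - measure (J n (K n)) (A n))"]) auto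
  then show "fnr_at v \<le> \<beta> + \<eta>" by simp
qed

text \<open>The bound at every v beyond \<open>ustar\<close> passes to \<open>ustar\<close> by right
  continuity of \<open>fnr_at\<close>, provided \<open>ustar < 1\<close>.\<close>

lemma fnr_at_ustar_le:
  assumes K: "\<And>n. n \<ge> 1 \<Longrightarrow> decision_rule M n (K n)"
    and fdp: "whp (\<lambda>n. J n (K n)) (\<lambda>n \<omega>. FDP n (lab \<omega>) (dec \<omega>) \<le> \<alpha>)"
    and fnr: "\<And>n. n \<ge> 1 \<Longrightarrow> FNR M \<pi>1 f0 f1 n (K n) \<le> \<beta>"
  shows "fnr_at ustar \<le> \<beta>"
proof (cases "ustar = 1")
  case True
  \<comment> \<open>There is no v between \<open>ustar\<close> and 1, but \<open>fnr_at 1\<close> is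
    0/0 = 0, so a single nonnegative FNR suffices.\<close>
  have "0 \<le> FNR M \<pi>1 f0 f1 1 (K 1)"
    unfolding FNR_def by (intro integral_nonneg_AE AE_I2) (auto simp: FNP_bounds)
  then show ?thesis using fnr[of 1] True by (simp add: fnr_at_def)
next
  case False
  have u: "0 \<le> ustar" "ustar < 1" using ustar_bounds False by auto
  have ev: "eventually (\<lambda>v. ustar < v \<and> v < 1) (at_right ustar)"
    using u by (auto simp: eventually_at_right_field intro!: exI[of _ 1])
  have risk: "(risk \<longlongrightarrow> risk ustar) (at_right ustar)"
  proof (rule tendsto_sandwich[OF _ _ tendsto_const])
    show "eventually (\<lambda>v. risk ustar \<le> risk v) (at_right ustar)"
      using ev by eventually_elim (use u in \<open>auto intro: risk_mono\<close>)
    show "eventually (\<lambda>v. risk v \<le> risk ustar + (v - ustar)) (at_right ustar)"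
      using ev by eventually_elim (use u in \<open>auto intro: risk_lipschitz\<close>)
    have "((\<lambda>v. risk ustar + (v - ustar)) \<longlongrightarrow> risk ustar + (ustar - ustar)) (at_right ustar)" by (intro tendsto_intros)
    then show "((\<lambda>v. risk ustar + (v - ustar)) \<longlongrightarrow> risk ustar) (at_right ustar)" by simp
  qed
  have "(fnr_at \<longlongrightarrow> fnr_at ustar) (at_right ustar)"
    unfolding fnr_at_def using u by (intro tendsto_intros risk) auto
  moreover have "eventually (\<lambda>v. fnr_at v \<le> \<beta>) (at_right ustar)"
    using ev by eventually_elim (auto intro: fnr_at_le_beyond_ustar[OF K fdp fnr])
  ultimately show ?thesis by (rule tendsto_upperbound) simp
qed

end

theorem theorem2:
  fixes M :: "'x measure" and f0 f1 :: "'x \<Rightarrow> real" and \<pi>0 \<pi>1 \<alpha> :: real and m :: nat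
  assumes "0 < \<pi>0" "\<pi>0 < 1" "0 < \<pi>1" "\<pi>1 < 1" "\<pi>0 + \<pi>1 = 1"
    and "prob_density M f0" "prob_density M f1"
    and "0 \<le> \<alpha>" "\<alpha> \<le> 1"
    and "m \<ge> 1"
  shows
    "(\<forall>p. tie_breaking M \<pi>0 \<pi>1 f0 f1 p \<longrightarrow>
        (\<forall>\<beta> \<ge> mFNR_star M \<pi>1 f0 f1 m \<alpha>. \<forall>\<epsilon>>0.
          (\<lambda>n. \<P>((\<theta>, x, d) in joint_law M \<pi>1 f0 f1 n (NP_rule M \<pi>0 \<pi>1 f0 f1 p \<alpha> n).
                 FDP n \<theta> d \<le> \<alpha> + \<epsilon>)) \<longlonglongrightarrow> 1 \<and>
          (\<lambda>n. \<P>((\<theta>, x, d) in joint_law M \<pi>1 f0 f1 n (NP_rule M \<pi>0 \<pi>1 f0 f1 p \<alpha> n).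
                 FNP n \<theta> d \<le> \<beta> + \<epsilon>)) \<longlonglongrightarrow> 1)) \<and>
     (\<forall>K \<beta>.
        (\<forall>n\<ge>1. decision_rule M n (K n)) \<longrightarrow>
        (\<lambda>n. \<P>((\<theta>, x, d) in joint_law M \<pi>1 f0 f1 n (K n). FDP n \<theta> d \<le> \<alpha>)) \<longlonglongrightarrow> 1 \<longrightarrow>
        (\<forall>n\<ge>1. FNR M \<pi>1 f0 f1 n (K n) \<le> \<beta>) \<longrightarrow>
        \<beta> \<ge> mFNR_star M \<pi>1 f0 f1 m \<alpha>)"
proof -
  interpret two_group M f0 f1 \<pi>0 \<pi>1
    using assms by unfold_locales
  note \<alpha> = \<open>0 \<le> \<alpha>\<close> \<open>\<alpha> \<le> 1\<close>
  show ?thesis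
    unfolding case_prod_unfold prod.collapse
  proof (intro conjI allI impI)
    fix p and \<beta> \<epsilon> :: real
    assume "tie_breaking M \<pi>0 \<pi>1 f0 f1 p" and \<beta>: "mFNR_star M \<pi>1 f0 f1 m \<alpha> \<le> \<beta>" and \<epsilon>: "0 < \<epsilon>"
    then interpret np_level M f0 f1 \<pi>0 \<pi>1 p \<alpha>
      using \<alpha> by unfold_locales
    note K = NP_decision_rule
    show "(\<lambda>n. \<P>(\<omega> in J n (NP_rule M \<pi>0 \<pi>1 f0 f1 p \<alpha> n). FDP n (lab \<omega>) (dec \<omega>) \<le> \<alpha> + \<epsilon>)) \<longlonglongrightarrow> 1"
      by (rule prob_tendsto_1_of_whp[OF NP_FDP_whp[OF \<epsilon>] prob_space_J[OF K] ratio_events(1)[OF K]])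
    \<comment> \<open>A larger \<beta> only enlarges the event, so the bound at the optimal rate is
      enough.\<close>
    have "whp (\<lambda>n. J n (NP_rule M \<pi>0 \<pi>1 f0 f1 p \<alpha> n)) (\<lambda>n \<omega>. FNP n (lab \<omega>) (dec \<omega>) \<le> \<beta> + \<epsilon>)"
      using \<beta> by (intro whp_mono[OF NP_FNP_whp[OF \<epsilon>]]) (simp add: mFNR_star_eq[OF \<open>m \<ge> 1\<close>])
    then show "(\<lambda>n. \<P>(\<omega> in J n (NP_rule M \<pi>0 \<pi>1 f0 f1 p \<alpha> n). FNP n (lab \<omega>) (dec \<omega>) \<le> \<beta> + \<epsilon>)) \<longlonglongrightarrow> 1"
      by (rule prob_tendsto_1_of_whp[OF _ prob_space_J[OF K] ratio_events(2)[OF K]])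
  next
    fix K \<beta>
    assume "\<forall>n\<ge>1. decision_rule M n (K n)"
      and lim: "(\<lambda>n. \<P>(\<omega> in J n (K n). FDP n (lab \<omega>) (dec \<omega>) \<le> \<alpha>)) \<longlonglongrightarrow> 1"
      and fnr: "\<forall>n\<ge>1. FNR M \<pi>1 f0 f1 n (K n) \<le> \<beta>"
    then have K: "\<And>n. n \<ge> 1 \<Longrightarrow> decision_rule M n (K n)" by blast
    obtain p where "tie_breaking M \<pi>0 \<pi>1 f0 f1 p" using ex_tie_breaking by blast
    then interpret np_level M f0 f1 \<pi>0 \<pi>1 p \<alpha>
      using \<alpha> by unfold_locales
    have "whp (\<lambda>n. J n (K n)) (\<lambda>n \<omega>. FDP n (lab \<omega>) (dec \<omega>) \<le> \<alpha>)"
      by (rule whp_of_prob_tendsto_1[OF prob_space_J[OF K] ratio_events(1)[OF K] lim])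
    from fnr_at_ustar_le[OF K this] fnr show "mFNR_star M \<pi>1 f0 f1 m \<alpha> \<le> \<beta>"
      by (simp add: mFNR_star_eq[OF \<open>m \<ge> 1\<close>])
  qed
qed

end
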